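(* Let $(\mathcal U,\rho)$ be a complete metric space, let $F\in W(\mathbf R,\mathrm{cl}\,\mathcal U)$ and let $g\in W(\mathbf R,\mathcal U)$. Then for any function $\eta\in\mathcal N$ there exists a function $f\in W(\mathbf R,\mathcal U)$ such that $\mathrm{Mod}\,f\subset\mathrm{Mod}\,F+\mathrm{Mod}\,g$, $f(t)\in F(t)$ for almost every $t\in\mathbf R$, and $$\rho(f(t),g(t))\le\rho(g(t),F(t))+\eta(\rho(g(t),F(t)))\quad\text{for almost every }t\in\mathbf R.$$ Moreover, if $F\in W_p(\mathbf R,\mathrm{cl}_b\,\mathcal U)\subset W(\mathbf R,\mathrm{cl}\,\mathcal U)$, $p\ge1$, then $f\in W_p(\mathbf R,\mathcal U)$.
   Context: Below $(X,d)$ denotes a complete metric space. $\mathrm{meas}$ is Lebesgue measure on $\mathbf R$, and measurable sets are Lebesgue measurable. A function $f:\mathbf R\to X$ is elementary if there are points $x_j\in X$ and pairwise disjoint measurable sets $T_j\subset\mathbf R$, $j\in\mathbf N$, with $\mathrm{meas}(\mathbf R\setminus\bigcup_jT_j)=0$ and $f(t)=x_j$ for $t\in T_j$. A function $f:\mathbf R\to X$ is measurable if for every $\epsilon>0$ there is an elementary function $f_\epsilon$ with $\mathrm{ess\,sup}_{t\in\mathbf R}\,d(f(t),f_\epsilon(t))<\epsilon$; $M(\mathbf R,X)$ is the class of measurable functions, functions equal almost everywhere being identified. Put $d'(x,y)=\min\{1,d(x,y)\}$ and, for $l>0$, $D^{(d)}_l(f,g)=\sup_{\xi\in\mathbf R}\frac1l\int_\xi^{\xi+l}d'(f(t),g(t))\,dt$.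 A set $T\subset\mathbf R$ is relatively dense if there is $a>0$ with $[\xi,\xi+a]\cap T\ne\emptyset$ for all $\xi\in\mathbf R$. $W(\mathbf R,X)$ (equi-Weyl almost periodic functions) is the set of $f\in M(\mathbf R,X)$ such that for every $\epsilon>0$ there is $l>0$ for which the set of $\tau\in\mathbf R$ with $D^{(d)}_l(f(\cdot),f(\cdot+\tau))<\epsilon$ is relatively dense. For $f\in W(\mathbf R,X)$, a sequence $\tau_j\in\mathbf R$, $j\in\mathbf N$, is $f$-returning if for every $\epsilon>0$ there are $l>0$ and $j_0\in\mathbf N$ with $D^{(d)}_l(f(\cdot),f(\cdot+\tau_j))<\epsilon$ for all $j\ge j_0$. $\mathrm{Mod}\,f$ is the set of $\lambda\in\mathbf R$ such that $e^{i\lambda\tau_j}\to1$ for all $f$-returning sequences $\{\tau_j\}$; it is an additive subgroup (module) of $\mathbf R$. The sum $\Lambda_1+\Lambda_2$ of modules is the smallest additive subgroup of $\mathbf R$ containing both. For $p\ge1$ and a fixed $x_0\in X$, $M_p(\mathbf R,X)$ is the set of $f\in M(\mathbf R,X)$ with $\sup_{\xi\in\mathbf R}\int_\xi^{\xi+1}d^p(f(t),x_0)\,dt<+\infty$, and $D^{(d)}_{p,l}(f,g)=\bigl(\sup_{\xi\in\mathbf R}\frac1l\int_\xi^{\xi+l}d^p(f(t),g(t))\,dt\bigr)^{1/p}$ for $f,g\in M_p(\mathbf R,X)$, $l>0$. $W_p(\mathbf R,X)$ (equi-Weyl almost periodic functions of degree $p$) is the set of $f\in M_p(\mathbf R,X)$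 such that for every $\epsilon>0$ there is $l>0$ for which the set of $\tau\in\mathbf R$ with $D^{(d)}_{p,l}(f(\cdot),f(\cdot+\tau))<\epsilon$ is relatively dense. One has $W_p(\mathbf R,X)\subset W(\mathbf R,X)$. $\mathrm{cl}\,\mathcal U$ is the collection of non-empty closed subsets of $\mathcal U$ and $\mathrm{cl}_b\,\mathcal U$ the collection of non-empty closed bounded subsets; $\rho(x,A)=\inf_{y\in A}\rho(x,y)$. $\mathrm{dist}(A,B)=\max\{\sup_{x\in A}\rho(x,B),\sup_{x\in B}\rho(x,A)\}$ is the Hausdorff metric on $\mathrm{cl}_b\,\mathcal U$, and $\mathrm{dist}_{\rho'}$ is the Hausdorff metric on $\mathrm{cl}\,\mathcal U$ defined by the same formula with $\rho$ replaced by $\rho'=\min\{1,\rho\}$. These metric spaces are complete. $W(\mathbf R,\mathrm{cl}\,\mathcal U)$ is the space $W(\mathbf R,X)$ for $X=(\mathrm{cl}\,\mathcal U,\mathrm{dist}_{\rho'})$, and $W_p(\mathbf R,\mathrm{cl}_b\,\mathcal U)$ is the space $W_p(\mathbf R,X)$ for $X=(\mathrm{cl}_b\,\mathcal U,\mathrm{dist})$; $\mathrm{dist}_{\rho'}=\min\{1,\mathrm{dist}\}$ on $\mathrm{cl}_b\,\mathcal U$, so $W_p(\mathbf R,\mathrm{cl}_b\,\mathcal U)\subset W(\mathbf R,\mathrm{cl}\,\mathcal U)$. $\mathcal N$ is the set of non-decreasing functions $\eta:[0,+\infty)\to\mathbf R$ with $\eta(0)=0$ and $\eta(t)>0$ for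 all $t>0$. *)

theory Defs
  imports
    "HOL-Analysis.Analysis"
    "HOL-Probability.Essential_Supremum"
    "HOL-Computational_Algebra.Group_Closure"
begin

text \<open>A metric space is a carrier \<open>X\<close> with a distance \<open>d\<close>, as in the locale
  \<^locale>\<open>Metric_space\<close>, because the same definitions are used for a space of points and for a
  space of sets under a Hausdorff metric. Functions are representatives of their classes modulo
  equality almost everywhere, with all values in \<open>X\<close>.\<close>

definition elementary :: "'x set \<Rightarrow> (real \<Rightarrow> 'x) \<Rightarrow> bool" where
  "elementary X f \<longleftrightarrow> f \<in> UNIV \<rightarrow> X \<and>
     (\<exists>(x :: nat \<Rightarrow> 'x) (T :: nat \<Rightarrow> real set).
        (\<forall>j. x j \<in> X) \<and> (\<forall>j. T j \<in> sets lebesgue) \<and> disjoint_family T \<and>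
        emeasure lebesgue (UNIV - (\<Union>j. T j)) = 0 \<and>
        (\<forall>j. \<forall>t\<in>T j. f t = x j))"

text \<open>\<^const>\<open>esssup\<close> is \<open>\<infinity>\<close> on functions that are not measurable. This does not restrict the
  definition below: if \<open>f\<close> can be approximated for every \<open>\<epsilon>\<close>, then \<open>t \<mapsto> d (f t) (h t)\<close> is measurable
  for each elementary \<open>h\<close>, being almost everywhere a limit of countably valued measurable
  functions.\<close>

definition measurable_funs :: "'x set \<Rightarrow> ('x \<Rightarrow> 'x \<Rightarrow> real) \<Rightarrow> (real \<Rightarrow> 'x) set" where
  "measurable_funs X d = {f \<in> UNIV \<rightarrow> X. \<forall>\<epsilon>>0. \<exists>h. elementary X h \<and>
     esssup lebesgue (\<lambda>t. ereal (d (f t) (h t))) < ereal \<epsilon>}"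

definition trunc_dist :: "('x \<Rightarrow> 'x \<Rightarrow> real) \<Rightarrow> 'x \<Rightarrow> 'x \<Rightarrow> real" where
  "trunc_dist d x y = min 1 (d x y)"

definition weyl_dist :: "('x \<Rightarrow> 'x \<Rightarrow> real) \<Rightarrow> real \<Rightarrow> (real \<Rightarrow> 'x) \<Rightarrow> (real \<Rightarrow> 'x) \<Rightarrow> real" where
  "weyl_dist d l f g =
     (SUP \<xi>. (1 / l) * (LINT t:{\<xi>..\<xi> + l}|lebesgue. trunc_dist d (f t) (g t)))"

definition relatively_dense :: "real set \<Rightarrow> bool" where
  "relatively_dense T \<longleftrightarrow> (\<exists>a>0. \<forall>\<xi>. {\<xi>..\<xi> + a} \<inter> T \<noteq> {})"

definition weyl_ap :: "'x set \<Rightarrow> ('x \<Rightarrow> 'x \<Rightarrow> real) \<Rightarrow> (real \<Rightarrow> 'x) set" where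
  "weyl_ap X d = {f \<in> measurable_funs X d. \<forall>\<epsilon>>0. \<exists>l>0.
     relatively_dense {\<tau>. weyl_dist d l f (\<lambda>t. f (t + \<tau>)) < \<epsilon>}}"

definition returning :: "('x \<Rightarrow> 'x \<Rightarrow> real) \<Rightarrow> (real \<Rightarrow> 'x) \<Rightarrow> (nat \<Rightarrow> real) \<Rightarrow> bool" where
  "returning d f \<tau> \<longleftrightarrow>
     (\<forall>\<epsilon>>0. \<exists>l>0. \<exists>j0. \<forall>j\<ge>j0. weyl_dist d l f (\<lambda>t. f (t + \<tau> j)) < \<epsilon>)"

definition Mod :: "('x \<Rightarrow> 'x \<Rightarrow> real) \<Rightarrow> (real \<Rightarrow> 'x) \<Rightarrow> real set" where
  "Mod d f = {\<mu>. \<forall>\<tau>. returning d f \<tau> \<longrightarrow>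
     (\<lambda>j. exp (\<i> * complex_of_real (\<mu> * \<tau> j))) \<longlonglongrightarrow> 1}"

definition module_sum :: "real set \<Rightarrow> real set \<Rightarrow> real set" where
  "module_sum \<Lambda>1 \<Lambda>2 = group_closure (\<Lambda>1 \<union> \<Lambda>2)"

text \<open>The finiteness condition is stated with the extended nonnegative integral, since a real
  supremum or a Bochner integral would not detect divergence. In \<open>weyl_dist_p\<close>, real-valued
  integrals and suprema suffice: for \<open>f\<close> and \<open>g\<close> in \<open>Mp_funs\<close> they are finite.\<close>

definition Mp_funs :: "'x set \<Rightarrow> ('x \<Rightarrow> 'x \<Rightarrow> real) \<Rightarrow> 'x \<Rightarrow> real \<Rightarrow> (real \<Rightarrow> 'x) set" where
  "Mp_funs X d x0 p = {f \<in> measurable_funs X d.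
     (SUP \<xi>::real. \<integral>\<^sup>+t\<in>{\<xi>..\<xi> + 1}. ennreal (d (f t) x0 powr p) \<partial>lebesgue) < \<infinity>}"

definition weyl_dist_p ::
    "('x \<Rightarrow> 'x \<Rightarrow> real) \<Rightarrow> real \<Rightarrow> real \<Rightarrow> (real \<Rightarrow> 'x) \<Rightarrow> (real \<Rightarrow> 'x) \<Rightarrow> real" where
  "weyl_dist_p d p l f g =
     (SUP \<xi>. (1 / l) * (LINT t:{\<xi>..\<xi> + l}|lebesgue. d (f t) (g t) powr p)) powr (1 / p)"

definition weyl_ap_p :: "'x set \<Rightarrow> ('x \<Rightarrow> 'x \<Rightarrow> real) \<Rightarrow> 'x \<Rightarrow> real \<Rightarrow> (real \<Rightarrow> 'x) set" where
  "weyl_ap_p X d x0 p = {f \<in> Mp_funs X d x0 p. \<forall>\<epsilon>>0. \<exists>l>0.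
     relatively_dense {\<tau>. weyl_dist_p d p l f (\<lambda>t. f (t + \<tau>)) < \<epsilon>}}"

definition cl_sets :: "'a set \<Rightarrow> ('a \<Rightarrow> 'a \<Rightarrow> real) \<Rightarrow> 'a set set" where
  "cl_sets U \<rho> = {A. A \<noteq> {} \<and> closedin (Metric_space.mtopology U \<rho>) A}"

definition clb_sets :: "'a set \<Rightarrow> ('a \<Rightarrow> 'a \<Rightarrow> real) \<Rightarrow> 'a set set" where
  "clb_sets U \<rho> = {A \<in> cl_sets U \<rho>. Metric_space.mbounded U \<rho> A}"

definition point_set_dist :: "('a \<Rightarrow> 'a \<Rightarrow> real) \<Rightarrow> 'a \<Rightarrow> 'a set \<Rightarrow> real" where
  "point_set_dist \<rho> x A = (INF y\<in>A. \<rho> x y)"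

definition hausdorff_dist :: "('a \<Rightarrow> 'a \<Rightarrow> real) \<Rightarrow> 'a set \<Rightarrow> 'a set \<Rightarrow> real" where
  "hausdorff_dist \<rho> A B =
     max (SUP x\<in>A. point_set_dist \<rho> x B) (SUP x\<in>B. point_set_dist \<rho> x A)"

definition gauge_funs :: "(real \<Rightarrow> real) set" where
  "gauge_funs = {\<eta>. mono_on {0..} \<eta> \<and> \<eta> 0 = 0 \<and> (\<forall>t>0. \<eta> t > 0)}"

end

theory Submission
  imports Defs
begin

text \<open>
  All conditions on a function \<open>f\<close> are conditions on the kernel \<open>min 1 (d (f t) (f s))\<close> on the time axis.
  For an almost periodic kernel the upper mean measure of \<open>{t. e t (t + \<tau>) \<ge> \<epsilon>}\<close> gives a totally
  bounded, continuous pseudonorm \<open>N\<close> in \<open>\<tau>\<close>, and the module consists of the frequencies whose character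
  is continuous for \<open>N\<close>.

  The selection is built from the maximum \<open>e\<close> of the kernels of \<open>F\<close> and \<open>g\<close> by a Kuratowski--Ryll-Nardzewski
  iteration: at each stage the value is the first point of a countable set that satisfies finitely
  many inequalities \<open>v t < r\<close>, where \<open>v\<close> is uniformly continuous for \<open>e\<close>. All but countably many thresholds \<open>r\<close>
  are attained only on sets of small density, hence off a set of small density nearby values of
  \<open>(F, g)\<close> lead to nearby values of the selection. So common almost periods of \<open>F\<close> and \<open>g\<close> are almost periods
  of the selection, and every frequency of its module is continuous for \<open>N\<^sub>F + N\<^sub>g\<close>.

  Such a frequency is a sum of one that is continuous for \<open>N\<^sub>F\<close> and one that is continuous for \<open>N\<^sub>g\<close>: this is the
  extension of characters from the diagonal of a product of two compact groups, proved by finding a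
  large Fourier coefficient of a function that is uniformly continuous for \<open>N\<^sub>g\<close> and, after multiplication
  by the character, for \<open>N\<^sub>F\<close>.
\<close>

section \<open>Characters of pseudonorms on the real line\<close>

text \<open>Closed sets without convexity admit in general no continuous choice of points, so the
  selection can be continuous only off an exceptional set of times. What must be small is the
  density of that set in all long windows, uniformly in their position: this is unchanged by
  translation, so a pair t, t + \<tau> is spoilt only on the set and one translate of it. A second
  device recurs: an almost period carries any window into one fixed interval, where countable
  additivity and Lusin's theorem apply. The module inclusion needs one window length for a whole
  sequence of shifts, while a small \<open>kernel_norm\<close> gives a length for each shift; total
  boundedness makes it uniform. The compact groups, completions of the line for the pseudonorms, are
  never formed: a character is split on finite arithmetic progressions with a constant independent
  of mesh and length, and a limit follows. For degree p the same f serves: membership in F bounds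
  its distances, and almost periodicity in measure together with uniform integrability gives almost
  periodicity in mean.\<close>

locale pseudonorm =
  fixes N :: "real \<Rightarrow> real"
  assumes zero: "N 0 = 0"
    and minus: "N (- x) = N x"
    and triangle: "N (x + y) \<le> N x + N y"
    and cont0: "\<epsilon> > 0 \<Longrightarrow> \<exists>\<delta>>0. \<forall>r. \<bar>r\<bar> < \<delta> \<longrightarrow> N r < \<epsilon>"
    and totally_bounded: "\<epsilon> > 0 \<Longrightarrow> \<exists>S. finite S \<and> (\<forall>\<tau>. \<exists>s\<in>S. N (\<tau> - s) < \<epsilon>)"
begin

lemma nonneg: "0 \<le> N x"
  using triangle[of x "- x"] minus[of x] zero by simp

lemma minus_commute: "N (x - y) = N (y - x)"
  using minus[of "x - y"] by simp

lemma triangle_diff: "N (x - y) \<le> N x + N y"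
  using triangle[of x "- y"] minus[of y] by simp

lemma abs_diff_le: "\<bar>N x - N y\<bar> \<le> N (x - y)"
  using triangle[of "x - y" y] triangle[of "y - x" x] minus_commute[of x y] by simp

lemma tendsto_N:
  assumes "(f \<longlongrightarrow> t) F"
  shows "((\<lambda>x. N (f x)) \<longlongrightarrow> N t) F"
proof (rule tendstoI)
  fix \<epsilon> :: real assume "\<epsilon> > 0"
  then obtain \<delta> where d: "\<delta> > 0" "\<And>r. \<bar>r\<bar> < \<delta> \<Longrightarrow> N r < \<epsilon>"
    using cont0 by metis
  have "eventually (\<lambda>x. dist (f x) t < \<delta>) F"
    using assms d(1) by (rule tendstoD)
  then show "eventually (\<lambda>x. dist (N (f x)) (N t) < \<epsilon>) F"
  proof (rule eventually_mono)
    fix x assume "dist (f x) t < \<delta>"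
    then have "N (f x - t) < \<epsilon>" by (intro d(2)) (simp add: dist_real_def)
    then show "dist (N (f x)) (N t) < \<epsilon>"
      using abs_diff_le[of "f x" t] by (simp add: dist_real_def)
  qed
qed

text \<open>Pigeonhole: of the first \<open>n\<close> multiples of \<open>h\<close>, many lie in one translate \<open>s + {N < \<epsilon>/2}\<close>,
  and their differences to the smallest of them are again multiples with index below \<open>n\<close>.\<close>

lemma count_small:
  assumes "\<epsilon> > 0"
  shows "\<exists>K::nat. K > 0 \<and> (\<forall>h n. n \<le> K * card {j. j < n \<and> N (real j * h) < \<epsilon>})"
proof -
  obtain S where S: "finite S" "\<And>\<tau>. \<exists>s\<in>S. N (\<tau> - s) < \<epsilon> / 2"
    using totally_bounded[of "\<epsilon> / 2"] assms by auto
  have "S \<noteq> {}" using S(2)[of 0] by auto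
  then have K: "card S > 0" using S(1) by (simp add: card_gt_0_iff)
  have "n \<le> card S * card {j. j < n \<and> N (real j * h) < \<epsilon>}" for h n
  proof -
    let ?C = "card {j. j < n \<and> N (real j * h) < \<epsilon>}"
    let ?P = "\<lambda>s. {j. j < n \<and> N (real j * h - s) < \<epsilon> / 2}"
    have "{..<n} \<subseteq> (\<Union>s\<in>S. ?P s)" using S(2) by fastforce
    then have "card {..<n} \<le> card (\<Union>s\<in>S. ?P s)"
      by (intro card_mono finite_UN_I) (use S(1) in auto)
    also have "\<dots> \<le> (\<Sum>s\<in>S. card (?P s))"
      by (rule card_UN_le) (rule S(1))
    also have "\<dots> \<le> (\<Sum>s\<in>S. ?C)"
    proof (rule sum_mono)
      fix s assume "s \<in> S"
      show "card (?P s) \<le> ?C"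
      proof (cases "?P s = {}")
        case False
        define j0 where "j0 = Min (?P s)"
        have fin: "finite (?P s)" by simp
        have j0: "j0 \<in> ?P s" unfolding j0_def by (rule Min_in[OF fin False])
        have le: "j0 \<le> j" if "j \<in> ?P s" for j
          unfolding j0_def by (rule Min_le[OF fin that])
        have "card (?P s) = card ((\<lambda>j. j - j0) ` ?P s)"
        proof (rule card_image[symmetric], rule inj_onI)
          fix x y assume "x \<in> ?P s" "y \<in> ?P s" "x - j0 = y - j0"
          with le[of x] le[of y] show "x = y" by (metis eq_diff_iff)
        qed
        also have "\<dots> \<le> ?C"
        proof (rule card_mono)
          show "(\<lambda>j. j - j0) ` ?P s \<subseteq> {j. j < n \<and> N (real j * h) < \<epsilon>}"
          proof (rule image_subsetI)
            fix j assume "j \<in> ?P s"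
            then have j: "j < n" "N (real j * h - s) < \<epsilon> / 2" by auto
            then have "j0 \<le> j" by (intro le) simp
            then have eq: "real (j - j0) * h = (real j * h - s) - (real j0 * h - s)"
              by (simp add: of_nat_diff algebra_simps)
            show "j - j0 \<in> {j. j < n \<and> N (real j * h) < \<epsilon>}"
              unfolding mem_Collect_eq eq using triangle_diff[of "real j * h - s" "real j0 * h - s"] j j0 by auto
          qed
        qed simp
        finally show ?thesis .
      next
        case True
        show ?thesis unfolding True by simp
      qed
    qed
    finally show ?thesis by simp
  qed
  then show ?thesis using K by blast
qed

end

lemma pseudonorm_add:
  assumes "pseudonorm N1" "pseudonorm N2"
  shows "pseudonorm (\<lambda>x. N1 x + N2 x)"
proof -
  interpret N1: pseudonorm N1 by fact
  interpret N2: pseudonorm N2 by fact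
  show ?thesis
  proof
    fix x y
    show "N1 0 + N2 0 = 0" by (simp add: N1.zero N2.zero)
    show "N1 (- x) + N2 (- x) = N1 x + N2 x" by (simp add: N1.minus N2.minus)
    show "N1 (x + y) + N2 (x + y) \<le> N1 x + N2 x + (N1 y + N2 y)"
      using N1.triangle[of x y] N2.triangle[of x y] by simp
  next
    fix \<epsilon> :: real assume e: "\<epsilon> > 0"
    obtain a where a: "a > 0" "\<And>r. \<bar>r\<bar> < a \<Longrightarrow> N1 r < \<epsilon> / 2" using N1.cont0[of "\<epsilon> / 2"] e by auto
    obtain b where b: "b > 0" "\<And>r. \<bar>r\<bar> < b \<Longrightarrow> N2 r < \<epsilon> / 2" using N2.cont0[of "\<epsilon> / 2"] e by auto
    show "\<exists>\<delta>>0. \<forall>r. \<bar>r\<bar> < \<delta> \<longrightarrow> N1 r + N2 r < \<epsilon>"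
    proof (intro exI[of _ "min a b"] conjI allI impI)
      fix r assume "\<bar>r\<bar> < min a b"
      then show "N1 r + N2 r < \<epsilon>" using a(2)[of r] b(2)[of r] by simp
    qed (use a b in simp)
    obtain S where S: "finite S" "\<And>\<tau>. \<exists>s\<in>S. N1 (\<tau> - s) < \<epsilon> / 4"
      using N1.totally_bounded[of "\<epsilon> / 4"] e by auto
    obtain T where T: "finite T" "\<And>\<tau>. \<exists>s\<in>T. N2 (\<tau> - s) < \<epsilon> / 4"
      using N2.totally_bounded[of "\<epsilon> / 4"] e by auto
    \<comment> \<open>The centres of the two nets are unrelated, so each nonempty intersection of
      cells gets a point of its own as new centre. This doubles the radii, whence \<epsilon> / 4 for
      each net.\<close>
    define C where "C = (\<lambda>(s, t). {\<tau>. N1 (\<tau> - s) < \<epsilon> / 4 \<and> N2 (\<tau> - t) < \<epsilon> / 4})"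
    define R where "R = (\<lambda>q. SOME \<tau>. \<tau> \<in> C q) ` (S \<times> T)"
    show "\<exists>S. finite S \<and> (\<forall>\<tau>. \<exists>s\<in>S. N1 (\<tau> - s) + N2 (\<tau> - s) < \<epsilon>)"
    proof (intro exI[of _ R] conjI allI)
      show "finite R" using S T by (simp add: R_def)
      fix \<tau>
      obtain s t where st: "s \<in> S" "t \<in> T" "\<tau> \<in> C (s, t)"
        using S(2)[of \<tau>] T(2)[of \<tau>] by (auto simp: C_def)
      define p where "p = (SOME \<tau>. \<tau> \<in> C (s, t))"
      have p: "p \<in> C (s, t)" unfolding p_def using st(3) by (rule someI)
      have "N1 (\<tau> - p) < \<epsilon> / 2" "N2 (\<tau> - p) < \<epsilon> / 2"
        using N1.triangle_diff[of "\<tau> - s" "p - s"] N2.triangle_diff[of "\<tau> - t" "p - t"] p st(3)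
        by (auto simp: C_def)
      moreover have "p \<in> R" using st unfolding R_def p_def by auto
      ultimately show "\<exists>s\<in>R. N1 (\<tau> - s) + N2 (\<tau> - s) < \<epsilon>" by force
    qed
  qed
qed

section \<open>Finite Fourier analysis along an arithmetic progression\<close>

lemma sum_cis_roots_of_unity:
  assumes n: "n > 0" and a: "\<bar>a\<bar> < int n"
  shows "(\<Sum>k<n. cis (2 * pi * real k * of_int a / real n)) = (if a = 0 then of_nat n else 0)"
proof (cases "a = 0")
  case False
  define z where "z = cis (2 * pi * of_int a / real n)"
  have zk: "cis (2 * pi * real k * of_int a / real n) = z ^ k" for k
    unfolding z_def by (simp add: Complex.DeMoivre mult_ac)
  have zn: "z ^ n = 1"
    unfolding z_def using n by (simp add: Complex.DeMoivre cis_multiple_2pi)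
  have "z \<noteq> 1"
  proof
    assume "z = 1"
    then have "cos (2 * pi * of_int a / real n) = 1"
      unfolding z_def by (metis cis.sel(1) one_complex.sel(1))
    then obtain m :: int where "2 * pi * of_int a / real n = of_int m * 2 * pi"
      by (auto simp: cos_one_2pi_int)
    then have "of_int a = of_int m * real n" using n by (simp add: field_simps)
    then have "a = m * int n" by (metis of_int_eq_iff of_int_mult of_int_of_nat_eq)
    with False have "\<bar>m\<bar> \<ge> 1" by auto
    then have "\<bar>a\<bar> \<ge> int n"
      unfolding \<open>a = m * int n\<close> abs_mult using mult_right_mono[of 1 "\<bar>m\<bar>" "int n"] by simp
    with a show False by simp
  qed
  then have "(\<Sum>k<n. z ^ k) = 0" using zn by (simp add: geometric_sum)
  then show ?thesis using False by (simp add: zk)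
qed simp


text \<open>The sum over \<open>B \<times> B\<close> is the average over the frequencies of \<open>X\<^sub>k\<close> times the squared
  conjugate transform of \<open>B\<close>; Parseval for \<open>B\<close> then leaves a large \<open>X\<^sub>k\<close>.\<close>

lemma large_fourier_coefficient:
  fixes x :: "nat \<Rightarrow> complex"
  assumes n: "n > 0" and B: "finite B" "\<And>b. b \<in> B \<Longrightarrow> 2 * b < n"
  shows "\<exists>k<n. norm (\<Sum>b\<in>B. \<Sum>r\<in>B. x (b + r))
     \<le> norm (\<Sum>m<n. x m * cis (- (2 * pi * real k / real n) * real m)) * real (card B)"
proof -
  define w where "w = (\<lambda>k m :: nat. cis (- (2 * pi * real k / real n) * real m))"
  define X where "X = (\<lambda>k. \<Sum>m<n. x m * w k m)"
  define Y where "Y = (\<lambda>k. \<Sum>b\<in>B. cnj (w k b))"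
  have w_comb: "w k m * cnj (w k b) * cnj (w k r) = cis (2 * pi * real k * of_int (int b + int r - int m) / real n)"
    for k m b r
    unfolding w_def by (simp add: cis_cnj cis_mult) (simp add: field_simps add_divide_distrib diff_divide_distrib)
  \<comment> \<open>Orthogonality sees b + r - m only modulo n. Both b + r and m are below n, the
    former because elements of \<open>B\<close> are below n / 2, so the congruence is an
    equality.\<close>
  have sum_w: "(\<Sum>k<n. w k m * cnj (w k b) * cnj (w k r)) = (if m = b + r then of_nat n else 0)"
    if "m < n" "b + r < n" for m b r
    unfolding w_comb using that n
    by (subst sum_cis_roots_of_unity) auto
  have "of_nat n * (\<Sum>b\<in>B. \<Sum>r\<in>B. x (b + r)) = (\<Sum>k<n. X k * Y k * Y k)"
  proof -
    have "(\<Sum>k<n. X k * Y k * Y k) = (\<Sum>k<n. \<Sum>b\<in>B. \<Sum>r\<in>B. \<Sum>m<n. x m * (w k m * cnj (w k b) * cnj (w k r)))"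
    proof (rule sum.cong[OF refl])
      fix k
      have "X k * Y k * Y k = (\<Sum>b\<in>B. \<Sum>r\<in>B. X k * cnj (w k r) * cnj (w k b))"
        unfolding Y_def by (simp only: sum_distrib_left sum_distrib_right mult.assoc)
      also have "\<dots> = (\<Sum>b\<in>B. \<Sum>r\<in>B. \<Sum>m<n. x m * (w k m * cnj (w k b) * cnj (w k r)))"
        unfolding X_def by (simp only: sum_distrib_left sum_distrib_right mult_ac)
      finally show "X k * Y k * Y k = \<dots>" .
    qed
    also have "\<dots> = (\<Sum>b\<in>B. \<Sum>r\<in>B. \<Sum>m<n. \<Sum>k<n. x m * (w k m * cnj (w k b) * cnj (w k r)))"
      by (subst sum.swap, rule sum.cong[OF refl], subst sum.swap, rule sum.cong[OF refl], rule sum.swap)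
    also have "\<dots> = (\<Sum>b\<in>B. \<Sum>r\<in>B. of_nat n * x (b + r))"
    proof (intro sum.cong refl)
      fix b r assume br: "b \<in> B" "r \<in> B"
      then have lt: "b + r < n" using B(2)[of b] B(2)[of r] by linarith
      have "(\<Sum>m<n. \<Sum>k<n. x m * (w k m * cnj (w k b) * cnj (w k r)))
          = (\<Sum>m<n. if m = b + r then of_nat n * x m else 0)"
        by (rule sum.cong[OF refl]) (simp add: sum_distrib_left[symmetric] sum_w lt)
      also have "\<dots> = of_nat n * x (b + r)" using lt by simp
      finally show "(\<Sum>m<n. \<Sum>k<n. x m * (w k m * cnj (w k b) * cnj (w k r))) = of_nat n * x (b + r)" .
    qed
    finally show ?thesis by (simp add: sum_distrib_left)
  qed
  from arg_cong[OF this, of norm]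
  have id: "real n * norm (\<Sum>b\<in>B. \<Sum>r\<in>B. x (b + r)) = norm (\<Sum>k<n. X k * Y k * Y k)"
    by (simp only: norm_mult norm_of_nat)
  have parseval: "(\<Sum>k<n. (norm (Y k))\<^sup>2) = real n * real (card B)"
  proof -
    have "complex_of_real (\<Sum>k<n. (norm (Y k))\<^sup>2) = (\<Sum>k<n. cnj (Y k) * Y k)"
      by (simp only: of_real_sum complex_norm_square mult.commute)
    \<comment> \<open>The factor \<open>cnj (w k 0)\<close> equals 1 and serves to bring the term
      into the form of \<open>sum_w\<close>.\<close>
    also have "\<dots> = (\<Sum>k<n. \<Sum>b\<in>B. \<Sum>r\<in>B. w k b * cnj (w k 0) * cnj (w k r))"
      by (simp add: Y_def sum_product w_def)
    also have "\<dots> = (\<Sum>b\<in>B. \<Sum>r\<in>B. \<Sum>k<n. w k b * cnj (w k 0) * cnj (w k r))"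
      by (subst sum.swap, rule sum.cong[OF refl], rule sum.swap)
    also have "\<dots> = (\<Sum>b\<in>B. \<Sum>r\<in>B. if b = r then of_nat n else 0)"
    proof (intro sum.cong refl)
      fix b r assume "b \<in> B" "r \<in> B"
      then have "b < n" "0 + r < n" using B(2)[of b] B(2)[of r] by auto
      then show "(\<Sum>k<n. w k b * cnj (w k 0) * cnj (w k r)) = (if b = r then of_nat n else 0)"
        by (subst sum_w) auto
    qed
    also have "\<dots> = of_nat (card B) * of_nat n"
      using B(1) by simp
    finally have "complex_of_real (\<Sum>k<n. (norm (Y k))\<^sup>2) = complex_of_real (real n * real (card B))"
      by simp
    then show ?thesis by (simp only: of_real_eq_iff)
  qed
  define M where "M = Max ((\<lambda>k. norm (X k)) ` {..<n})"
  have ne: "(\<lambda>k. norm (X k)) ` {..<n} \<noteq> {}" using n by auto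
  obtain k where k: "k < n" "M = norm (X k)"
    using Max_in[OF _ ne] unfolding M_def by auto
  have le: "norm (X j) \<le> M" if "j < n" for j
    unfolding M_def using that by (intro Max_ge) auto
  have "real n * norm (\<Sum>b\<in>B. \<Sum>r\<in>B. x (b + r)) \<le> (\<Sum>k<n. norm (X k * Y k * Y k))"
    unfolding id by (rule norm_sum)
  also have "\<dots> \<le> (\<Sum>k<n. M * (norm (Y k))\<^sup>2)"
    by (rule sum_mono) (simp add: norm_mult power2_eq_square mult.assoc mult_right_mono le)
  also have "\<dots> = real n * (M * real (card B))"
    by (simp add: sum_distrib_left[symmetric] parseval)
  finally have "norm (\<Sum>b\<in>B. \<Sum>r\<in>B. x (b + r)) \<le> M * real (card B)"
    using n by simp
  then show ?thesis using k unfolding X_def w_def by blast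
qed

text \<open>Comparing \<open>p (j + r)\<close> with \<open>q j\<close> matches all but r terms of
  each sum; the unmatched ones are estimated by the common bound \<open>b\<close>.\<close>

lemma norm_shifted_sum_diff:
  fixes p q :: "nat \<Rightarrow> complex"
  assumes "r \<le> n" and D: "\<And>j. norm (p (j + r) - q j) \<le> D" "D \<ge> 0"
    and b: "\<And>j. norm (p j) \<le> b" "\<And>j. norm (q j) \<le> b"
  shows "norm ((\<Sum>j<n. p j) - (\<Sum>j<n. q j)) \<le> real n * D + 2 * real r * b"
proof -
  have np: "(\<Sum>j<n. p j) = (\<Sum>j<r. p j) + (\<Sum>j<n - r. p (j + r))"
  proof -
    have "(\<Sum>j=r..<n. p j) = (\<Sum>j=0..<n - r. p (j + r))"
      using sum.shift_bounds_nat_ivl[of p 0 r "n - r"] assms(1) by simp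
    then show ?thesis
      using sum.atLeastLessThan_concat[of 0 r n p] assms(1) by (simp add: atLeast0LessThan)
  qed
  have nq: "(\<Sum>j<n. q j) = (\<Sum>j<n - r. q j) + (\<Sum>j=n - r..<n. q j)"
    using sum.atLeastLessThan_concat[of 0 "n - r" n q] by (simp add: atLeast0LessThan)
  have "norm ((\<Sum>j<n. p j) - (\<Sum>j<n. q j))
      = norm ((\<Sum>j<n - r. p (j + r) - q j) + ((\<Sum>j<r. p j) - (\<Sum>j=n - r..<n. q j)))"
    unfolding np nq by (simp add: sum_subtractf algebra_simps)
  also have "\<dots> \<le> norm (\<Sum>j<n - r. p (j + r) - q j) + (norm (\<Sum>j<r. p j) + norm (\<Sum>j=n - r..<n. q j))"
    by (intro norm_triangle_le add_left_mono norm_triangle_ineq4)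
  also have "\<dots> \<le> real (card {..<n - r}) * D + (real (card {..<r}) * b + real (card {n - r..<n}) * b)"
    by (intro add_mono sum_norm_bound D b)
  also have "\<dots> = real (n - r) * D + 2 * real r * b" using assms(1) by simp
  also have "\<dots> \<le> real n * D + 2 * real r * b"
    using D(2) by (intro add_right_mono mult_right_mono) auto
  finally show ?thesis .
qed

text \<open>Multiplying the transform at \<theta> by \<open>cis (\<theta> * real r)\<close> amounts
  to translating the sequence by r, up to boundary terms. So a large coefficient at \<theta> of a
  sequence that changes little under this translation forces the factor to be close to 1.\<close>

lemma norm_cis_minus_one_mult_sum_le:
  fixes x :: "nat \<Rightarrow> complex"
  assumes "r \<le> n" and D: "\<And>m. norm (x (m + r) - x m) \<le> D" "D \<ge> 0" and b: "\<And>m. norm (x m) \<le> b"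
  shows "norm (cis (\<theta> * real r) - 1) * norm (\<Sum>m<n. x m * cis (- \<theta> * real m)) \<le> real n * D + 2 * real r * b"
proof -
  have "(cis (\<theta> * real r) - 1) * (\<Sum>m<n. x m * cis (- \<theta> * real m))
     = (\<Sum>m<n. x m * cis (- \<theta> * (real m - real r))) - (\<Sum>m<n. x m * cis (- \<theta> * real m))"
  proof -
    have "cis (\<theta> * real r) * (x m * cis (- \<theta> * real m)) = x m * cis (- \<theta> * (real m - real r))" for m
      by (simp add: cis_mult algebra_simps mult.left_commute[of "cis _"])
    then show ?thesis by (simp only: left_diff_distrib sum_distrib_left mult_1_left sum_subtractf)
  qed
  then have "norm (cis (\<theta> * real r) - 1) * norm (\<Sum>m<n. x m * cis (- \<theta> * real m))
     = norm ((\<Sum>m<n. x m * cis (- \<theta> * (real m - real r))) - (\<Sum>m<n. x m * cis (- \<theta> * real m)))"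
    unfolding norm_mult[symmetric] by (rule arg_cong)
  also have "\<dots> \<le> real n * D + 2 * real r * b"
  proof (rule norm_shifted_sum_diff[OF assms(1)])
    fix j
    have "x (j + r) * cis (- \<theta> * (real (j + r) - real r)) - x j * cis (- \<theta> * real j)
        = (x (j + r) - x j) * cis (- \<theta> * real j)" by (simp add: algebra_simps)
    then show "norm (x (j + r) * cis (- \<theta> * (real (j + r) - real r)) - x j * cis (- \<theta> * real j)) \<le> D"
      using D(1)[of j] by (simp add: norm_mult)
  qed (use b D in \<open>auto simp: norm_mult\<close>)
  finally show ?thesis .
qed

text \<open>The squared chord is 2 - 2 cos x, so a chord of length at most 1 means cos x \<ge> 1 /
  2.\<close>

lemma abs_le_of_norm_cis_minus_one_le:
  assumes "\<bar>x\<bar> \<le> pi" "norm (cis x - 1) \<le> 1"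
  shows "\<bar>x\<bar> \<le> pi / 3"
proof -
  have "(norm (cis x - 1))\<^sup>2 = 2 - 2 * cos x"
    unfolding cmod_power2 using sin_cos_squared_add[of x] by (simp add: power2_eq_square algebra_simps)
  moreover have "(norm (cis x - 1))\<^sup>2 \<le> 1" using assms(2) by (simp add: power_le_one)
  ultimately have "cos (pi / 3) \<le> cos \<bar>x\<bar>" by (simp add: cos_60)
  then show ?thesis using assms(1) by (subst (asm) cos_mono_le_eq) auto
qed

text \<open>Chords determine angles only modulo 2 pi. Inductively the angle reached so far is at
  most pi / 3, one more step keeps it below pi, and there the chord condition confines it to pi / 3
  again.\<close>

lemma angle_multiple_bound:
  assumes "\<bar>\<theta>\<bar> \<le> pi" "\<And>r. r \<le> r0 \<Longrightarrow> norm (cis (\<theta> * real r) - 1) \<le> 1"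
  shows "\<bar>\<theta>\<bar> * real r0 \<le> pi / 3"
  using assms(2)
proof (induction r0)
  case (Suc r)
  then have IH: "\<bar>\<theta>\<bar> * real r \<le> pi / 3" by simp
  show ?case
  proof (cases "r = 0")
    case True
    then show ?thesis using abs_le_of_norm_cis_minus_one_le[OF assms(1)] Suc(2)[of 1] by simp
  next
    case False
    then have "\<bar>\<theta>\<bar> \<le> pi / 3"
      using mult_left_mono[of 1 "real r" "\<bar>\<theta>\<bar>"] IH by simp
    then have "\<bar>\<theta> * real (Suc r)\<bar> \<le> pi"
      using IH pi_gt_zero unfolding abs_mult by (simp add: algebra_simps)
    then have "\<bar>\<theta> * real (Suc r)\<bar> \<le> pi / 3"
      using Suc.prems[of "Suc r"] by (intro abs_le_of_norm_cis_minus_one_le) auto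
    then show ?thesis by (simp add: abs_mult)
  qed
qed simp


section \<open>Splitting a character that is continuous for a sum of pseudonorms\<close>

lemma norm_cis_mult_diff:
  "norm (cis a * complex_of_real u - cis a * complex_of_real v) = \<bar>u - v\<bar>"
proof -
  have "cis a * complex_of_real u - cis a * complex_of_real v = cis a * complex_of_real (u - v)"
    by (simp add: right_diff_distrib)
  then show ?thesis by (simp only: norm_mult norm_cis norm_of_real mult_1_left)
qed

text \<open>The sequence \<open>x\<close> in the proof samples, at the multiples of
  \<open>h\<close>, the mean over \<sigma> of e^(i \<mu> \<sigma>) \<kappa>(N1 \<sigma> + N2 (\<tau>
  - \<sigma>)). This is Lipschitz in \<tau> for \<open>N2\<close>; after multiplication by e^(-i
  \<mu> \<tau>), translating \<sigma> along with \<tau> shows that it is Lipschitz for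
  \<open>N1\<close>. A frequency \<theta> with a large Fourier coefficient therefore obeys both
  estimates, up to boundary terms of order r / m. That \<open>c\<close> depends neither on
  \<open>h\<close> nor on \<open>m\<close> permits the later limit.\<close>

lemma approximate_character:
  assumes "pseudonorm N1" "pseudonorm N2" and \<delta>: "\<delta> > 0"
    and near: "\<And>\<tau>. N1 \<tau> + N2 \<tau> < \<delta> \<Longrightarrow> norm (cis (\<mu> * \<tau>) - 1) \<le> 1 / 2"
  shows "\<exists>c>0. \<forall>h m. m > 0 \<longrightarrow> (\<exists>\<theta>. \<bar>\<theta>\<bar> \<le> pi \<and> (\<forall>r\<le>2 * m.
     norm (cis (\<theta> * real r) - 1) * c \<le> N2 (real r * h) + real r * \<delta> / real m \<and>
     norm (cis ((\<theta> - \<mu> * h) * real r) - 1) * c \<le> N1 (real r * h) + 2 * real r * \<delta> / real m))"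
proof -
  interpret N1: pseudonorm N1 by fact
  interpret N2: pseudonorm N2 by fact
  interpret N: pseudonorm "\<lambda>x. N1 x + N2 x" by (rule pseudonorm_add) fact+
  obtain K0 where K0: "K0 > 0" "\<And>h n. n \<le> K0 * card {j. j < n \<and> N1 (real j * h) + N2 (real j * h) < \<delta> / 2}"
    using N.count_small[of "\<delta> / 2"] \<delta> by auto
  \<comment> \<open>A proportion of at least 1 / K0 of the indices contributes at least \<delta> / 4
    each to the real part of the mean \<open>x 0\<close>: there \<kappa> is at least \<delta> / 2
    and the cosine at least 1 / 2.\<close>
  define c0 where "c0 = \<delta> / (4 * real K0)"
  have c0: "c0 > 0" unfolding c0_def using \<delta> K0(1) by simp
  obtain K1 where K1: "K1 > 0" "\<And>h n. n \<le> K1 * card {j. j < n \<and> N2 (real j * h) < c0 / 4}"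
    using N2.count_small[of "c0 / 4"] c0 by auto
  define c where "c = c0 / (4 * real K1)"
  have c: "c > 0" unfolding c_def using c0 K1(1) by simp
  \<comment> \<open>A tent of height \<delta> that vanishes unless \<open>near\<close> makes e^(i
    \<mu> \<tau>) close to 1, so that the terms of \<open>x 0\<close> cannot cancel.\<close>
  define \<kappa> where "\<kappa> = (\<lambda>y :: real. max 0 (\<delta> - y))"
  have \<kappa>_lip: "\<bar>\<kappa> a - \<kappa> b\<bar> \<le> \<bar>a - b\<bar>" for a b unfolding \<kappa>_def by linarith
  have \<kappa>_bd: "\<bar>\<kappa> (N1 a + N2 b)\<bar> \<le> \<delta>" for a b
    unfolding \<kappa>_def using N1.nonneg[of a] N2.nonneg[of b] \<delta> by linarith
  have "\<exists>\<theta>. \<bar>\<theta>\<bar> \<le> pi \<and> (\<forall>r\<le>2 * m.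
     norm (cis (\<theta> * real r) - 1) * c \<le> N2 (real r * h) + real r * \<delta> / real m \<and>
     norm (cis ((\<theta> - \<mu> * h) * real r) - 1) * c \<le> N1 (real r * h) + 2 * real r * \<delta> / real m)"
    if m: "m > 0" for h m
  proof -
    \<comment> \<open>Twice m, so that the indices in \<open>B\<close>, all below m, meet the
      condition \<open>2 * b < n\<close> of \<open>large_fourier_coefficient\<close>.\<close>
    define n where "n = 2 * m"
    have n: "n > 0" "real n > 0" unfolding n_def using m by auto
    define y where "y = (\<lambda>m j. cis (\<mu> * (real j * h)) * complex_of_real (\<kappa> (N1 (real j * h) + N2 (real m * h - real j * h))))"
    define x where "x = (\<lambda>m. (1 / of_nat n) * (\<Sum>j<n. y m j))"
    have norm_x_diff: "norm (x a - x b) = norm ((\<Sum>j<n. y a j) - (\<Sum>j<n. y b j)) / real n" for a b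
      unfolding x_def right_diff_distrib[symmetric] norm_mult norm_divide by simp
    have y_bd: "norm (y a j) \<le> \<delta>" for a j
      unfolding y_def by (simp add: norm_mult \<kappa>_bd)
    have x_bd: "norm (x a) \<le> \<delta>" for a
    proof -
      have "norm (\<Sum>j<n. y a j) \<le> real (card {..<n}) * \<delta>" by (rule sum_norm_bound) (rule y_bd)
      then show ?thesis unfolding x_def norm_mult norm_divide using n by (simp add: field_simps)
    qed
    \<comment> \<open>Only the argument of \<open>N2\<close> contains the index that moves, so the
      terms compare one by one without boundary terms.\<close>
    have x_shift: "norm (x (a + r) - x a) \<le> N2 (real r * h)" for a r
    proof -
      have "norm ((\<Sum>j<n. y (a + r) j) - (\<Sum>j<n. y a j)) = norm (\<Sum>j<n. y (a + r) j - y a j)"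
        by (simp add: sum_subtractf)
      also have "\<dots> \<le> real (card {..<n}) * N2 (real r * h)"
      proof (rule sum_norm_bound)
        fix j
        have "norm (y (a + r) j - y a j)
          = \<bar>\<kappa> (N1 (real j * h) + N2 (real (a + r) * h - real j * h)) - \<kappa> (N1 (real j * h) + N2 (real a * h - real j * h))\<bar>"
          unfolding y_def by (rule norm_cis_mult_diff)
        also have "\<dots> \<le> \<bar>N2 (real (a + r) * h - real j * h) - N2 (real a * h - real j * h)\<bar>"
          by (rule order_trans[OF \<kappa>_lip]) simp
        also have "\<dots> \<le> N2 (real r * h)"
          by (rule order_trans[OF N2.abs_diff_le]) (simp add: algebra_simps)
        finally show "norm (y (a + r) j - y a j) \<le> N2 (real r * h)" .
      qed
      finally show ?thesis unfolding norm_x_diff using n by (simp add: field_simps)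
    qed
    have x0: "c0 \<le> norm (x 0)"
    proof -
      let ?J = "{j. j < n \<and> N1 (real j * h) + N2 (real j * h) < \<delta> / 2}"
      have Re_y: "Re (y 0 j) = cos (\<mu> * (real j * h)) * \<kappa> (N1 (real j * h) + N2 (real j * h))" for j
        unfolding y_def using N2.minus by simp
      have Re_ge: "cos (\<mu> * (real j * h)) \<ge> 1 / 2" if "N1 (real j * h) + N2 (real j * h) < \<delta>" for j
        using near[OF that] abs_Re_le_cmod[of "cis (\<mu> * (real j * h)) - 1"] by simp
      have nn: "Re (y 0 j) \<ge> 0" for j
      proof (cases "N1 (real j * h) + N2 (real j * h) < \<delta>")
        case True
        have "0 \<le> cos (\<mu> * (real j * h))" using Re_ge[OF True] by linarith
        then show ?thesis unfolding Re_y by (rule mult_nonneg_nonneg) (simp add: \<kappa>_def)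
      qed (simp add: Re_y \<kappa>_def)
      have "real (card ?J) * (\<delta> / 4) \<le> (\<Sum>j\<in>?J. Re (y 0 j))"
      proof (rule sum_bounded_below)
        fix j assume j: "j \<in> ?J"
        have "(1 / 2) * (\<delta> / 2) \<le> cos (\<mu> * (real j * h)) * \<kappa> (N1 (real j * h) + N2 (real j * h))"
        proof (rule mult_mono)
          show "1 / 2 \<le> cos (\<mu> * (real j * h))" by (rule Re_ge) (use j \<delta> in simp)
          then show "0 \<le> cos (\<mu> * (real j * h))" by linarith
          show "\<delta> / 2 \<le> \<kappa> (N1 (real j * h) + N2 (real j * h))" using j unfolding \<kappa>_def mem_Collect_eq by linarith
        qed (use \<delta> in simp)
        then show "\<delta> / 4 \<le> Re (y 0 j)" unfolding Re_y by simp
      qed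
      also have "\<dots> \<le> (\<Sum>j<n. Re (y 0 j))"
        by (rule sum_mono2) (auto intro: nn)
      also have "\<dots> = Re (\<Sum>j<n. y 0 j)" by simp
      also have "\<dots> \<le> norm (\<Sum>j<n. y 0 j)" by (rule complex_Re_le_cmod)
      also have "\<dots> = real n * norm (x 0)" unfolding x_def norm_mult norm_divide using n by simp
      finally have 1: "real (card ?J) * (\<delta> / 4) \<le> real n * norm (x 0)" .
      have "real n \<le> real K0 * real (card ?J)" using K0(2)[of n h] by (simp only: of_nat_le_iff of_nat_mult[symmetric])
      then have "real n * (\<delta> / 4) \<le> real K0 * (real (card ?J) * (\<delta> / 4))"
        using \<delta> mult_right_mono[of "real n" "real K0 * real (card ?J)" "\<delta> / 4"] by (simp only: mult.assoc)
      also have "\<dots> \<le> real K0 * (real n * norm (x 0))" using 1 by (intro mult_left_mono) auto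
      finally have "\<delta> / 4 \<le> real K0 * norm (x 0)" using n by (simp add: mult.left_commute)
      then show ?thesis unfolding c0_def using K0(1) by (simp add: field_simps)
    qed
    \<comment> \<open>For b and r in \<open>B\<close> the value \<open>x (b + r)\<close> is within
      c0 / 2 of \<open>x 0\<close>, so the double sum over \<open>B\<close> has norm at least c0 / 2
      times the square of \<open>card B\<close>.\<close>
    define B where "B = {j. j < m \<and> N2 (real j * h) < c0 / 4}"
    have finB: "finite B" unfolding B_def by simp
    have cardB: "real m \<le> real K1 * real (card B)"
      using K1(2)[of m h] unfolding B_def by (simp only: of_nat_le_iff of_nat_mult[symmetric])
    obtain k where k: "k < n" "norm (\<Sum>b\<in>B. \<Sum>r\<in>B. x (b + r))
       \<le> norm (\<Sum>m<n. x m * cis (- (2 * pi * real k / real n) * real m)) * real (card B)"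
      using large_fourier_coefficient[OF n(1) finB, of x] unfolding B_def n_def by auto
    define \<theta>' where "\<theta>' = 2 * pi * real k / real n"
    have \<theta>': "0 \<le> \<theta>'" "\<theta>' \<le> 2 * pi"
      unfolding \<theta>'_def using k n by (auto simp: field_simps)
    \<comment> \<open>The grid frequency is moved to its representative in [-pi, pi], as
      \<open>angle_multiple_bound\<close> will require; at integer arguments the exponentials
      agree.\<close>
    define \<theta> where "\<theta> = (if \<theta>' \<le> pi then \<theta>' else \<theta>' - 2 * pi)"
    have \<theta>: "\<bar>\<theta>\<bar> \<le> pi" unfolding \<theta>_def using \<theta>' by auto
    have cis_\<theta>: "cis (- \<theta>' * real a) = cis (- \<theta> * real a)" for a
    proof -
      have "- \<theta> * real a = - \<theta>' * real a + (if \<theta>' \<le> pi then 0 else 2 * pi * real a)"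
        unfolding \<theta>_def by (simp add: algebra_simps)
      then have "cis (- \<theta> * real a) = cis (- \<theta>' * real a) * cis (if \<theta>' \<le> pi then 0 else 2 * pi * real a)"
        by (simp only: cis_mult)
      moreover have "cis (2 * pi * real a) = 1" by (simp add: cis_multiple_2pi)
      ultimately show ?thesis by (simp split: if_splits)
    qed
    define X where "X = (\<Sum>m<n. x m * cis (- \<theta> * real m))"
    have X_big: "real n * c \<le> norm X"
    proof -
      have "norm ((\<Sum>b\<in>B. \<Sum>r\<in>B. x (b + r)) - (\<Sum>b\<in>B. \<Sum>r\<in>B. x 0)) = norm (\<Sum>b\<in>B. \<Sum>r\<in>B. x (b + r) - x 0)"
        by (simp add: sum_subtractf)
      also have "\<dots> \<le> real (card B) * (real (card B) * (c0 / 2))"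
      proof (rule sum_norm_bound, rule sum_norm_bound)
        fix b r assume br: "b \<in> B" "r \<in> B"
        have "norm (x (b + r) - x 0) \<le> N2 (real b * h + real r * h)"
          using x_shift[of 0 "b + r"] by (simp add: algebra_simps)
        also have "\<dots> \<le> c0 / 2" using N2.triangle[of "real b * h" "real r * h"] br by (auto simp: B_def)
        finally show "norm (x (b + r) - x 0) \<le> c0 / 2" .
      qed
      finally have 1: "norm ((\<Sum>b\<in>B. \<Sum>r\<in>B. x (b + r)) - (\<Sum>b\<in>B. \<Sum>r\<in>B. x 0)) \<le> real (card B) * (real (card B) * (c0 / 2))" .
      have "norm (\<Sum>b\<in>B. \<Sum>r\<in>B. x 0) = real (card B) * (real (card B) * norm (x 0))"
        by (simp add: norm_mult)
      moreover have "\<dots> \<ge> real (card B) * (real (card B) * c0)"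
        using x0 by (intro mult_left_mono) auto
      ultimately have "real (card B) * (real (card B) * (c0 / 2)) \<le> norm (\<Sum>b\<in>B. \<Sum>r\<in>B. x (b + r))"
        using 1 norm_triangle_ineq2[of "\<Sum>b\<in>B. \<Sum>r\<in>B. x 0" "\<Sum>b\<in>B. \<Sum>r\<in>B. x (b + r)"]
        by (simp add: norm_minus_commute)
      also have "\<dots> \<le> norm X * real (card B)"
        using k(2) unfolding X_def \<theta>'_def[symmetric] cis_\<theta> .
      finally have "real (card B) * (real (card B) * (c0 / 2)) \<le> real (card B) * norm X"
        by (simp add: mult.commute)
      moreover have "real (card B) > 0"
        using cardB m by (cases "card B = 0") auto
      ultimately have "real (card B) * (c0 / 2) \<le> norm X" by simp
      moreover have "real n * c \<le> real (card B) * (c0 / 2)"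
      proof -
        have "real n * c = (real m / real K1) * (c0 / 2)" unfolding n_def c_def by (simp add: mult.commute)
        also have "\<dots> \<le> real (card B) * (c0 / 2)"
          using cardB c0 K1(1) by (intro mult_right_mono) (auto simp: field_simps)
        finally show ?thesis .
      qed
      ultimately show ?thesis by linarith
    qed
    have scale: "u * c \<le> D + 2 * real r * \<delta> / real n"
      if "u * norm X \<le> real n * D + 2 * real r * \<delta>" "u \<ge> 0" for u D r
    proof -
      have "u * (real n * c) \<le> real n * D + 2 * real r * \<delta>"
        using that mult_left_mono[OF X_big that(2)] by linarith
      then show ?thesis using n by (simp add: field_simps)
    qed
    have first: "norm (cis (\<theta> * real r) - 1) * c \<le> N2 (real r * h) + 2 * real r * \<delta> / real n" if "r \<le> n" for r
    proof (rule scale)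
      show "norm (cis (\<theta> * real r) - 1) * norm X \<le> real n * N2 (real r * h) + 2 * real r * \<delta>"
        unfolding X_def by (rule norm_cis_minus_one_mult_sum_le[OF that]) (fact x_shift N2.nonneg x_bd)+
    qed simp
    define x' where "x' = (\<lambda>a. cis (- (\<mu> * h) * real a) * x a)"
    have X': "X = (\<Sum>m<n. x' m * cis (- (\<theta> - \<mu> * h) * real m))"
    proof -
      have "cis (- (\<mu> * h) * real a) * x a * cis (- (\<theta> - \<mu> * h) * real a) = x a * cis (- \<theta> * real a)" for a
      proof -
        have "cis (- (\<mu> * h) * real a) * x a * cis (- (\<theta> - \<mu> * h) * real a)
            = x a * (cis (- (\<mu> * h) * real a) * cis (- (\<theta> - \<mu> * h) * real a))" by (simp only: mult_ac)
        also have "\<dots> = x a * cis (- \<theta> * real a)" unfolding cis_mult by (simp add: algebra_simps)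
        finally show ?thesis .
      qed
      then show ?thesis unfolding X_def x'_def by (simp only:)
    qed
    \<comment> \<open>Here the index j of the mean is shifted together with a: the factor depending
      on j - a and the argument of \<open>N2\<close> stay fixed, only \<open>N1\<close> changes, and
      r terms at either end are left over.\<close>
    have x'_shift: "norm (x' (a + r) - x' a) \<le> N1 (real r * h) + 2 * real r * \<delta> / real n" if "r \<le> n" for a r
    proof -
      define p where "p = (\<lambda>j. cis (- (\<mu> * h) * real (a + r)) * y (a + r) j)"
      define q where "q = (\<lambda>j. cis (- (\<mu> * h) * real a) * y a j)"
      have "norm ((\<Sum>j<n. p j) - (\<Sum>j<n. q j)) \<le> real n * N1 (real r * h) + 2 * real r * \<delta>"
      proof (rule norm_shifted_sum_diff[OF that])
        fix j
        have p: "p (j + r) = cis (\<mu> * h * (real j - real a)) * complex_of_real (\<kappa> (N1 (real (j + r) * h) + N2 (real a * h - real j * h)))"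
          unfolding p_def y_def mult.assoc[symmetric] cis_mult by (simp add: algebra_simps)
        have q: "q j = cis (\<mu> * h * (real j - real a)) * complex_of_real (\<kappa> (N1 (real j * h) + N2 (real a * h - real j * h)))"
          unfolding q_def y_def mult.assoc[symmetric] cis_mult by (simp add: algebra_simps)
        have "norm (p (j + r) - q j) = \<bar>\<kappa> (N1 (real (j + r) * h) + N2 (real a * h - real j * h)) - \<kappa> (N1 (real j * h) + N2 (real a * h - real j * h))\<bar>"
          unfolding p q by (rule norm_cis_mult_diff)
        also have "\<dots> \<le> \<bar>N1 (real (j + r) * h) - N1 (real j * h)\<bar>"
          by (rule order_trans[OF \<kappa>_lip]) simp
        also have "\<dots> \<le> N1 (real r * h)"
          by (rule order_trans[OF N1.abs_diff_le]) (simp add: algebra_simps)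
        finally show "norm (p (j + r) - q j) \<le> N1 (real r * h)" .
      qed (auto simp: p_def q_def norm_mult y_bd N1.nonneg)
      then have "norm ((\<Sum>j<n. p j) - (\<Sum>j<n. q j)) / real n \<le> N1 (real r * h) + 2 * real r * \<delta> / real n"
        using n by (simp add: field_simps)
      moreover have "x' (a + r) - x' a = (1 / of_nat n) * ((\<Sum>j<n. p j) - (\<Sum>j<n. q j))"
        unfolding x'_def x_def p_def q_def by (simp add: sum_distrib_left right_diff_distrib mult_ac)
      then have "norm (x' (a + r) - x' a) = norm ((\<Sum>j<n. p j) - (\<Sum>j<n. q j)) / real n"
        by (simp only: norm_mult norm_divide norm_of_nat norm_one times_divide_eq_left mult_1_left)
      ultimately show ?thesis by (simp only:)
    qed
    \<comment> \<open>The boundary term occurs twice, once from the mean that defines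
      \<open>x\<close> and once from the transform.\<close>
    have second: "norm (cis ((\<theta> - \<mu> * h) * real r) - 1) * c \<le> N1 (real r * h) + 2 * real r * \<delta> / real n + 2 * real r * \<delta> / real n" if "r \<le> n" for r
    proof (rule scale)
      show "norm (cis ((\<theta> - \<mu> * h) * real r) - 1) * norm X \<le> real n * (N1 (real r * h) + 2 * real r * \<delta> / real n) + 2 * real r * \<delta>"
        unfolding X'
      proof (rule norm_cis_minus_one_mult_sum_le[OF that])
        show "0 \<le> N1 (real r * h) + 2 * real r * \<delta> / real n" using N1.nonneg \<delta> n by simp
      qed (use x'_shift that in \<open>auto simp: x'_def norm_mult x_bd\<close>)
    qed simp
    have e1: "2 * real r * \<delta> / real n = real r * \<delta> / real m" for r
      unfolding n_def using m by simp
    have e2: "real r * \<delta> / real m + real r * \<delta> / real m = 2 * real r * \<delta> / real m" for r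
      by (simp add: add_divide_distrib[symmetric])
    show ?thesis
      using \<theta> first second e2 unfolding e1 by (intro exI[of _ \<theta>]) (simp add: n_def add.assoc)
  qed
  then show ?thesis using c by blast
qed


text \<open>The rescaled frequencies \<open>\<theta> M * real M\<close> of the approximate
  characters stay bounded by continuity of \<open>N2\<close> at 0, so a subsequence converges. The
  estimates of \<open>approximate_character\<close> pass to the limit with the same constant and
  lose their boundary terms, which yields Lipschitz bounds with C = 1 / c.\<close>

theorem pseudonorm_character_split:
  assumes "pseudonorm N1" "pseudonorm N2"
    and cont: "\<And>\<epsilon>. \<epsilon> > 0 \<Longrightarrow> \<exists>\<delta>>0. \<forall>\<tau>. N1 \<tau> + N2 \<tau> < \<delta> \<longrightarrow> norm (cis (\<mu> * \<tau>) - 1) < \<epsilon>"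
  shows "\<exists>\<nu> C. (\<forall>r. norm (cis (\<nu> * r) - 1) \<le> C * N2 r) \<and> (\<forall>r. norm (cis ((\<mu> - \<nu>) * r) - 1) \<le> C * N1 r)"
proof -
  interpret N1: pseudonorm N1 by fact
  interpret N2: pseudonorm N2 by fact
  obtain \<delta> where \<delta>: "\<delta> > 0" "\<And>\<tau>. N1 \<tau> + N2 \<tau> < \<delta> \<Longrightarrow> norm (cis (\<mu> * \<tau>) - 1) < 1 / 2"
    using cont[of "1 / 2"] by auto
  obtain c where c: "c > 0" and ex: "\<And>h m. m > 0 \<Longrightarrow> \<exists>\<theta>. \<bar>\<theta>\<bar> \<le> pi \<and> (\<forall>r\<le>2 * m.
     norm (cis (\<theta> * real r) - 1) * c \<le> N2 (real r * h) + real r * \<delta> / real m \<and>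
     norm (cis ((\<theta> - \<mu> * h) * real r) - 1) * c \<le> N1 (real r * h) + 2 * real r * \<delta> / real m)"
    using approximate_character[OF assms(1,2) \<delta>(1) less_imp_le[OF \<delta>(2)]] by metis
  \<comment> \<open>With step 1 / M and m = M^2 the mesh tends to 0 while the progression reaches up
    to time 2 * M, and the boundary error at time t is of order t / M.\<close>
  have "\<forall>M. \<exists>\<theta>. M > 0 \<longrightarrow> \<bar>\<theta>\<bar> \<le> pi \<and> (\<forall>r\<le>2 * M\<^sup>2.
     norm (cis (\<theta> * real r) - 1) * c \<le> N2 (real r * (1 / real M)) + real r * \<delta> / real (M\<^sup>2) \<and>
     norm (cis ((\<theta> - \<mu> * (1 / real M)) * real r) - 1) * c \<le> N1 (real r * (1 / real M)) + 2 * real r * \<delta> / real (M\<^sup>2))"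
    using ex[of "M\<^sup>2" "1 / real M" for M] by auto
  then obtain \<theta> where \<theta>: "\<And>M. M > 0 \<Longrightarrow> \<bar>\<theta> M\<bar> \<le> pi"
    and \<theta>2: "\<And>M r. M > 0 \<Longrightarrow> r \<le> 2 * M\<^sup>2 \<Longrightarrow> norm (cis (\<theta> M * real r) - 1) * c \<le> N2 (real r * (1 / real M)) + real r * \<delta> / real (M\<^sup>2)"
    and \<theta>1: "\<And>M r. M > 0 \<Longrightarrow> r \<le> 2 * M\<^sup>2 \<Longrightarrow> norm (cis ((\<theta> M - \<mu> * (1 / real M)) * real r) - 1) * c \<le> N1 (real r * (1 / real M)) + 2 * real r * \<delta> / real (M\<^sup>2)"
    by metis
  obtain \<eta> where \<eta>: "\<eta> > 0" "\<And>r. \<bar>r\<bar> < \<eta> \<Longrightarrow> N2 r < c / 2"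
    using N2.cont0[of "c / 2"] c by auto
  \<comment> \<open>The entries in turn ensure M > 0, indices r within 2 * M^2, a loss of at most
    one half by rounding down to \<open>r0\<close>, and a boundary error of at most c / 2.\<close>
  define M0 where "M0 = nat \<lceil>max (max 1 \<eta>) (max (4 / \<eta>) (\<eta> * \<delta> / c))\<rceil>"
  have bound: "\<bar>\<theta> M * real M\<bar> \<le> (pi / 3) * (4 / \<eta>)" if M: "M \<ge> M0" for M
  proof -
    have "max (max 1 \<eta>) (max (4 / \<eta>) (\<eta> * \<delta> / c)) \<le> real M0"
      unfolding M0_def by (rule real_nat_ceiling_ge)
    also have "\<dots> \<le> real M" using M by simp
    finally have M': "1 \<le> real M" "\<eta> \<le> real M" "4 / \<eta> \<le> real M" "\<eta> * \<delta> / c \<le> real M" by auto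
    then have Mpos: "M > 0" "real M > 0" by auto
    define r0 where "r0 = nat \<lfloor>\<eta> * real M / 2\<rfloor>"
    have r0: "real r0 \<le> \<eta> * real M / 2"
      unfolding r0_def using \<eta>(1) by (intro of_nat_floor) auto
    have r0': "real r0 \<ge> \<eta> * real M / 4"
    proof -
      have "real r0 \<ge> \<eta> * real M / 2 - 1"
        unfolding r0_def by linarith
      moreover have "\<eta> * real M \<ge> 4" using M'(3) \<eta>(1) by (simp add: field_simps)
      ultimately show ?thesis by linarith
    qed
    \<comment> \<open>Up to time \<eta> / 2 the pseudonorm \<open>N2\<close> is below c / 2; with
      the boundary error the chords stay at most 1, so the angles cannot wind around the
      circle.\<close>
    have "\<bar>\<theta> M\<bar> * real r0 \<le> pi / 3"
    proof (rule angle_multiple_bound[OF \<theta>[OF Mpos(1)]])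
      fix r assume "r \<le> r0"
      then have r: "real r \<le> \<eta> * real M / 2" using r0 by linarith
      have le: "r \<le> 2 * M\<^sup>2"
      proof -
        have "\<eta> * real M \<le> real M * real M" using M'(2) by (intro mult_right_mono) auto
        then have "real r \<le> real (2 * M\<^sup>2)"
          using r mult_nonneg_nonneg[of "real M" "real M"] Mpos unfolding of_nat_mult of_nat_power power2_eq_square
          by linarith
        then show ?thesis by (simp only: of_nat_le_iff)
      qed
      have "real r * \<delta> / real (M\<^sup>2) \<le> (\<eta> * real M / 2) * \<delta> / real (M\<^sup>2)"
        using r \<delta>(1) by (intro divide_right_mono mult_right_mono) auto
      also have "\<dots> = (\<eta> * \<delta> / c) / real M * (c / 2)"
        using Mpos c by (simp add: power2_eq_square)
      also have "\<dots> \<le> 1 * (c / 2)"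
        using M'(4) Mpos c by (intro mult_right_mono) (auto simp: divide_le_eq mult.commute)
      finally have 1: "real r * \<delta> / real (M\<^sup>2) \<le> c / 2" by simp
      have "N2 (real r * (1 / real M)) < c / 2"
      proof (rule \<eta>(2))
        have "real r * (1 / real M) \<le> \<eta> / 2" using r Mpos by (simp add: field_simps)
        moreover have "0 \<le> real r * (1 / real M)" by simp
        ultimately show "\<bar>real r * (1 / real M)\<bar> < \<eta>" using \<eta>(1) by linarith
      qed
      then have "norm (cis (\<theta> M * real r) - 1) * c \<le> 1 * c"
        using \<theta>2[OF Mpos(1) le] 1 by linarith
      then show "norm (cis (\<theta> M * real r) - 1) \<le> 1" using c by (simp only: mult_le_cancel_right_pos)
    qed
    moreover have "\<bar>\<theta> M\<bar> * (\<eta> * real M / 4) \<le> \<bar>\<theta> M\<bar> * real r0"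
      using r0' by (intro mult_left_mono) auto
    ultimately have "\<bar>\<theta> M\<bar> * (\<eta> * real M / 4) \<le> pi / 3" by linarith
    then show ?thesis using \<eta>(1) by (simp add: abs_mult field_simps)
  qed
  define \<nu>s where "\<nu>s = (\<lambda>k. \<theta> (k + M0 + 1) * real (k + M0 + 1))"
  have "bounded (range \<nu>s)"
  proof (unfold bounded_iff, intro exI ballI)
    fix x assume "x \<in> range \<nu>s"
    then obtain k where "x = \<theta> (k + M0 + 1) * real (k + M0 + 1)" unfolding \<nu>s_def by blast
    then show "norm x \<le> (pi / 3) * (4 / \<eta>)" using bound[of "k + M0 + 1"] by (simp only: real_norm_def)
  qed
  then obtain \<nu> s where s: "strict_mono s" "(\<nu>s \<circ> s) \<longlonglongrightarrow> \<nu>"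
    using bounded_imp_convergent_subsequence by blast
  define M where "M = (\<lambda>k. s k + M0 + 1)"
  have Mpos: "M k > 0" for k unfolding M_def by simp
  have M_lim: "filterlim M at_top sequentially"
    by (rule filterlim_at_top_mono[OF filterlim_subseq[OF s(1)]]) (auto simp: M_def)
  have inv_lim: "(\<lambda>k. 1 / real (M k)) \<longlonglongrightarrow> 0"
    using filterlim_compose[OF lim_1_over_n M_lim] .
  have \<nu>_lim: "(\<lambda>k. \<theta> (M k) * real (M k)) \<longlonglongrightarrow> \<nu>"
    using s(2) unfolding \<nu>s_def M_def o_def .
  have key: "norm (cis (\<nu> * t) - 1) * c \<le> N2 t \<and> norm (cis ((\<nu> - \<mu>) * t) - 1) * c \<le> N1 t" if t: "t \<ge> 0" for t
  proof -
    \<comment> \<open>The last grid index at or before time t; the grid times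
      \<open>real (r k) / real (M k)\<close> tend to t.\<close>
    define r where "r = (\<lambda>k. nat \<lfloor>t * real (M k)\<rfloor>)"
    have r_bounds: "t * real (M k) - 1 \<le> real (r k)" "real (r k) \<le> t * real (M k)" for k
    proof -
      show "real (r k) \<le> t * real (M k)" unfolding r_def using t by (intro of_nat_floor) auto
      show "t * real (M k) - 1 \<le> real (r k)" unfolding r_def by linarith
    qed
    have q_lim: "(\<lambda>k. real (r k) * (1 / real (M k))) \<longlonglongrightarrow> t"
    proof (rule tendsto_sandwich[of "\<lambda>k. t - 1 / real (M k)" _ _ "\<lambda>k. t"])
      show "(\<lambda>k. t - 1 / real (M k)) \<longlonglongrightarrow> t" using tendsto_diff[OF tendsto_const inv_lim, of t] by simp
      show "\<forall>\<^sub>F k in sequentially. t - 1 / real (M k) \<le> real (r k) * (1 / real (M k))"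
      proof (intro always_eventually allI)
        fix k
        show "t - 1 / real (M k) \<le> real (r k) * (1 / real (M k))"
          using divide_right_mono[OF r_bounds(1)[of k], of "real (M k)"] Mpos[of k] by (simp add: diff_divide_distrib)
      qed
      show "\<forall>\<^sub>F k in sequentially. real (r k) * (1 / real (M k)) \<le> t"
      proof (intro always_eventually allI)
        fix k
        show "real (r k) * (1 / real (M k)) \<le> t"
          using divide_right_mono[OF r_bounds(2)[of k], of "real (M k)"] Mpos[of k] by simp
      qed
    qed simp
    have err_lim: "(\<lambda>k. real (r k) * d / real ((M k)\<^sup>2)) \<longlonglongrightarrow> 0" for d
    proof -
      have "(\<lambda>k. (real (r k) * (1 / real (M k))) * (d * (1 / real (M k)))) \<longlonglongrightarrow> t * (d * 0)"
        by (intro tendsto_intros q_lim inv_lim)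
      then show ?thesis by (simp add: power2_eq_square)
    qed
    have "eventually (\<lambda>k. nat \<lceil>t\<rceil> \<le> M k) sequentially"
      using M_lim unfolding filterlim_at_top by (rule spec)
    then have ev: "eventually (\<lambda>k. r k \<le> 2 * (M k)\<^sup>2) sequentially"
    proof (rule eventually_mono)
      fix k assume "nat \<lceil>t\<rceil> \<le> M k"
      then have "t \<le> real (M k)" by linarith
      then have "t * real (M k) \<le> real (M k) * real (M k)" by (rule mult_right_mono) simp
      then have "real (r k) \<le> real (2 * (M k)\<^sup>2)"
        using r_bounds(2)[of k] mult_nonneg_nonneg[of "real (M k)" "real (M k)"]
        unfolding of_nat_mult of_nat_power power2_eq_square by simp
      then show "r k \<le> 2 * (M k)\<^sup>2" by (simp only: of_nat_le_iff)
    qed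
    have arg2: "\<theta> (M k) * real (r k) = (\<theta> (M k) * real (M k)) * (real (r k) * (1 / real (M k)))" for k
      using Mpos[of k] by simp
    have arg1: "(\<theta> (M k) - \<mu> * (1 / real (M k))) * real (r k) = (\<theta> (M k) * real (M k) - \<mu>) * (real (r k) * (1 / real (M k)))" for k
      using Mpos[of k] by (simp add: field_simps)
    have "norm (cis (\<nu> * t) - 1) * c \<le> N2 t + 0"
    proof (rule tendsto_le)
      show "(\<lambda>k. norm (cis (\<theta> (M k) * real (r k)) - 1) * c) \<longlonglongrightarrow> norm (cis (\<nu> * t) - 1) * c"
        unfolding arg2 by (intro tendsto_intros \<nu>_lim q_lim)
      show "(\<lambda>k. N2 (real (r k) * (1 / real (M k))) + real (r k) * \<delta> / real ((M k)\<^sup>2)) \<longlonglongrightarrow> N2 t + 0"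
        by (intro tendsto_add N2.tendsto_N q_lim err_lim)
      show "\<forall>\<^sub>F k in sequentially. norm (cis (\<theta> (M k) * real (r k)) - 1) * c \<le> N2 (real (r k) * (1 / real (M k))) + real (r k) * \<delta> / real ((M k)\<^sup>2)"
        using ev by (rule eventually_mono) (rule \<theta>2[OF Mpos])
    qed simp
    moreover have "norm (cis ((\<nu> - \<mu>) * t) - 1) * c \<le> N1 t + 0"
    proof (rule tendsto_le)
      show "(\<lambda>k. norm (cis ((\<theta> (M k) - \<mu> * (1 / real (M k))) * real (r k)) - 1) * c) \<longlonglongrightarrow> norm (cis ((\<nu> - \<mu>) * t) - 1) * c"
        unfolding arg1 by (intro tendsto_intros \<nu>_lim q_lim)
      have "2 * real (r k) * \<delta> / real ((M k)\<^sup>2) = real (r k) * (2 * \<delta>) / real ((M k)\<^sup>2)" for k by simp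
      then show "(\<lambda>k. N1 (real (r k) * (1 / real (M k))) + 2 * real (r k) * \<delta> / real ((M k)\<^sup>2)) \<longlonglongrightarrow> N1 t + 0"
        by (simp only:) (intro tendsto_add N1.tendsto_N q_lim err_lim)
      show "\<forall>\<^sub>F k in sequentially. norm (cis ((\<theta> (M k) - \<mu> * (1 / real (M k))) * real (r k)) - 1) * c \<le> N1 (real (r k) * (1 / real (M k))) + 2 * real (r k) * \<delta> / real ((M k)\<^sup>2)"
        using ev by (rule eventually_mono) (rule \<theta>1[OF Mpos])
    qed simp
    ultimately show ?thesis by simp
  qed
  have norm_neg: "norm (cis (- x) - 1) = norm (cis x - 1)" for x
    by (metis cis_cnj complex_cnj_diff complex_cnj_one complex_mod_cnj)
  have "norm (cis (\<nu> * t) - 1) \<le> (1 / c) * N2 t \<and> norm (cis ((\<mu> - \<nu>) * t) - 1) \<le> (1 / c) * N1 t" for t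
  proof -
    have "norm (cis (\<nu> * t) - 1) = norm (cis (\<nu> * \<bar>t\<bar>) - 1)"
      using norm_neg[of "\<nu> * t"] by (simp add: abs_if)
    moreover have "norm (cis ((\<mu> - \<nu>) * t) - 1) = norm (cis ((\<nu> - \<mu>) * \<bar>t\<bar>) - 1)"
      using norm_neg[of "(\<nu> - \<mu>) * t"] by (auto simp: abs_if algebra_simps)
    moreover have "N1 \<bar>t\<bar> = N1 t" "N2 \<bar>t\<bar> = N2 t"
      using N1.minus[of t] N2.minus[of t] by (auto simp: abs_if)
    ultimately show ?thesis using key[of "\<bar>t\<bar>"] c by (simp add: field_simps)
  qed
  then show ?thesis by blast
qed

section \<open>Sets of small density\<close>

definition window :: "real set \<Rightarrow> real \<Rightarrow> real \<Rightarrow> real" where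
  "window E a l = measure lebesgue (E \<inter> {a..a + l})"

text \<open>A quantitative bound on the upper Banach density: one length L serves windows at all
  positions. This makes the notion invariant under translation and subadditive under finite
  unions.\<close>

definition small :: "real set \<Rightarrow> real \<Rightarrow> bool" where
  "small E \<epsilon> \<longleftrightarrow> E \<in> sets lebesgue \<and> (\<exists>L>0. \<forall>l\<ge>L. \<forall>\<xi>. window E \<xi> l \<le> \<epsilon> * l)"

lemma lmeasurable_Int_Icc: "E \<in> sets lebesgue \<Longrightarrow> E \<inter> {a..b :: real} \<in> lmeasurable"
  by (subst Int_commute) (rule fmeasurable_Int_fmeasurable, auto)

lemma window_nonneg: "0 \<le> window E a l"
  by (simp add: window_def)

lemma window_mono:
  assumes "E \<subseteq> F" "E \<in> sets lebesgue" "F \<in> sets lebesgue"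
  shows "window E a l \<le> window F a l"
  unfolding window_def
  by (rule measure_mono_fmeasurable) (use assms lmeasurable_Int_Icc in \<open>auto intro: fmeasurableD\<close>)

lemma window_interval_mono:
  assumes "E \<in> sets lebesgue" "b \<le> a" "a + l \<le> b + m"
  shows "window E a l \<le> window E b m"
  unfolding window_def
  by (rule measure_mono_fmeasurable) (use assms lmeasurable_Int_Icc in \<open>auto intro: fmeasurableD\<close>)

lemma window_le_length:
  assumes "E \<in> sets lebesgue" "0 \<le> l"
  shows "window E a l \<le> l"
proof -
  have "window E a l \<le> measure lebesgue {a..a + l}"
    unfolding window_def by (rule measure_mono_fmeasurable) (use assms in auto)
  then show ?thesis using assms(2) by simp
qed

lemma window_Un_le:
  assumes "E \<in> sets lebesgue" "F \<in> sets lebesgue"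
  shows "window (E \<union> F) a l \<le> window E a l + window F a l"
  unfolding window_def Int_Un_distrib2
  by (rule measure_Un_le) (use assms lmeasurable_Int_Icc in \<open>auto intro: fmeasurableD\<close>)

lemma window_le_add:
  assumes "E \<subseteq> F \<union> G" "E \<in> sets lebesgue" "F \<in> sets lebesgue" "G \<in> sets lebesgue"
  shows "window E a l \<le> window F a l + window G a l"
  using window_mono[OF assms(1,2) sets.Un[OF assms(3,4)], of a l] window_Un_le[OF assms(3,4), of a l] by linarith

lemma translate_eq_image: "{t. t + \<tau> \<in> E} = (+) (- \<tau> :: real) ` E"
  by (auto simp: image_iff intro!: bexI[of _ "_ + \<tau>"])

lemma sets_lebesgue_translate: "E \<in> sets lebesgue \<Longrightarrow> {t. t + \<tau> \<in> E} \<in> sets lebesgue" for \<tau> :: real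
  unfolding translate_eq_image by (rule lebesgue_sets_translation)

lemma window_translate: "window {t. t + \<tau> \<in> E} a l = window E (a + \<tau>) l"
proof -
  have "{t. t + \<tau> \<in> E} \<inter> {a..a + l} = {t. t + \<tau> \<in> E \<inter> {a + \<tau>..a + \<tau> + l}}" by auto
  then show ?thesis unfolding window_def translate_eq_image using measure_translation by metis
qed

lemma borel_measurable_translate:
  fixes f :: "real \<Rightarrow> 'b::topological_space"
  assumes "f \<in> borel_measurable lebesgue"
  shows "(\<lambda>t. f (t + \<tau>)) \<in> borel_measurable lebesgue"
proof (rule measurableI)
  fix A :: "'b set" assume "A \<in> sets borel"
  then have "f -` A \<inter> space lebesgue \<in> sets lebesgue" using assms by (rule measurable_sets[rotated])
  then have "{t. t + \<tau> \<in> f -` A \<inter> space lebesgue} \<in> sets lebesgue" by (rule sets_lebesgue_translate)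
  then show "(\<lambda>t. f (t + \<tau>)) -` A \<inter> space lebesgue \<in> sets lebesgue" by (simp add: vimage_def)
qed simp

lemma AE_translate:
  assumes "AE t in lebesgue. P t"
  shows "AE t in lebesgue. P (t + \<tau> :: real)"
proof -
  obtain N where N: "N \<in> null_sets lebesgue" "{t. \<not> P t} \<subseteq> N"
    using assms by (auto simp: eventually_ae_filter)
  have "{t. t + \<tau> \<in> N} \<in> null_sets lebesgue"
  proof (rule null_setsI)
    show "{t. t + \<tau> \<in> N} \<in> sets lebesgue" using N by (intro sets_lebesgue_translate) auto
    have "(+) (- \<tau>) ` N \<in> null_sets lebesgue" using N(1) by (metis negligible_iff_null_sets negligible_translation)
    then show "emeasure lebesgue {t. t + \<tau> \<in> N} = 0" unfolding translate_eq_image by auto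
  qed
  then show ?thesis
    by (rule AE_I') (use N(2) in auto)
qed

text \<open>A window of length \<open>l' \<ge> l\<close> is covered by at most \<open>2 l'/l\<close> windows of length \<open>l\<close>.\<close>

lemma window_scale:
  assumes E: "E \<in> sets lebesgue" and l: "0 < l" and le: "\<And>\<xi>. window E \<xi> l \<le> \<epsilon> * l" and l': "l \<le> l'"
  shows "window E \<xi> l' \<le> 2 * \<epsilon> * l'"
proof -
  have e: "0 \<le> \<epsilon>" using le[of 0] window_nonneg[of E 0 l] l by (metis dual_order.trans mult_less_0_iff not_le)
  have n: "window E \<xi> (real n * l) \<le> real n * (\<epsilon> * l)" for n \<xi>
  proof (induction n)
    case 0
    show ?case using window_le_length[OF E, of 0 \<xi>] by simp
  next
    case (Suc n)
    have sub: "E \<inter> {\<xi>..\<xi> + real (Suc n) * l} \<subseteq> (E \<inter> {\<xi>..\<xi> + real n * l}) \<union> (E \<inter> {\<xi> + real n * l..\<xi> + real n * l + l})"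
      by (auto simp: algebra_simps)
    have "window E \<xi> (real (Suc n) * l) \<le> measure lebesgue ((E \<inter> {\<xi>..\<xi> + real n * l}) \<union> (E \<inter> {\<xi> + real n * l..\<xi> + real n * l + l}))"
      unfolding window_def by (rule measure_mono_fmeasurable[OF sub]) (use E lmeasurable_Int_Icc in \<open>auto intro: fmeasurableD\<close>)
    also have "\<dots> \<le> window E \<xi> (real n * l) + window E (\<xi> + real n * l) l"
      unfolding window_def by (rule measure_Un_le) (use E lmeasurable_Int_Icc in \<open>auto intro: fmeasurableD\<close>)
    also have "\<dots> \<le> real n * (\<epsilon> * l) + \<epsilon> * l" using Suc le by (intro add_mono) auto
    finally show ?case by (simp add: algebra_simps)
  qed
  define n where "n = nat \<lceil>l' / l\<rceil>"
  have "l' / l \<le> real n" unfolding n_def by (rule real_nat_ceiling_ge)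
  then have "window E \<xi> l' \<le> window E \<xi> (real n * l)"
    using l by (intro window_interval_mono E) (auto simp: field_simps)
  also have "\<dots> \<le> real n * (\<epsilon> * l)" by (rule n)
  also have "real n \<le> 2 * (l' / l)"
  proof -
    have "1 \<le> l' / l" using l l' by simp
    then show ?thesis unfolding n_def by linarith
  qed
  then have "real n * (\<epsilon> * l) \<le> 2 * (l' / l) * (\<epsilon> * l)" using e l by (intro mult_right_mono) auto
  also have "\<dots> = 2 * \<epsilon> * l'" using l by simp
  finally show ?thesis by simp
qed

text \<open>One window length suffices; passing to longer windows costs the factor 2 of
  \<open>window_scale\<close>.\<close>

lemma smallI_window:
  assumes "E \<in> sets lebesgue" "0 < l" "\<And>\<xi>. window E \<xi> l \<le> (\<epsilon> / 2) * l"
  shows "small E \<epsilon>"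
  unfolding small_def using window_scale[OF assms] assms by auto

lemma small_mono:
  assumes "small E \<epsilon>" "F \<subseteq> E" "F \<in> sets lebesgue" "\<epsilon> \<le> \<delta>"
  shows "small F \<delta>"
proof -
  obtain L where E: "E \<in> sets lebesgue" and L: "L > 0" "\<And>l \<xi>. l \<ge> L \<Longrightarrow> window E \<xi> l \<le> \<epsilon> * l"
    using assms(1) by (auto simp: small_def)
  have "window F \<xi> l \<le> \<delta> * l" if "l \<ge> L" for l \<xi>
  proof -
    have "window F \<xi> l \<le> window E \<xi> l" by (rule window_mono) fact+
    also have "\<dots> \<le> \<epsilon> * l" by (rule L) fact
    also have "\<dots> \<le> \<delta> * l" using assms(4) L(1) that by (intro mult_right_mono) auto
    finally show ?thesis .
  qed
  then show ?thesis using assms(3) L(1) by (auto simp: small_def)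
qed

lemma small_Un:
  assumes "small E \<epsilon>" "small F \<delta>"
  shows "small (E \<union> F) (\<epsilon> + \<delta>)"
proof -
  obtain L where E: "E \<in> sets lebesgue" and L: "L > 0" "\<And>l \<xi>. l \<ge> L \<Longrightarrow> window E \<xi> l \<le> \<epsilon> * l"
    using assms(1) by (auto simp: small_def)
  obtain M where F: "F \<in> sets lebesgue" and M: "M > 0" "\<And>l \<xi>. l \<ge> M \<Longrightarrow> window F \<xi> l \<le> \<delta> * l"
    using assms(2) by (auto simp: small_def)
  have "window (E \<union> F) \<xi> l \<le> (\<epsilon> + \<delta>) * l" if "l \<ge> max L M" for l \<xi>
    using window_Un_le[OF E F, of \<xi> l] L(2)[of l \<xi>] M(2)[of l \<xi>] that by (simp add: distrib_right)
  then show ?thesis using E F L(1) M(1) unfolding small_def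
    by (intro conjI sets.Un exI[of _ "max L M"]) auto
qed

lemma small_null: "N \<in> null_sets lebesgue \<Longrightarrow> small N 0"
proof -
  assume N: "N \<in> null_sets lebesgue"
  have "window N \<xi> l \<le> 0" for \<xi> l
  proof -
    have "N \<inter> {\<xi>..\<xi> + l} \<in> null_sets lebesgue" using N by (intro null_set_Int2) auto
    then show ?thesis unfolding window_def by (simp add: measure_eq_0_null_sets)
  qed
  then show ?thesis using N by (auto simp: small_def intro!: exI[of _ 1])
qed

lemma small_UN:
  assumes "finite I" "\<And>i. i \<in> I \<Longrightarrow> small (E i) (\<epsilon> i)"
  shows "small (\<Union>i\<in>I. E i) (\<Sum>i\<in>I. \<epsilon> i)"
  using assms
proof (induction rule: finite_induct)
  case empty
  then show ?case by (simp add: small_null)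
next
  case (insert i I)
  then show ?case by (auto intro!: small_Un)
qed

section \<open>Kernels on the time axis\<close>

definition kernel_uc :: "(real \<Rightarrow> real \<Rightarrow> real) \<Rightarrow> (real \<Rightarrow> real) \<Rightarrow> bool" where
  "kernel_uc e v \<longleftrightarrow> (\<forall>\<epsilon>>0. \<exists>\<delta>>0. \<forall>t t'. e t t' < \<delta> \<longrightarrow> \<bar>v t - v t'\<bar> < \<epsilon>)"

text \<open>Deviations are measured in the manner of Ky Fan rather than by the mean of \<open>e\<close>. For bounded kernels both
  ways are equivalent, and this one needs no integrals.\<close>

definition almost_period :: "(real \<Rightarrow> real \<Rightarrow> real) \<Rightarrow> real \<Rightarrow> real \<Rightarrow> real \<Rightarrow> bool" where
  "almost_period e l \<epsilon> \<tau> \<longleftrightarrow> (\<forall>\<xi>. window {t. \<epsilon> \<le> e t (t + \<tau>)} \<xi> l \<le> \<epsilon> * l)"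

text \<open>Threshold and density are bounded by the same \<epsilon>, which is what gives the
  triangle inequality. Since kernels are bounded by 1, the set contains 2 and the infimum is
  genuine.\<close>

definition kernel_norm :: "(real \<Rightarrow> real \<Rightarrow> real) \<Rightarrow> real \<Rightarrow> real" where
  "kernel_norm e \<tau> = Inf {\<epsilon>. \<epsilon> > 0 \<and> (\<exists>L. \<forall>l\<ge>L. almost_period e l \<epsilon> \<tau>)}"

text \<open>The last two assumptions express measurability of an underlying function without
  mentioning its values: the values at countably many times come arbitrarily close to almost every
  value.\<close>

locale kernel =
  fixes e :: "real \<Rightarrow> real \<Rightarrow> real"
  assumes refl: "e t t = 0"
    and sym: "e t s = e s t"
    and triangle: "e t u \<le> e t s + e s u"
    and le_one: "e t s \<le> 1"
    and section_measurable [measurable]: "(\<lambda>t. e t s) \<in> borel_measurable lebesgue"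
    and separable: "\<exists>s :: nat \<Rightarrow> real. AE t in lebesgue. \<forall>\<delta>>0. \<exists>j. e t (s j) < \<delta>"
begin

lemma nonneg: "0 \<le> e t s"
  using triangle[of t t s] refl[of t] sym[of t s] by simp

text \<open>With the first \<open>s j\<close> that is close to t in place of c, \<open>V c t\<close>
  becomes a function glued measurably from countably many, and such functions converge to
  \<open>u\<close> almost everywhere. Where no index qualifies the value of \<open>LEAST\<close> is
  arbitrary, but this concerns a null set.\<close>

lemma approx_measurable:
  fixes u :: "real \<Rightarrow> real"
  assumes V: "\<And>c. V c \<in> borel_measurable lebesgue"
    and approx: "\<And>\<epsilon>. \<epsilon> > 0 \<Longrightarrow> \<exists>\<delta>>0. \<forall>t c. e t c < \<delta> \<longrightarrow> \<bar>u t - V c t\<bar> < \<epsilon>"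
  shows "u \<in> borel_measurable lebesgue"
proof -
  obtain s :: "nat \<Rightarrow> real" where s: "AE t in lebesgue. \<forall>\<delta>>0. \<exists>j. e t (s j) < \<delta>"
    using separable by blast
  have "\<forall>n. \<exists>\<delta>>0. \<forall>t c. e t c < \<delta> \<longrightarrow> \<bar>u t - V c t\<bar> < 1 / real (Suc n)"
    using approx by simp
  then obtain \<delta> where \<delta>: "\<And>n. \<delta> n > 0" "\<And>n t c. e t c < \<delta> n \<Longrightarrow> \<bar>u t - V c t\<bar> < 1 / real (Suc n)"
    by metis
  define J where "J = (\<lambda>n t. LEAST j. e t (s j) < \<delta> n)"
  have J_meas: "J n \<in> measurable lebesgue (count_space UNIV)" for n
    unfolding J_def by measurable
  define w where "w = (\<lambda>n t. V (s (J n t)) t)"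
  have w_meas: "w n \<in> borel_measurable lebesgue" for n
    unfolding w_def using V J_meas by (rule measurable_compose_countable)
  have lim_meas: "(\<lambda>t. lim (\<lambda>n. w n t)) \<in> borel_measurable lebesgue"
    using w_meas by (rule borel_measurable_lim_metric)
  have "AE t in lebesgue. lim (\<lambda>n. w n t) = u t"
    using s
  proof eventually_elim
    case (elim t)
    have "\<bar>w n t - u t\<bar> < 1 / real (Suc n)" for n
    proof -
      have "e t (s (J n t)) < \<delta> n"
        unfolding J_def by (rule LeastI_ex[where P = "\<lambda>j. e t (s j) < \<delta> n"]) (use elim \<delta>(1)[of n] in blast)
      then show ?thesis unfolding w_def using \<delta>(2)[of t "s (J n t)" n] by (simp add: abs_minus_commute)
    qed
    then have "(\<lambda>n. w n t - u t) \<longlonglongrightarrow> 0"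
      by (intro Lim_null_comparison[OF _ LIMSEQ_Suc[OF lim_1_over_n]] always_eventually allI) (simp add: less_imp_le)
    then show "lim (\<lambda>n. w n t) = u t"
      by (intro limI) (simp add: LIM_zero_iff)
  qed
  then show ?thesis by (rule borel_measurable_AE[OF lim_meas])
qed

lemma uc_measurable:
  assumes "kernel_uc e v"
  shows "v \<in> borel_measurable lebesgue"
proof (rule approx_measurable[of "\<lambda>c t. v c"])
  show "\<exists>\<delta>>0. \<forall>t c. e t c < \<delta> \<longrightarrow> \<bar>v t - v c\<bar> < \<epsilon>" if "\<epsilon> > 0" for \<epsilon>
    using assms that unfolding kernel_uc_def by blast
qed simp

text \<open>Both arguments of the kernel move, whereas the locale provides measurable sections. The
  first argument is frozen at a nearby c, and \<open>e (t + \<tau>) c\<close> is a translated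
  section.\<close>

lemma shift_measurable [measurable]: "(\<lambda>t. e t (t + \<tau>)) \<in> borel_measurable lebesgue"
proof (rule approx_measurable[of "\<lambda>c t. e (t + \<tau>) c"])
  show "(\<lambda>t. e (t + \<tau>) c) \<in> borel_measurable lebesgue" for c
    by (rule borel_measurable_translate) (rule section_measurable)
  fix \<epsilon> :: real assume "\<epsilon> > 0"
  moreover have "\<bar>e t (t + \<tau>) - e (t + \<tau>) c\<bar> \<le> e t c" for t c
    using triangle[of t "t + \<tau>" c] triangle[of c "t + \<tau>" t] sym[of c "t + \<tau>"] sym[of c t] by linarith
  ultimately show "\<exists>\<delta>>0. \<forall>t c. e t c < \<delta> \<longrightarrow> \<bar>e t (t + \<tau>) - e (t + \<tau>) c\<bar> < \<epsilon>"
    by (meson order_le_less_trans)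
qed

lemma deviation_sets: "{t. \<epsilon> \<le> e t (t + \<tau>)} \<in> sets lebesgue"
  using measurable_sets[OF shift_measurable, of "{\<epsilon>..}" \<tau>] by (simp add: vimage_def)

lemma section_sets: "{t. e t s < \<delta>} \<in> sets lebesgue"
  using measurable_sets[OF section_measurable, of "{..<\<delta>}" s] by (simp add: vimage_def)

lemma section_sets_ge: "{t. \<delta> \<le> e t s} \<in> sets lebesgue"
  using measurable_sets[OF section_measurable, of "{\<delta>..}" s] by (simp add: vimage_def)

lemma tail_sets: "{t. \<forall>j<J. \<delta> \<le> e t (s j)} \<in> sets lebesgue" for J :: nat
proof (induction J)
  case (Suc J)
  have "{t. \<forall>j<Suc J. \<delta> \<le> e t (s j)} = {t. \<forall>j<J. \<delta> \<le> e t (s j)} \<inter> {t. \<delta> \<le> e t (s J)}"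
    by (auto simp: less_Suc_eq)
  then show ?case using sets.Int[OF Suc section_sets_ge[of \<delta> "s J"]] by (simp only:)
qed auto

lemma almost_period_add:
  assumes "almost_period e l \<epsilon> \<tau>" "almost_period e l \<delta> \<sigma>"
  shows "almost_period e l (\<epsilon> + \<delta>) (\<tau> + \<sigma>)"
  unfolding almost_period_def
proof
  fix \<xi>
  have "{t. \<epsilon> + \<delta> \<le> e t (t + (\<tau> + \<sigma>))} \<subseteq> {t. \<epsilon> \<le> e t (t + \<tau>)} \<union> {t. t + \<tau> \<in> {t. \<delta> \<le> e t (t + \<sigma>)}}"
  proof
    fix t assume "t \<in> {t. \<epsilon> + \<delta> \<le> e t (t + (\<tau> + \<sigma>))}"
    then show "t \<in> {t. \<epsilon> \<le> e t (t + \<tau>)} \<union> {t. t + \<tau> \<in> {t. \<delta> \<le> e t (t + \<sigma>)}}"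
      using triangle[of t "t + (\<tau> + \<sigma>)" "t + \<tau>"] by (auto simp: add.assoc)
  qed
  then have "window {t. \<epsilon> + \<delta> \<le> e t (t + (\<tau> + \<sigma>))} \<xi> l
     \<le> window {t. \<epsilon> \<le> e t (t + \<tau>)} \<xi> l + window {t. t + \<tau> \<in> {t. \<delta> \<le> e t (t + \<sigma>)}} \<xi> l"
    by (intro window_le_add sets_lebesgue_translate deviation_sets)
  also have "\<dots> \<le> \<epsilon> * l + \<delta> * l"
    unfolding window_translate using assms by (intro add_mono) (auto simp: almost_period_def)
  finally show "window {t. \<epsilon> + \<delta> \<le> e t (t + (\<tau> + \<sigma>))} \<xi> l \<le> (\<epsilon> + \<delta>) * l"
    by (simp add: distrib_right)
qed

lemma almost_period_minus:
  assumes "almost_period e l \<epsilon> \<tau>"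
  shows "almost_period e l \<epsilon> (- \<tau>)"
  unfolding almost_period_def
proof
  fix \<xi>
  have "{t. \<epsilon> \<le> e t (t + - \<tau>)} = {t. t + - \<tau> \<in> {t. \<epsilon> \<le> e t (t + \<tau>)}}"
    using sym by auto
  then show "window {t. \<epsilon> \<le> e t (t + - \<tau>)} \<xi> l \<le> \<epsilon> * l"
    using assms by (simp only: window_translate almost_period_def)
qed

lemma almost_period_mono:
  assumes "almost_period e l \<epsilon> \<tau>" "\<epsilon> \<le> \<delta>" "0 \<le> l"
  shows "almost_period e l \<delta> \<tau>"
  unfolding almost_period_def
proof
  fix \<xi>
  have "window {t. \<delta> \<le> e t (t + \<tau>)} \<xi> l \<le> window {t. \<epsilon> \<le> e t (t + \<tau>)} \<xi> l"
    by (intro window_mono deviation_sets) (use assms in auto)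
  also have "\<dots> \<le> \<epsilon> * l" using assms by (simp add: almost_period_def)
  also have "\<dots> \<le> \<delta> * l" using assms by (intro mult_right_mono)
  finally show "window {t. \<delta> \<le> e t (t + \<tau>)} \<xi> l \<le> \<delta> * l" .
qed

lemma almost_period_nonneg:
  assumes "almost_period e l \<epsilon> \<tau>" "0 < l"
  shows "0 \<le> \<epsilon>"
proof -
  have "0 \<le> \<epsilon> * l"
    using assms window_nonneg[of "{t. \<epsilon> \<le> e t (t + \<tau>)}" 0 l] unfolding almost_period_def by (meson order_trans)
  then show ?thesis using assms(2) by (simp add: zero_le_mult_iff)
qed

lemma almost_period_scale:
  assumes "almost_period e l \<epsilon> \<tau>" "0 < l" "l \<le> l'"
  shows "almost_period e l' (2 * \<epsilon>) \<tau>"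
  unfolding almost_period_def
proof
  fix \<xi>
  have "window {t. 2 * \<epsilon> \<le> e t (t + \<tau>)} \<xi> l' \<le> window {t. \<epsilon> \<le> e t (t + \<tau>)} \<xi> l'"
    using almost_period_nonneg[OF assms(1,2)] by (intro window_mono deviation_sets) auto
  also have "\<dots> \<le> 2 * \<epsilon> * l'"
    by (rule window_scale[OF deviation_sets assms(2) _ assms(3)]) (use assms in \<open>auto simp: almost_period_def\<close>)
  finally show "window {t. 2 * \<epsilon> \<le> e t (t + \<tau>)} \<xi> l' \<le> 2 * \<epsilon> * l'" .
qed

lemma almost_period_trivial: "1 < \<epsilon> \<Longrightarrow> 0 \<le> l \<Longrightarrow> almost_period e l \<epsilon> \<tau>"
proof -
  assume *: "1 < \<epsilon>" "0 \<le> l"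
  have "\<not> \<epsilon> \<le> e t (t + \<tau>)" for t using le_one[of t "t + \<tau>"] * by linarith
  then show ?thesis using * by (simp add: almost_period_def window_def)
qed

lemma almost_period_zero: "0 < \<epsilon> \<Longrightarrow> 0 \<le> l \<Longrightarrow> almost_period e l \<epsilon> 0"
proof -
  assume *: "0 < \<epsilon>" "0 \<le> l"
  have "\<not> \<epsilon> \<le> e t (t + 0)" for t using refl[of t] * by simp
  then show ?thesis using * by (simp add: almost_period_def window_def)
qed

text \<open>The sets decrease to a null set as J grows, and continuity of measure from above applies
  inside a bounded window.\<close>

lemma tail_window:
  assumes ae: "AE t in lebesgue. \<exists>j. e t (s j) < \<delta>" and "\<epsilon> > 0"
  shows "\<exists>J :: nat. window {t. \<forall>j<J. \<delta> \<le> e t (s j)} a l \<le> \<epsilon>"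
proof -
  define A where "A = (\<lambda>J :: nat. {t. \<forall>j<J. \<delta> \<le> e t (s j)} \<inter> {a..a + l})"
  have A_meas: "A J \<in> lmeasurable" for J
    unfolding A_def by (intro lmeasurable_Int_Icc tail_sets)
  have "(\<lambda>n. measure lebesgue (A n)) \<longlonglongrightarrow> measure lebesgue (\<Inter>i. A i)"
  proof (rule Lim_measure_decseq)
    show "range A \<subseteq> sets lebesgue" using A_meas by (auto dest: fmeasurableD)
    show "decseq A" unfolding A_def by (intro antimonoI) auto
    show "emeasure lebesgue (A i) \<noteq> \<infinity>" for i using fmeasurableD2[OF A_meas[of i]] by (simp only: infinity_ennreal_def not_False_eq_True)
  qed
  moreover have "(\<Inter>i. A i) \<in> null_sets lebesgue"
  proof -
    have "(\<Inter>i. A i) \<in> sets lebesgue" using A_meas by (auto dest: fmeasurableD)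
    moreover have "AE t in lebesgue. t \<notin> (\<Inter>i. A i)"
      using ae
    proof eventually_elim
      case (elim t)
      then obtain j where "e t (s j) < \<delta>" by blast
      then have "t \<notin> A (Suc j)" by (auto simp: A_def not_le intro!: exI[of _ j])
      then show ?case by blast
    qed
    ultimately show ?thesis by (simp add: completion.null_sets_iff_AE)
  qed
  ultimately have "(\<lambda>n. measure lebesgue (A n)) \<longlonglongrightarrow> 0" by (simp add: measure_eq_0_null_sets)
  then have "eventually (\<lambda>n. measure lebesgue (A n) < \<epsilon>) sequentially"
    using assms(2) by (rule order_tendstoD(2))
  then obtain J where "measure lebesgue (A J) < \<epsilon>" by (auto simp: eventually_sequentially)
  then have "window {t. \<forall>j<J. \<delta> \<le> e t (s j)} a l \<le> \<epsilon>"
    unfolding A_def window_def by (rule less_imp_le)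
  then show ?thesis ..
qed

text \<open>Lusin's argument: up to small measure, the interval is a finite union of compact sets on each of
  which \<open>e\<close> is small, and a shift below their mutual distances does not lead from one to another.\<close>

lemma local_shift_continuity:
  assumes \<epsilon>: "\<epsilon> > 0"
  shows "\<exists>\<delta>>0. \<forall>r. \<bar>r\<bar> < \<delta> \<longrightarrow> window {t. \<epsilon> \<le> e t (t + r)} a l \<le> \<epsilon>"
proof -
  obtain s :: "nat \<Rightarrow> real" where s: "AE t in lebesgue. \<forall>\<delta>>0. \<exists>j. e t (s j) < \<delta>"
    using separable by blast
  then have "AE t in lebesgue. \<exists>j. e t (s j) < \<epsilon> / 2"
  proof eventually_elim
    case (elim t)
    show ?case using elim[rule_format, OF half_gt_zero[OF \<epsilon>]] .
  qed
  then obtain J where J: "window {t. \<forall>j<J. \<epsilon> / 2 \<le> e t (s j)} a l \<le> \<epsilon> / 8"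
    using tail_window[of s "\<epsilon> / 2" "\<epsilon> / 8"] \<epsilon> by fastforce
  define I where "I = {a..a + l}"
  \<comment> \<open>Disjoint pieces; two points of one piece are both within \<epsilon> / 2 of the
    same \<open>s j\<close>, so \<open>e\<close> is below \<epsilon> between them.\<close>
  define D where "D = (\<lambda>j. ({t. e t (s j) < \<epsilon> / 2} - (\<Union>i<j. {t. e t (s i) < \<epsilon> / 2})) \<inter> I)"
  have D_sets: "D j \<in> sets lebesgue" for j
    unfolding D_def I_def by (intro sets.Int sets.Diff sets.finite_UN section_sets) auto
  have "\<forall>j. \<exists>K. closed K \<and> K \<subseteq> D j \<and> D j - K \<in> lmeasurable \<and> emeasure lebesgue (D j - K) < ennreal (\<epsilon> / (8 * real (Suc J)))"
  proof
    fix j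
    show "\<exists>K. closed K \<and> K \<subseteq> D j \<and> D j - K \<in> lmeasurable \<and> emeasure lebesgue (D j - K) < ennreal (\<epsilon> / (8 * real (Suc J)))"
      using sets_lebesgue_inner_closed[OF D_sets[of j], of "\<epsilon> / (8 * real (Suc J))"] \<epsilon>
      by (metis divide_pos_pos mult_pos_pos of_nat_0_less_iff zero_less_Suc zero_less_numeral)
  qed
  then obtain K where K: "\<And>j. closed (K j)" "\<And>j. K j \<subseteq> D j" "\<And>j. D j - K j \<in> lmeasurable"
    and K_m: "\<And>j. emeasure lebesgue (D j - K j) < ennreal (\<epsilon> / (8 * real (Suc J)))"
    by metis
  have K_m': "measure lebesgue (D j - K j) \<le> \<epsilon> / (8 * real (Suc J))" for j
    using K_m[of j] K(3)[of j] \<epsilon> by (simp add: emeasure_eq_measure2 ennreal_less_iff)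
  have D_disj: "D i \<inter> D j = {}" if "i < j" for i j
    using that by (auto simp: D_def)
  have compact_K: "compact (K j)" for j
    unfolding compact_eq_bounded_closed using K(1,2)[of j]
    by (auto simp: D_def I_def intro: bounded_subset[OF bounded_closed_interval])
  have "\<forall>j\<in>{..<J}. eventually (\<lambda>d. \<forall>x\<in>K j. \<forall>y\<in>(\<Union>i\<in>{..<J} - {j}. K i). d \<le> dist x y) (at_right (0 :: real))"
  proof
    fix j assume "j \<in> {..<J}"
    have "K j \<inter> (\<Union>i\<in>{..<J} - {j}. K i) = {}"
    proof -
      have "K j \<inter> K i = {}" if "i \<noteq> j" for i
        using K(2)[of i] K(2)[of j] D_disj[of i j] D_disj[of j i] that by (cases "i < j") auto
      then show ?thesis by blast
    qed
    moreover have "closed (\<Union>i\<in>{..<J} - {j}. K i)" using K(1) by (intro closed_UN) auto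
    ultimately obtain d where d: "d > 0" "\<forall>x\<in>K j. \<forall>y\<in>(\<Union>i\<in>{..<J} - {j}. K i). d \<le> dist x y"
      using separate_compact_closed[OF compact_K[of j]] by blast
    then show "eventually (\<lambda>d. \<forall>x\<in>K j. \<forall>y\<in>(\<Union>i\<in>{..<J} - {j}. K i). d \<le> dist x y) (at_right (0 :: real))"
      by (intro eventually_at_rightI[of 0 d]) force+
  qed
  then have "eventually (\<lambda>d. \<forall>j\<in>{..<J}. \<forall>x\<in>K j. \<forall>y\<in>(\<Union>i\<in>{..<J} - {j}. K i). d \<le> dist x y) (at_right (0 :: real))"
    by (intro eventually_ball_finite) auto
  moreover have "eventually (\<lambda>d. d < \<epsilon> / 4) (at_right (0 :: real))"
    using \<epsilon> by (intro eventually_at_rightI[of 0 "\<epsilon> / 4"]) auto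
  moreover have "eventually (\<lambda>d. 0 < d) (at_right (0 :: real))"
    by (rule eventually_at_right_less)
  ultimately have "eventually (\<lambda>d. (\<forall>j\<in>{..<J}. \<forall>x\<in>K j. \<forall>y\<in>(\<Union>i\<in>{..<J} - {j}. K i). d \<le> dist x y) \<and> d < \<epsilon> / 4 \<and> 0 < d) (at_right (0 :: real))"
    by eventually_elim auto
  from eventually_happens'[OF trivial_limit_at_right_real this]
  obtain d where d0: "(\<forall>j\<in>{..<J}. \<forall>x\<in>K j. \<forall>y\<in>(\<Union>i\<in>{..<J} - {j}. K i). d \<le> dist x y) \<and> d < \<epsilon> / 4 \<and> 0 < d" ..
  then have d: "0 < d" "d < \<epsilon> / 4" by auto
  have sep: "d \<le> dist x y" if "i < J" "j < J" "i \<noteq> j" "x \<in> K j" "y \<in> K i" for i j x y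
    using d0 that by blast
  define G where "G = I - (\<Union>j<J. K j)"
  have K_sets: "K j \<in> sets lebesgue" for j using K(1) by auto
  have G_meas: "G \<in> lmeasurable"
    unfolding G_def I_def by (intro fmeasurable_Diff sets.finite_UN K_sets) auto
  have G_le: "measure lebesgue G \<le> \<epsilon> / 4"
  proof -
    have sub: "G \<subseteq> ({t. \<forall>j<J. \<epsilon> / 2 \<le> e t (s j)} \<inter> I) \<union> (\<Union>j<J. D j - K j)"
    proof
      fix t assume t: "t \<in> G"
      show "t \<in> ({t. \<forall>j<J. \<epsilon> / 2 \<le> e t (s j)} \<inter> I) \<union> (\<Union>j<J. D j - K j)"
      proof (cases "\<forall>j<J. \<epsilon> / 2 \<le> e t (s j)")
        case False
        then obtain i where i: "i < J" "e t (s i) < \<epsilon> / 2" by (auto simp: not_le)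
        define j where "j = (LEAST j. e t (s j) < \<epsilon> / 2)"
        have "e t (s j) < \<epsilon> / 2" "j \<le> i" unfolding j_def using i by (auto intro: LeastI Least_le)
        moreover have "\<not> e t (s k) < \<epsilon> / 2" if "k < j" for k using not_less_Least that unfolding j_def by blast
        ultimately have "t \<in> D j" "j < J" using i t by (auto simp: D_def G_def)
        then show ?thesis using t by (auto simp: G_def)
      qed (use t in \<open>auto simp: G_def\<close>)
    qed
    have m1: "{t. \<forall>j<J. \<epsilon> / 2 \<le> e t (s j)} \<inter> I \<in> lmeasurable" unfolding I_def by (intro lmeasurable_Int_Icc tail_sets)
    have m3: "measure lebesgue ({t. \<forall>j<J. \<epsilon> / 2 \<le> e t (s j)} \<inter> I) \<le> \<epsilon> / 8"
      using J by (simp only: window_def I_def)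
    have m4: "measure lebesgue (\<Union>j<J. D j - K j) \<le> (\<Sum>j<J. measure lebesgue (D j - K j))"
      by (rule measure_UNION_le[where F = "\<lambda>j. D j - K j"], rule finite_lessThan, rule fmeasurableD, rule K(3))
    have m2: "(\<Union>j<J. D j - K j) \<in> lmeasurable"
      by (rule fmeasurable.finite_UN) (auto intro: K(3))
    have 1: "measure lebesgue G \<le> measure lebesgue (({t. \<forall>j<J. \<epsilon> / 2 \<le> e t (s j)} \<inter> I) \<union> (\<Union>j<J. D j - K j))"
      by (rule measure_mono_fmeasurable[OF sub fmeasurableD[OF G_meas] fmeasurable.Un[OF m1 m2]])
    have 2: "measure lebesgue (({t. \<forall>j<J. \<epsilon> / 2 \<le> e t (s j)} \<inter> I) \<union> (\<Union>j<J. D j - K j))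
        \<le> measure lebesgue ({t. \<forall>j<J. \<epsilon> / 2 \<le> e t (s j)} \<inter> I) + measure lebesgue (\<Union>j<J. D j - K j)"
      by (rule measure_Un_le[OF fmeasurableD[OF m1] fmeasurableD[OF m2]])
    have 3: "(\<Sum>j<J. measure lebesgue (D j - K j)) \<le> real (card {..<J}) * (\<epsilon> / (8 * real (Suc J)))"
      by (rule sum_bounded_above) (rule K_m')
    have 4: "real (card {..<J}) * (\<epsilon> / (8 * real (Suc J))) \<le> \<epsilon> / 8"
      using \<epsilon> by (simp add: field_simps)
    show ?thesis using 1 2 m3 m4 3 4 by linarith
  qed
  have "window {t. \<epsilon> \<le> e t (t + r)} a l \<le> \<epsilon>" if r: "\<bar>r\<bar> < d" for r
  proof -
    \<comment> \<open>Apart from t or t + r lying in the remainder \<open>G\<close>, the shift may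
      leave the interval, which happens only within \<bar>r\<bar> of an end.\<close>
    have sub: "{t. \<epsilon> \<le> e t (t + r)} \<inter> I \<subseteq> (G \<union> {t. t + r \<in> G}) \<union> ({a..a + \<bar>r\<bar>} \<union> {a + l - \<bar>r\<bar>..a + l})"
    proof
      fix t assume t: "t \<in> {t. \<epsilon> \<le> e t (t + r)} \<inter> I"
      show "t \<in> (G \<union> {t. t + r \<in> G}) \<union> ({a..a + \<bar>r\<bar>} \<union> {a + l - \<bar>r\<bar>..a + l})"
      proof (rule ccontr)
        assume n: "\<not> ?thesis"
        then have "t + r \<in> I" using t by (auto simp: I_def abs_if split: if_splits)
        then obtain i j where ij: "i < J" "t \<in> K i" "j < J" "t + r \<in> K j" using n t by (auto simp: G_def)
        show False
        proof (cases "i = j")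
          case True
          then have "e t (s i) < \<epsilon> / 2" "e (t + r) (s i) < \<epsilon> / 2" using ij K(2)[of i] by (auto simp: D_def)
          then show False using t triangle[of t "t + r" "s i"] sym[of "t + r" "s i"] by auto
        next
          case False
          then have "d \<le> dist t (t + r)" using sep[of j i t "t + r"] ij by auto
          then show False using r by (simp add: dist_real_def)
        qed
      qed
    qed
    have Gr: "{t. t + r \<in> G} \<in> lmeasurable"
      unfolding translate_eq_image using G_meas by (rule measurable_translation)
    have GG: "G \<union> {t. t + r \<in> G} \<in> lmeasurable" by (rule fmeasurable.Un[OF G_meas Gr])
    have EE: "{a..a + \<bar>r\<bar>} \<union> {a + l - \<bar>r\<bar>..a + l} \<in> lmeasurable" by (rule fmeasurable.Un) auto
    have B: "{t. \<epsilon> \<le> e t (t + r)} \<inter> I \<in> lmeasurable" unfolding I_def by (rule lmeasurable_Int_Icc[OF deviation_sets])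
    have "measure lebesgue ({t. \<epsilon> \<le> e t (t + r)} \<inter> I)
       \<le> measure lebesgue ((G \<union> {t. t + r \<in> G}) \<union> ({a..a + \<bar>r\<bar>} \<union> {a + l - \<bar>r\<bar>..a + l}))"
      by (rule measure_mono_fmeasurable[OF sub fmeasurableD[OF B] fmeasurable.Un[OF GG EE]])
    also have "\<dots> \<le> measure lebesgue (G \<union> {t. t + r \<in> G}) + measure lebesgue ({a..a + \<bar>r\<bar>} \<union> {a + l - \<bar>r\<bar>..a + l})"
      by (rule measure_Un_le[OF fmeasurableD[OF GG] fmeasurableD[OF EE]])
    also have "\<dots> \<le> (measure lebesgue G + measure lebesgue {t. t + r \<in> G}) + (measure lebesgue {a..a + \<bar>r\<bar>} + measure lebesgue {a + l - \<bar>r\<bar>..a + l})"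
      by (rule add_mono[OF measure_Un_le[OF fmeasurableD[OF G_meas] fmeasurableD[OF Gr]] measure_Un_le]) auto
    also have "\<dots> \<le> (\<epsilon> / 4 + \<epsilon> / 4) + (\<bar>r\<bar> + \<bar>r\<bar>)"
      using G_le unfolding translate_eq_image measure_translation by (intro add_mono) auto
    also have "\<dots> \<le> \<epsilon>" using r d by linarith
    finally show ?thesis unfolding window_def I_def .
  qed
  then show ?thesis using d(1) by blast
qed

end

section \<open>Almost periodic kernels\<close>

locale ap_kernel = kernel +
  assumes almost_periodic: "\<epsilon> > 0 \<Longrightarrow> \<exists>l>0. relatively_dense {\<tau>. almost_period e l \<epsilon> \<tau>}"
begin

text \<open>Every window of length \<open>l\<close> can be compared with a window inside the fixed interval \<open>{0..a + l}\<close>.\<close>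

lemma reference_window:
  assumes "\<epsilon> > 0"
  shows "\<exists>l>0. \<exists>a>0. \<forall>\<xi>. \<exists>\<tau>. almost_period e l \<epsilon> \<tau> \<and> 0 \<le> \<xi> + \<tau> \<and> \<xi> + \<tau> \<le> a"
proof -
  obtain l a where l: "l > 0" "a > 0" and dense: "\<And>\<xi>. {\<xi>..\<xi> + a} \<inter> {\<tau>. almost_period e l \<epsilon> \<tau>} \<noteq> {}"
    using almost_periodic[OF assms] unfolding relatively_dense_def by blast
  have "\<exists>\<tau>. almost_period e l \<epsilon> \<tau> \<and> 0 \<le> \<xi> + \<tau> \<and> \<xi> + \<tau> \<le> a" for \<xi>
  proof -
    obtain \<tau> where "\<tau> \<in> {- \<xi>..- \<xi> + a}" "almost_period e l \<epsilon> \<tau>" using dense[of "- \<xi>"] by blast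
    then show ?thesis by (intro exI[of _ \<tau>]) auto
  qed
  then show ?thesis using l by blast
qed

text \<open>An almost period \<tau> moves the window into the fixed interval {0..a + l}, where
  \<open>local_shift_continuity\<close> holds. Going from t to t + r by way of t + \<tau> and t +
  \<tau> + r costs two deviations by \<tau>.\<close>

lemma shift_continuity:
  assumes \<epsilon>: "\<epsilon> > 0"
  shows "\<exists>l>0. \<exists>\<delta>>0. \<forall>r. \<bar>r\<bar> < \<delta> \<longrightarrow> almost_period e l \<epsilon> r"
proof -
  obtain l a where l: "l > 0" "a > 0"
    and ref: "\<And>\<xi>. \<exists>\<tau>. almost_period e l (\<epsilon> / 3) \<tau> \<and> 0 \<le> \<xi> + \<tau> \<and> \<xi> + \<tau> \<le> a"
    using reference_window[of "\<epsilon> / 3"] \<epsilon> by auto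
  \<comment> \<open>Bounds the threshold by \<epsilon> / 3 and also the measure on the long interval
    by \<epsilon> / 3 * l.\<close>
  define \<epsilon>' where "\<epsilon>' = min (\<epsilon> / 3) (\<epsilon> / 3 * l)"
  have \<epsilon>': "\<epsilon>' > 0" unfolding \<epsilon>'_def using \<epsilon> l by simp
  obtain \<delta> where \<delta>: "\<delta> > 0" "\<And>r. \<bar>r\<bar> < \<delta> \<Longrightarrow> window {t. \<epsilon>' \<le> e t (t + r)} 0 (a + l) \<le> \<epsilon>'"
    using local_shift_continuity[OF \<epsilon>', of 0 "a + l"] by blast
  have "almost_period e l \<epsilon> r" if r: "\<bar>r\<bar> < \<delta>" for r
    unfolding almost_period_def
  proof
    fix \<xi>
    obtain \<tau> where \<tau>: "almost_period e l (\<epsilon> / 3) \<tau>" "0 \<le> \<xi> + \<tau>" "\<xi> + \<tau> \<le> a" using ref by blast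
    define A where "A = {t. \<epsilon> / 3 \<le> e t (t + \<tau>)}"
    define B where "B = {t. \<epsilon> / 3 \<le> e t (t + r)}"
    have A: "A \<in> sets lebesgue" and B: "B \<in> sets lebesgue" unfolding A_def B_def by (rule deviation_sets)+
    have A': "{t. t + r \<in> A} \<in> sets lebesgue" and B': "{t. t + \<tau> \<in> B} \<in> sets lebesgue"
      using A B by (auto intro: sets_lebesgue_translate)
    have "{t. \<epsilon> \<le> e t (t + r)} \<subseteq> A \<union> ({t. t + \<tau> \<in> B} \<union> {t. t + r \<in> A})"
    proof
      fix t assume t: "t \<in> {t. \<epsilon> \<le> e t (t + r)}"
      have "e t (t + r) \<le> e t (t + \<tau>) + (e (t + \<tau>) (t + \<tau> + r) + e (t + r) (t + r + \<tau>))"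
        using triangle[of t "t + r" "t + \<tau>"] triangle[of "t + \<tau>" "t + r" "t + \<tau> + r"]
          sym[of "t + \<tau> + r" "t + r"] by (simp add: ac_simps)
      then show "t \<in> A \<union> ({t. t + \<tau> \<in> B} \<union> {t. t + r \<in> A})" using t unfolding A_def B_def by auto
    qed
    then have "window {t. \<epsilon> \<le> e t (t + r)} \<xi> l \<le> window A \<xi> l + window ({t. t + \<tau> \<in> B} \<union> {t. t + r \<in> A}) \<xi> l"
      by (rule window_le_add[OF _ deviation_sets A sets.Un[OF B' A']])
    also have "window ({t. t + \<tau> \<in> B} \<union> {t. t + r \<in> A}) \<xi> l \<le> window B (\<xi> + \<tau>) l + window A (\<xi> + r) l"
      using window_Un_le[OF B' A'] unfolding window_translate .
    also have "window B (\<xi> + \<tau>) l \<le> window {t. \<epsilon>' \<le> e t (t + r)} (\<xi> + \<tau>) l"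
      unfolding B_def by (intro window_mono deviation_sets) (auto simp: \<epsilon>'_def)
    also have "\<dots> \<le> window {t. \<epsilon>' \<le> e t (t + r)} 0 (a + l)"
      by (intro window_interval_mono deviation_sets) (use \<tau> in auto)
    also have "\<dots> \<le> \<epsilon> / 3 * l" using \<delta>(2)[OF r] unfolding \<epsilon>'_def by linarith
    finally show "window {t. \<epsilon> \<le> e t (t + r)} \<xi> l \<le> \<epsilon> * l"
      using \<tau>(1)[unfolded almost_period_def, rule_format, folded A_def, of \<xi>]
        \<tau>(1)[unfolded almost_period_def, rule_format, folded A_def, of "\<xi> + r"] by simp
  qed
  then show ?thesis using l \<delta>(1) by blast
qed

text \<open>Modulo an almost period every \<tau> lies in {0..a}, and there a grid finer than the
  modulus of shift continuity is a finite net. The length l is chosen before \<tau>, as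
  \<open>kernel_norm_uniform\<close> requires.\<close>

lemma uniform_totally_bounded:
  assumes \<epsilon>: "\<epsilon> > 0"
  shows "\<exists>l>0. \<exists>S. finite S \<and> (\<forall>\<tau>. \<exists>s\<in>S. \<forall>l'\<ge>l. almost_period e l' \<epsilon> (\<tau> - s))"
proof -
  obtain l1 a where l1: "l1 > 0" "a > 0"
    and ref: "\<And>\<xi>. \<exists>\<tau>. almost_period e l1 (\<epsilon> / 4) \<tau> \<and> 0 \<le> \<xi> + \<tau> \<and> \<xi> + \<tau> \<le> a"
    using reference_window[of "\<epsilon> / 4"] \<epsilon> by auto
  obtain l2 \<delta> where l2: "l2 > 0" "\<delta> > 0" and cont: "\<And>r. \<bar>r\<bar> < \<delta> \<Longrightarrow> almost_period e l2 (\<epsilon> / 4) r"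
    using shift_continuity[of "\<epsilon> / 4"] \<epsilon> by auto
  define S where "S = (\<lambda>i. real i * (\<delta> / 2)) ` {..nat \<lceil>2 * a / \<delta>\<rceil>}"
  have "\<exists>s\<in>S. \<forall>l'\<ge>max l1 l2. almost_period e l' \<epsilon> (\<tau> - s)" for \<tau>
  proof -
    obtain \<sigma> where \<sigma>: "almost_period e l1 (\<epsilon> / 4) \<sigma>" "0 \<le> \<tau> + \<sigma>" "\<tau> + \<sigma> \<le> a" using ref by blast
    define i where "i = nat \<lfloor>2 * (\<tau> + \<sigma>) / \<delta>\<rfloor>"
    have i: "real i \<le> 2 * (\<tau> + \<sigma>) / \<delta>" "2 * (\<tau> + \<sigma>) / \<delta> < real i + 1"
      unfolding i_def using \<sigma>(2) l2(2) by auto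
    have "2 * (\<tau> + \<sigma>) / \<delta> \<le> 2 * a / \<delta>" using \<sigma>(3) l2(2) by (intro divide_right_mono) auto
    then have "i \<le> nat \<lceil>2 * a / \<delta>\<rceil>" using i(1) by linarith
    then have s: "real i * (\<delta> / 2) \<in> S" unfolding S_def by blast
    have "\<bar>\<tau> + \<sigma> - real i * (\<delta> / 2)\<bar> < \<delta>" using i l2(2) by (simp add: field_simps)
    then have r: "almost_period e l2 (\<epsilon> / 4) (\<tau> + \<sigma> - real i * (\<delta> / 2))" by (rule cont)
    have "almost_period e l' \<epsilon> (\<tau> - real i * (\<delta> / 2))" if "l' \<ge> max l1 l2" for l'
    proof -
      have "almost_period e l' (2 * (\<epsilon> / 4)) (- \<sigma>)"
        using almost_period_scale[OF almost_period_minus[OF \<sigma>(1)] l1(1)] that by simp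
      moreover have "almost_period e l' (2 * (\<epsilon> / 4)) (\<tau> + \<sigma> - real i * (\<delta> / 2))"
        using almost_period_scale[OF r l2(1)] that by simp
      ultimately have "almost_period e l' (2 * (\<epsilon> / 4) + 2 * (\<epsilon> / 4)) (- \<sigma> + (\<tau> + \<sigma> - real i * (\<delta> / 2)))"
        by (rule almost_period_add)
      then show ?thesis by (simp add: algebra_simps)
    qed
    then show ?thesis using s by blast
  qed
  moreover have "finite S" unfolding S_def by simp
  ultimately show ?thesis using l1 by (intro exI[of _ "max l1 l2"]) auto
qed

lemma kernel_norm_bdd: "bdd_below {\<epsilon>. \<epsilon> > 0 \<and> (\<exists>L. \<forall>l\<ge>L. almost_period e l \<epsilon> \<tau>)}"
  by (rule bdd_belowI[of _ 0]) auto

lemma kernel_norm_nonempty: "{\<epsilon>. \<epsilon> > 0 \<and> (\<exists>L. \<forall>l\<ge>L. almost_period e l \<epsilon> \<tau>)} \<noteq> {}"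
proof -
  have "\<exists>L. \<forall>l\<ge>L. almost_period e l 2 \<tau>" by (intro exI[of _ 0] allI impI almost_period_trivial) auto
  then have "2 \<in> {\<epsilon>. \<epsilon> > 0 \<and> (\<exists>L. \<forall>l\<ge>L. almost_period e l \<epsilon> \<tau>)}" by simp
  then show ?thesis by blast
qed

lemma kernel_norm_le:
  assumes "\<epsilon> > 0" "\<And>l. l \<ge> L \<Longrightarrow> almost_period e l \<epsilon> \<tau>"
  shows "kernel_norm e \<tau> \<le> \<epsilon>"
  unfolding kernel_norm_def by (rule cInf_lower[OF _ kernel_norm_bdd]) (use assms in blast)

lemma kernel_norm_le_scale:
  assumes "\<epsilon> > 0" "almost_period e l \<epsilon> \<tau>" "l > 0"
  shows "kernel_norm e \<tau> \<le> 2 * \<epsilon>"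
  by (rule kernel_norm_le[of _ l]) (use assms almost_period_scale in auto)

lemma kernel_norm_lessD:
  assumes "kernel_norm e \<tau> < \<epsilon>"
  shows "\<exists>L>0. \<forall>l\<ge>L. almost_period e l \<epsilon> \<tau>"
proof -
  obtain \<epsilon>' L where *: "\<epsilon>' < \<epsilon>" "\<And>l. l \<ge> L \<Longrightarrow> almost_period e l \<epsilon>' \<tau>"
    using cInf_lessD[OF kernel_norm_nonempty, of \<tau> \<epsilon>] assms
    unfolding kernel_norm_def by auto
  have "almost_period e l \<epsilon> \<tau>" if "l \<ge> max L 1" for l
    using almost_period_mono[OF *(2)[of l], of \<epsilon>] *(1) that by simp
  then show ?thesis by (intro exI[of _ "max L 1"]) auto
qed

lemma pseudonorm_kernel_norm: "pseudonorm (kernel_norm e)"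
proof
  have nonneg: "0 \<le> kernel_norm e \<tau>" for \<tau>
    unfolding kernel_norm_def by (rule cInf_greatest[OF kernel_norm_nonempty]) auto
  have "kernel_norm e 0 \<le> \<epsilon>" if "\<epsilon> > 0" for \<epsilon>
    by (rule kernel_norm_le[of _ 0]) (use that almost_period_zero in auto)
  then have "kernel_norm e 0 \<le> 0" by (meson dense_ge)
  then show "kernel_norm e 0 = 0" using nonneg[of 0] by simp
  have "almost_period e l \<epsilon> (- x) = almost_period e l \<epsilon> x" for l \<epsilon> x
    using almost_period_minus[of l \<epsilon> x] almost_period_minus[of l \<epsilon> "- x"] by auto
  then show "kernel_norm e (- x) = kernel_norm e x" for x by (simp add: kernel_norm_def)
  show "kernel_norm e (x + y) \<le> kernel_norm e x + kernel_norm e y" for x y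
  proof (rule field_le_epsilon)
    fix d :: real assume d: "d > 0"
    obtain L where L: "L > 0" "\<forall>l\<ge>L. almost_period e l (kernel_norm e x + d / 2) x"
      using kernel_norm_lessD[of x "kernel_norm e x + d / 2"] d by auto
    obtain M where M: "M > 0" "\<forall>l\<ge>M. almost_period e l (kernel_norm e y + d / 2) y"
      using kernel_norm_lessD[of y "kernel_norm e y + d / 2"] d by auto
    have "kernel_norm e (x + y) \<le> (kernel_norm e x + d / 2) + (kernel_norm e y + d / 2)"
    proof (rule kernel_norm_le)
      show "almost_period e l ((kernel_norm e x + d / 2) + (kernel_norm e y + d / 2)) (x + y)" if "l \<ge> max L M" for l
        by (rule almost_period_add) (use L M that in auto)
    qed (use nonneg[of x] nonneg[of y] d in linarith)
    then show "kernel_norm e (x + y) \<le> kernel_norm e x + kernel_norm e y + d" by simp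
  qed
  show "\<exists>\<delta>>0. \<forall>r. \<bar>r\<bar> < \<delta> \<longrightarrow> kernel_norm e r < \<epsilon>" if e: "\<epsilon> > 0" for \<epsilon>
  proof -
    obtain l \<delta> where *: "l > 0" "\<delta> > 0" "\<And>r. \<bar>r\<bar> < \<delta> \<Longrightarrow> almost_period e l (\<epsilon> / 4) r"
      using shift_continuity[of "\<epsilon> / 4"] e by auto
    have "kernel_norm e r < \<epsilon>" if "\<bar>r\<bar> < \<delta>" for r
      using kernel_norm_le_scale[OF _ *(3)[OF that] *(1)] e by simp
    then show ?thesis using *(2) by blast
  qed
  show "\<exists>S. finite S \<and> (\<forall>\<tau>. \<exists>s\<in>S. kernel_norm e (\<tau> - s) < \<epsilon>)" if e: "\<epsilon> > 0" for \<epsilon>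
  proof -
    obtain l S where *: "l > 0" "finite S" "\<And>\<tau>. \<exists>s\<in>S. \<forall>l'\<ge>l. almost_period e l' (\<epsilon> / 2) (\<tau> - s)"
      using uniform_totally_bounded[of "\<epsilon> / 2"] e by auto
    have "\<exists>s\<in>S. kernel_norm e (\<tau> - s) < \<epsilon>" for \<tau>
    proof -
      obtain s where s: "s \<in> S" "\<forall>l'\<ge>l. almost_period e l' (\<epsilon> / 2) (\<tau> - s)" using *(3) by blast
      then have "kernel_norm e (\<tau> - s) \<le> \<epsilon> / 2" using e by (intro kernel_norm_le[of _ l]) auto
      then show ?thesis using s(1) e by (intro bexI[of _ s]) auto
    qed
    then show ?thesis using *(2) by blast
  qed
qed

text \<open>The window length in the definition of \<open>kernel_norm\<close> can be chosen uniformly in \<open>\<tau>\<close>: by total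
  boundedness only finitely many \<open>\<tau>\<close> matter.\<close>

lemma kernel_norm_uniform:
  assumes \<epsilon>: "\<epsilon> > 0"
  shows "\<exists>L>0. \<forall>\<tau>. kernel_norm e \<tau> < \<epsilon> \<longrightarrow> (\<forall>l\<ge>L. almost_period e l (4 * \<epsilon>) \<tau>)"
proof -
  interpret pseudonorm "kernel_norm e" by (rule pseudonorm_kernel_norm)
  obtain l0 S where l0: "l0 > 0" and S: "finite S" "\<And>\<tau>. \<exists>s\<in>S. \<forall>l'\<ge>l0. almost_period e l' \<epsilon> (\<tau> - s)"
    using uniform_totally_bounded[OF \<epsilon>] by auto
  \<comment> \<open>Only the lengths of the finitely many net points enter the maximum
    \<open>M\<close>. A net point near a shift of norm below \<epsilon> has itself norm below 3 *
    \<epsilon>, so its length applies.\<close>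
  have "\<forall>s. \<exists>L. L > 0 \<and> (kernel_norm e s < 3 * \<epsilon> \<longrightarrow> (\<forall>l\<ge>L. almost_period e l (3 * \<epsilon>) s))"
    using kernel_norm_lessD zero_less_one by metis
  then obtain L where L: "\<And>s. L s > 0" "\<And>s l. kernel_norm e s < 3 * \<epsilon> \<Longrightarrow> l \<ge> L s \<Longrightarrow> almost_period e l (3 * \<epsilon>) s"
    by metis
  define M where "M = Max (insert l0 (L ` S))"
  have M: "l0 \<le> M" "\<And>s. s \<in> S \<Longrightarrow> L s \<le> M" unfolding M_def using S(1) by auto
  have "almost_period e l (4 * \<epsilon>) \<tau>" if \<tau>: "kernel_norm e \<tau> < \<epsilon>" and l: "l \<ge> M" for \<tau> l
  proof -
    obtain s where s: "s \<in> S" "\<forall>l'\<ge>l0. almost_period e l' \<epsilon> (\<tau> - s)" using S(2) by blast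
    have "kernel_norm e (\<tau> - s) \<le> \<epsilon>" by (rule kernel_norm_le[OF \<epsilon>, of l0]) (use s in blast)
    then have "kernel_norm e s < 3 * \<epsilon>" using triangle_diff[of \<tau> "\<tau> - s"] \<tau> \<epsilon> by simp
    then have "almost_period e l (3 * \<epsilon>) s" using L(2) M(2)[OF s(1)] l by auto
    moreover have "almost_period e l \<epsilon> (\<tau> - s)" using s(2) M(1) l by auto
    ultimately have "almost_period e l (\<epsilon> + 3 * \<epsilon>) ((\<tau> - s) + s)" by (intro almost_period_add)
    then show ?thesis by simp
  qed
  then show ?thesis using M(1) l0 by (intro exI[of _ M]) auto
qed

text \<open>Almost periods reduce the question to one bounded interval, where finitely many
  reference times suffice up to small measure. Doubling \<delta> pays for the deviation along the
  almost period.\<close>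

lemma tightness:
  assumes ae: "AE t in lebesgue. \<exists>j. e t (s j) < \<delta>" and \<epsilon>: "\<epsilon> > 0" and \<delta>: "\<delta> > 0"
  shows "\<exists>J :: nat. small {t. \<forall>j<J. 2 * \<delta> \<le> e t (s j)} \<epsilon>"
proof -
  define \<epsilon>' where "\<epsilon>' = min \<delta> (\<epsilon> / 4)"
  have \<epsilon>': "\<epsilon>' > 0" unfolding \<epsilon>'_def using \<epsilon> \<delta> by simp
  obtain l a where l: "l > 0" "a > 0"
    and ref: "\<And>\<xi>. \<exists>\<tau>. almost_period e l \<epsilon>' \<tau> \<and> 0 \<le> \<xi> + \<tau> \<and> \<xi> + \<tau> \<le> a"
    using reference_window[OF \<epsilon>'] by auto
  obtain J where J: "window {t. \<forall>j<J. \<delta> \<le> e t (s j)} 0 (a + l) \<le> \<epsilon> / 4 * l"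
    using tail_window[OF ae, of "\<epsilon> / 4 * l" 0 "a + l"] \<epsilon> l by auto
  have "small {t. \<forall>j<J. 2 * \<delta> \<le> e t (s j)} \<epsilon>"
  proof (rule smallI_window[OF tail_sets l(1)])
    fix \<xi>
    obtain \<tau> where \<tau>: "almost_period e l \<epsilon>' \<tau>" "0 \<le> \<xi> + \<tau>" "\<xi> + \<tau> \<le> a" using ref by blast
    define B where "B = {t. \<forall>j<J. \<delta> \<le> e t (s j)}"
    have B: "B \<in> sets lebesgue" unfolding B_def by (rule tail_sets)
    have "{t. \<forall>j<J. 2 * \<delta> \<le> e t (s j)} \<subseteq> {t. \<epsilon>' \<le> e t (t + \<tau>)} \<union> {t. t + \<tau> \<in> B}"
    proof
      fix t assume t: "t \<in> {t. \<forall>j<J. 2 * \<delta> \<le> e t (s j)}"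
      have "t + \<tau> \<in> B" if "e t (t + \<tau>) < \<epsilon>'"
      proof -
        have "\<delta> \<le> e (t + \<tau>) (s j)" if "j < J" for j
        proof -
          have "2 * \<delta> \<le> e t (s j)" using t that by blast
          then show ?thesis using triangle[of t "s j" "t + \<tau>"] \<open>e t (t + \<tau>) < \<epsilon>'\<close> unfolding \<epsilon>'_def by linarith
        qed
        then show ?thesis by (simp add: B_def)
      qed
      then show "t \<in> {t. \<epsilon>' \<le> e t (t + \<tau>)} \<union> {t. t + \<tau> \<in> B}" by (simp add: not_le[symmetric]) blast
    qed
    then have "window {t. \<forall>j<J. 2 * \<delta> \<le> e t (s j)} \<xi> l \<le> window {t. \<epsilon>' \<le> e t (t + \<tau>)} \<xi> l + window B (\<xi> + \<tau>) l"
      using window_le_add[OF _ tail_sets deviation_sets sets_lebesgue_translate[OF B]] unfolding window_translate by blast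
    also have "window B (\<xi> + \<tau>) l \<le> window B 0 (a + l)"
      by (rule window_interval_mono[OF B]) (use \<tau> in auto)
    also have "\<dots> \<le> \<epsilon> / 4 * l" using J unfolding B_def .
    also have "window {t. \<epsilon>' \<le> e t (t + \<tau>)} \<xi> l \<le> \<epsilon>' * l" using \<tau>(1) by (simp add: almost_period_def)
    also have "\<dots> \<le> \<epsilon> / 4 * l" unfolding \<epsilon>'_def using l by (intro mult_right_mono) auto
    finally show "window {t. \<forall>j<J. 2 * \<delta> \<le> e t (s j)} \<xi> l \<le> \<epsilon> / 2 * l" by simp
  qed
  then show ?thesis ..
qed

end

section \<open>Controlled functions\<close>

text \<open>The almost periodic counterpart of a simple function: off a set of small density there
  are finitely many values, and the index is constant at a fixed scale of \<open>e\<close>.\<close>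

definition index_controlled :: "(real \<Rightarrow> real \<Rightarrow> real) \<Rightarrow> (real \<Rightarrow> nat) \<Rightarrow> bool" where
  "index_controlled e \<phi> \<longleftrightarrow> \<phi> \<in> measurable lebesgue (count_space UNIV) \<and>
     (\<forall>\<epsilon>>0. \<exists>E I \<delta>. small E \<epsilon> \<and> \<delta> > 0 \<and> (\<forall>t. t \<notin> E \<longrightarrow> \<phi> t \<le> I) \<and>
        (\<forall>t t'. t \<notin> E \<longrightarrow> t' \<notin> E \<longrightarrow> e t t' < \<delta> \<longrightarrow> \<phi> t = \<phi> t'))"

text \<open>Uniform continuity off an exceptional set, where each of the two times is tested
  separately. For the pair t, t + \<tau> the exceptional times thus form E and a translate of E, of
  the same density.\<close>

definition kernel_controlled :: "(real \<Rightarrow> real \<Rightarrow> real) \<Rightarrow> (real \<Rightarrow> real \<Rightarrow> real) \<Rightarrow> bool" where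
  "kernel_controlled e e' \<longleftrightarrow> (\<forall>\<epsilon>>0. \<exists>E \<delta>. small E \<epsilon> \<and> \<delta> > 0 \<and>
     (\<forall>t t'. t \<notin> E \<longrightarrow> t' \<notin> E \<longrightarrow> e t t' < \<delta> \<longrightarrow> e' t t' < \<epsilon>))"

lemma finite_common_bound:
  fixes P :: "'i \<Rightarrow> real \<Rightarrow> bool"
  assumes "finite A" "\<And>i. i \<in> A \<Longrightarrow> \<exists>\<delta>>0. P i \<delta>"
    and mono: "\<And>i \<delta> \<delta>'. i \<in> A \<Longrightarrow> P i \<delta> \<Longrightarrow> 0 < \<delta>' \<Longrightarrow> \<delta>' \<le> \<delta> \<Longrightarrow> P i \<delta>'"
  shows "\<exists>\<delta>>0. \<forall>i\<in>A. P i \<delta>"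
proof -
  obtain \<delta> where \<delta>: "\<And>i. i \<in> A \<Longrightarrow> \<delta> i > 0 \<and> P i (\<delta> i)" using assms(2) by metis
  define d where "d = Min (insert 1 (\<delta> ` A))"
  have d: "d > 0" "\<And>i. i \<in> A \<Longrightarrow> d \<le> \<delta> i"
    unfolding d_def using assms(1) \<delta> by auto
  then show ?thesis using \<delta> mono by blast
qed

lemma (in kernel) level_sets:
  assumes "v \<in> borel_measurable lebesgue"
  shows "{t. \<bar>v t - r\<bar> < (\<delta> :: real)} \<in> sets lebesgue"
proof -
  have "(\<lambda>t. \<bar>v t - r\<bar>) \<in> borel_measurable lebesgue" using assms by simp
  from measurable_sets[OF this, of "{..<\<delta>}"] show ?thesis by (simp add: vimage_def)
qed

section \<open>Thresholds that are nearly attained only with small density, and the first admissible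
  index\<close>

context ap_kernel
begin

text \<open>Each bad radius has a shell that fills more than \<epsilon> / 2 of some window, and an
  almost period moves at least \<epsilon> / 4 * l of a slightly wider shell into {0..2 * l}. The
  wider shells are disjoint, so at most 8 / \<epsilon> of them fit into length 2 * l.\<close>

lemma shells_card_le:
  assumes uc: "kernel_uc e v" and \<epsilon>: "\<epsilon> > 0" and R: "finite R"
    and bad: "\<And>r \<delta>. r \<in> R \<Longrightarrow> \<delta> > 0 \<Longrightarrow> \<not> small {t. \<bar>v t - r\<bar> < \<delta>} \<epsilon>"
  shows "real (card R) \<le> 8 / \<epsilon>"
proof -
  have v: "v \<in> borel_measurable lebesgue" using uc by (rule uc_measurable)
  \<comment> \<open>Separation by 4 * \<delta> keeps even the shells of radius 2 * \<delta>
    disjoint.\<close>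
  have "\<exists>\<delta>>0. \<forall>p\<in>{p \<in> R \<times> R. fst p \<noteq> snd p}. 4 * \<delta> \<le> \<bar>fst p - snd p\<bar>"
  proof (rule finite_common_bound)
    show "finite {p \<in> R \<times> R. fst p \<noteq> snd p}" using R by simp
    show "\<exists>\<delta>>0. 4 * \<delta> \<le> \<bar>fst p - snd p\<bar>" if "p \<in> {p \<in> R \<times> R. fst p \<noteq> snd p}" for p :: "real \<times> real"
      using that by (intro exI[of _ "\<bar>fst p - snd p\<bar> / 4"]) auto
  qed auto
  then obtain \<delta> where \<delta>: "\<delta> > 0" and sep: "\<And>r r'. r \<in> R \<Longrightarrow> r' \<in> R \<Longrightarrow> r \<noteq> r' \<Longrightarrow> 4 * \<delta> \<le> \<bar>r - r'\<bar>"
    by force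
  obtain \<delta>1 where \<delta>1: "\<delta>1 > 0" "\<And>t t'. e t t' < \<delta>1 \<Longrightarrow> \<bar>v t - v t'\<bar> < \<delta>"
    using uc \<delta> unfolding kernel_uc_def by blast
  define \<epsilon>' where "\<epsilon>' = min \<delta>1 (\<epsilon> / 4) / 2"
  have \<epsilon>': "\<epsilon>' > 0" unfolding \<epsilon>'_def using \<delta>1 \<epsilon> by simp
  obtain l0 a where l0: "l0 > 0" "a > 0"
    and ref0: "\<And>\<xi>. \<exists>\<tau>. almost_period e l0 \<epsilon>' \<tau> \<and> 0 \<le> \<xi> + \<tau> \<and> \<xi> + \<tau> \<le> a"
    using reference_window[OF \<epsilon>'] by auto
  \<comment> \<open>At least a, so that every transported window lies in {0..2 * l}.\<close>
  define l where "l = max l0 a"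
  have l: "l > 0" "l0 \<le> l" "a \<le> l" unfolding l_def using l0 by auto
  define A where "A = (\<lambda>r. {t. \<bar>v t - r\<bar> < \<delta>})"
  define B where "B = (\<lambda>r. {t. \<bar>v t - r\<bar> < 2 * \<delta>})"
  have A: "A r \<in> sets lebesgue" and B: "B r \<in> sets lebesgue" for r
    unfolding A_def B_def by (rule level_sets[OF v])+
  have lower: "\<epsilon> / 4 * l \<le> window (B r) 0 (2 * l)" if r: "r \<in> R" for r
  proof -
    have "\<not> (\<forall>\<xi>. window (A r) \<xi> l \<le> \<epsilon> / 2 * l)"
      using bad[OF r \<delta>] smallI_window[OF A l(1), of r \<epsilon>] unfolding A_def by blast
    then obtain \<xi> where \<xi>: "\<epsilon> / 2 * l < window (A r) \<xi> l" by (auto simp: not_le)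
    obtain \<tau> where \<tau>: "almost_period e l0 \<epsilon>' \<tau>" "0 \<le> \<xi> + \<tau>" "\<xi> + \<tau> \<le> a" using ref0 by blast
    have \<tau>l: "almost_period e l (2 * \<epsilon>') \<tau>" using almost_period_scale[OF \<tau>(1) l0(1) l(2)] .
    have "A r \<subseteq> {t. 2 * \<epsilon>' \<le> e t (t + \<tau>)} \<union> {t. t + \<tau> \<in> B r}"
    proof
      fix t assume t: "t \<in> A r"
      show "t \<in> {t. 2 * \<epsilon>' \<le> e t (t + \<tau>)} \<union> {t. t + \<tau> \<in> B r}"
      proof (cases "2 * \<epsilon>' \<le> e t (t + \<tau>)")
        case False
        then have "\<bar>v t - v (t + \<tau>)\<bar> < \<delta>" by (intro \<delta>1(2)) (auto simp: \<epsilon>'_def)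
        then show ?thesis using t unfolding A_def B_def by auto
      qed simp
    qed
    then have "window (A r) \<xi> l \<le> window {t. 2 * \<epsilon>' \<le> e t (t + \<tau>)} \<xi> l + window (B r) (\<xi> + \<tau>) l"
      using window_le_add[OF _ A deviation_sets sets_lebesgue_translate[OF B]] unfolding window_translate by blast
    also have "window {t. 2 * \<epsilon>' \<le> e t (t + \<tau>)} \<xi> l \<le> 2 * \<epsilon>' * l" using \<tau>l by (simp add: almost_period_def)
    also have "2 * \<epsilon>' * l \<le> \<epsilon> / 4 * l" unfolding \<epsilon>'_def using l by (intro mult_right_mono) auto
    also have "window (B r) (\<xi> + \<tau>) l \<le> window (B r) 0 (2 * l)"
      by (rule window_interval_mono[OF B]) (use \<tau> l in auto)
    finally show ?thesis using \<xi> by simp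
  qed
  have B_fm: "B r \<inter> {0..0 + 2 * l} \<in> lmeasurable" for r by (rule lmeasurable_Int_Icc[OF B])
  have "real (card R) * (\<epsilon> / 4 * l) \<le> (\<Sum>r\<in>R. window (B r) 0 (2 * l))"
    using lower by (rule sum_bounded_below)
  also have "\<dots> = measure lebesgue (\<Union>r\<in>R. B r \<inter> {0..0 + 2 * l})"
    unfolding window_def
  proof (rule measure_UNION'[symmetric, OF R B_fm])
    show "pairwise (\<lambda>i j. disjnt (B i \<inter> {0..0 + 2 * l}) (B j \<inter> {0..0 + 2 * l})) R"
    proof (rule pairwiseI)
      fix i j assume "i \<in> R" "j \<in> R" "i \<noteq> j"
      then have "4 * \<delta> \<le> \<bar>i - j\<bar>" by (rule sep)
      then have "t \<notin> B j" if "t \<in> B i" for t using that unfolding B_def by auto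
      then show "disjnt (B i \<inter> {0..0 + 2 * l}) (B j \<inter> {0..0 + 2 * l})" unfolding disjnt_def by blast
    qed
  qed
  also have "\<dots> \<le> measure lebesgue {0..2 * l}"
  proof (rule measure_mono_fmeasurable)
    show "(\<Union>r\<in>R. B r \<inter> {0..0 + 2 * l}) \<in> sets lebesgue"
      using R fmeasurableD[OF B_fm] by (intro sets.finite_UN)
  qed auto
  also have "\<dots> = 2 * l" using l by simp
  finally show ?thesis using l \<epsilon> by (simp add: field_simps)
qed

text \<open>For each density 1 / (k + 1) only finitely many radii are bad.\<close>

lemma countable_bad_radii:
  assumes uc: "kernel_uc e v"
  shows "countable {r. \<not> (\<forall>\<epsilon>>0. \<exists>\<delta>>0. small {t. \<bar>v t - r\<bar> < \<delta>} \<epsilon>)}"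
proof -
  have v: "v \<in> borel_measurable lebesgue" using uc by (rule uc_measurable)
  define Bad where "Bad = (\<lambda>k. {r. \<forall>\<delta>>0. \<not> small {t. \<bar>v t - r\<bar> < \<delta>} (1 / real (Suc k))})"
  have "finite (Bad k)" for k
  proof (rule ccontr)
    assume "infinite (Bad k)"
    then obtain R where R: "finite R" "card R = 8 * Suc k + 1" "R \<subseteq> Bad k"
      using infinite_arbitrarily_large by blast
    have "real (card R) \<le> 8 / (1 / real (Suc k))"
      by (rule shells_card_le[OF uc _ R(1)]) (use R(3) in \<open>auto simp: Bad_def\<close>)
    then show False using R(2) by simp
  qed
  then have "countable (\<Union>k. Bad k)" by (intro countable_UN) (auto intro: countable_finite)
  moreover have "{r. \<not> (\<forall>\<epsilon>>0. \<exists>\<delta>>0. small {t. \<bar>v t - r\<bar> < \<delta>} \<epsilon>)} \<subseteq> (\<Union>k. Bad k)"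
  proof
    fix r assume "r \<in> {r. \<not> (\<forall>\<epsilon>>0. \<exists>\<delta>>0. small {t. \<bar>v t - r\<bar> < \<delta>} \<epsilon>)}"
    then obtain \<epsilon> where \<epsilon>: "\<epsilon> > 0" "\<And>\<delta>. \<delta> > 0 \<Longrightarrow> \<not> small {t. \<bar>v t - r\<bar> < \<delta>} \<epsilon>" by auto
    obtain k where k: "1 / real (Suc k) < \<epsilon>" using nat_approx_posE[OF \<epsilon>(1)] by blast
    have "\<not> small {t. \<bar>v t - r\<bar> < \<delta>} (1 / real (Suc k))" if "\<delta> > 0" for \<delta>
    proof
      assume "small {t. \<bar>v t - r\<bar> < \<delta>} (1 / real (Suc k))"
      then have "small {t. \<bar>v t - r\<bar> < \<delta>} \<epsilon>"
        by (rule small_mono) (use k level_sets[OF v] in auto)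
      then show False using \<epsilon>(2)[OF that] by blast
    qed
    then show "r \<in> (\<Union>k. Bad k)" unfolding Bad_def by blast
  qed
  ultimately show ?thesis by (rule countable_subset[rotated])
qed

lemma good_radius:
  assumes "kernel_uc e v" "c < (c' :: real)"
  shows "\<exists>r. c < r \<and> r < c' \<and> (\<forall>\<epsilon>>0. \<exists>\<delta>>0. small {t. \<bar>v t - r\<bar> < \<delta>} \<epsilon>)"
proof -
  have "\<not> {c<..<c'} \<subseteq> {r. \<not> (\<forall>\<epsilon>>0. \<exists>\<delta>>0. small {t. \<bar>v t - r\<bar> < \<delta>} \<epsilon>)}"
    using countable_subset[OF _ countable_bad_radii[OF assms(1)]] uncountable_open_interval[of c c'] assms(2) by blast
  then show ?thesis by auto
qed

text \<open>The thresholds \<open>r k i\<close> are good radii in the gap between c and c', so the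
  truth of \<open>v k i t < r k i\<close> changes only on sets of small density. Near each reference
  time \<open>choice\<close> provides one candidate that works on a whole ball; with
  \<open>tightness\<close> this bounds the new index off a small set and leaves finitely many
  inequalities to watch.\<close>

lemma first_index:
  assumes \<phi>: "index_controlled e \<phi>" and uc: "\<And>k i :: nat. kernel_uc e (v k i)" and c: "c < c'"
    and ae: "AE t in lebesgue. \<exists>j. e t (s j) < \<delta>" and \<delta>: "\<delta> > 0"
    and choice: "\<And>k j. \<exists>i. \<forall>t. e t (s (j :: nat)) < 2 * \<delta> \<longrightarrow> v k i t \<le> c"
  shows "\<exists>\<psi>. index_controlled e \<psi> \<and> (AE t in lebesgue. v (\<phi> t) (\<psi> t) t < c')"
proof -
  have "\<forall>k i. \<exists>r. c < r \<and> r < c' \<and> (\<forall>\<epsilon>>0. \<exists>\<delta>>0. small {t. \<bar>v k i t - r\<bar> < \<delta>} \<epsilon>)"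
    using good_radius[OF uc c] by blast
  then obtain r where r: "\<And>k i. c < r k i" "\<And>k i. r k i < c'"
    and r_good: "\<And>k i \<epsilon>. \<epsilon> > 0 \<Longrightarrow> \<exists>\<delta>>0. small {t. \<bar>v k i t - r k i\<bar> < \<delta>} \<epsilon>"
    by metis
  have "\<forall>k j. \<exists>i. \<forall>t. e t (s j) < 2 * \<delta> \<longrightarrow> v k i t \<le> c"
    using choice by blast
  then obtain idx :: "nat \<Rightarrow> nat \<Rightarrow> nat"
    where idx: "\<And>k j t. e t (s j) < 2 * \<delta> \<Longrightarrow> v k (idx k j) t \<le> c"
    by metis
  \<comment> \<open>Some index qualifies for almost every t; elsewhere the value of
    \<open>LEAST\<close> is immaterial.\<close>
  define \<psi> where "\<psi> = (\<lambda>t. LEAST i. v (\<phi> t) i t < r (\<phi> t) i)"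
  have v_meas [measurable]: "v k i \<in> borel_measurable lebesgue" for k i by (rule uc_measurable[OF uc])
  have \<phi>_meas: "\<phi> \<in> measurable lebesgue (count_space UNIV)" using \<phi> by (simp add: index_controlled_def)
  have least_meas: "(\<lambda>t. LEAST i. v k i t < r k i) \<in> measurable lebesgue (count_space UNIV)" for k
    by measurable
  have \<psi>_meas: "\<psi> \<in> measurable lebesgue (count_space UNIV)"
    unfolding \<psi>_def by (rule measurable_compose_countable[OF least_meas \<phi>_meas])
  have \<psi>_ex: "v (\<phi> t) (\<psi> t) t < r (\<phi> t) (\<psi> t) \<and> \<psi> t \<le> idx (\<phi> t) j" if "e t (s j) < 2 * \<delta>" for t j
  proof -
    have "v (\<phi> t) (idx (\<phi> t) j) t < r (\<phi> t) (idx (\<phi> t) j)"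
      using idx[OF that, of "\<phi> t"] r(1)[of "\<phi> t" "idx (\<phi> t) j"] by linarith
    then show ?thesis
      unfolding \<psi>_def using LeastI[of "\<lambda>i. v (\<phi> t) i t < r (\<phi> t) i"] Least_le[of "\<lambda>i. v (\<phi> t) i t < r (\<phi> t) i"] by blast
  qed
  have "AE t in lebesgue. v (\<phi> t) (\<psi> t) t < c'"
    using ae
  proof eventually_elim
    case (elim t)
    then obtain j where "e t (s j) < \<delta>" by blast
    then have "e t (s j) < 2 * \<delta>" using \<delta> by linarith
    then have "v (\<phi> t) (\<psi> t) t < r (\<phi> t) (\<psi> t)" using \<psi>_ex by blast
    also have "\<dots> < c'" by (rule r)
    finally show ?case .
  qed
  moreover have "\<exists>E I \<delta>. small E \<epsilon> \<and> \<delta> > 0 \<and> (\<forall>t. t \<notin> E \<longrightarrow> \<psi> t \<le> I) \<and>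
        (\<forall>t t'. t \<notin> E \<longrightarrow> t' \<notin> E \<longrightarrow> e t t' < \<delta> \<longrightarrow> \<psi> t = \<psi> t')" if \<epsilon>: "\<epsilon> > 0" for \<epsilon>
  proof -
    have \<epsilon>3: "\<epsilon> / 3 > 0" using \<epsilon> by simp
    obtain E1 I1 \<delta>1 where E1: "small E1 (\<epsilon> / 3)" "\<delta>1 > 0" "\<And>t. t \<notin> E1 \<Longrightarrow> \<phi> t \<le> I1"
      "\<And>t t'. t \<notin> E1 \<Longrightarrow> t' \<notin> E1 \<Longrightarrow> e t t' < \<delta>1 \<Longrightarrow> \<phi> t = \<phi> t'"
      using \<phi> \<epsilon>3 unfolding index_controlled_def by blast
    obtain J where J: "small {t. \<forall>j<J. 2 * \<delta> \<le> e t (s j)} (\<epsilon> / 3)"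
      using tightness[OF ae \<epsilon>3 \<delta>] by blast
    define I2 where "I2 = Max (insert 0 ((\<lambda>(k, j). idx k j) ` ({..I1} \<times> {..<J})))"
    have I2: "idx k j \<le> I2" if "k \<le> I1" "j < J" for k j
      unfolding I2_def by (rule Max_ge) (use that in force)+
    \<comment> \<open>Off the exceptional set only these finitely many pairs of old and new index
      matter, so the shells about their thresholds can share the density \<epsilon> / 3.\<close>
    define P where "P = {..I1} \<times> {..I2}"
    have P: "finite P" "card P > 0" unfolding P_def by auto
    have "\<exists>d>0. \<forall>p\<in>P. small {t. \<bar>v (fst p) (snd p) t - r (fst p) (snd p)\<bar> < d} (\<epsilon> / 3 / real (card P))"
    proof (rule finite_common_bound[OF P(1)])
      show "\<exists>d>0. small {t. \<bar>v (fst p) (snd p) t - r (fst p) (snd p)\<bar> < d} (\<epsilon> / 3 / real (card P))" for p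
        by (rule r_good) (use \<epsilon>3 P(2) in simp)
      show "small {t. \<bar>v (fst p) (snd p) t - r (fst p) (snd p)\<bar> < d'} (\<epsilon> / 3 / real (card P))"
        if "small {t. \<bar>v (fst p) (snd p) t - r (fst p) (snd p)\<bar> < d} (\<epsilon> / 3 / real (card P))" "0 < d'" "d' \<le> d" for p d d'
        by (rule small_mono[OF that(1)]) (use that level_sets[OF v_meas] in auto)
    qed
    then obtain d where d: "d > 0" and shell: "\<And>p. p \<in> P \<Longrightarrow> small {t. \<bar>v (fst p) (snd p) t - r (fst p) (snd p)\<bar> < d} (\<epsilon> / 3 / real (card P))"
      by blast
    define E3 where "E3 = (\<Union>p\<in>P. {t. \<bar>v (fst p) (snd p) t - r (fst p) (snd p)\<bar> < d})"
    have E3: "small E3 (\<epsilon> / 3)"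
      unfolding E3_def using small_UN[OF P(1) shell] P(2) by simp
    have "\<exists>d'>0. \<forall>p\<in>P. \<forall>t t'. e t t' < d' \<longrightarrow> \<bar>v (fst p) (snd p) t - v (fst p) (snd p) t'\<bar> < d"
    proof (rule finite_common_bound[OF P(1)])
      show "\<exists>d'>0. \<forall>t t'. e t t' < d' \<longrightarrow> \<bar>v (fst p) (snd p) t - v (fst p) (snd p) t'\<bar> < d" for p
        using uc[of "fst p" "snd p"] d unfolding kernel_uc_def by blast
    qed (meson order_less_le_trans)
    then obtain d' where d': "d' > 0"
      and near: "\<And>p t t'. p \<in> P \<Longrightarrow> e t t' < d' \<Longrightarrow> \<bar>v (fst p) (snd p) t - v (fst p) (snd p) t'\<bar> < d"
      by blast
    define E where "E = E1 \<union> {t. \<forall>j<J. 2 * \<delta> \<le> e t (s j)} \<union> E3"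
    have "small E (\<epsilon> / 3 + \<epsilon> / 3 + \<epsilon> / 3)" unfolding E_def by (intro small_Un E1 J E3)
    then have E: "small E \<epsilon>" by simp
    have \<psi>_le: "\<psi> t \<le> I2 \<and> v (\<phi> t) (\<psi> t) t < r (\<phi> t) (\<psi> t)" if "t \<notin> E" for t
    proof -
      obtain j where j: "j < J" "e t (s j) < 2 * \<delta>" using \<open>t \<notin> E\<close> unfolding E_def by (auto simp: not_le)
      have "\<phi> t \<le> I1" using E1(3) \<open>t \<notin> E\<close> unfolding E_def by blast
      then show ?thesis using \<psi>_ex[OF j(2)] I2[OF _ j(1), of "\<phi> t"] by auto
    qed
    \<comment> \<open>The inequality that selects \<open>\<psi> t\<close> persists at t', since v
      moves by less than its distance from the threshold. Minimality gives this comparison and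
      symmetry of \<open>e\<close> the reverse one.\<close>
    have \<psi>_mono: "\<psi> t' \<le> \<psi> t" if "t \<notin> E" "t' \<notin> E" "e t t' < min \<delta>1 d'" for t t'
    proof -
      have eq: "\<phi> t = \<phi> t'" and le: "\<phi> t \<le> I1" using E1(3,4) that unfolding E_def by auto
      have t: "\<psi> t \<le> I2" "v (\<phi> t) (\<psi> t) t < r (\<phi> t) (\<psi> t)" using \<psi>_le[OF that(1)] by auto
      have p: "(\<phi> t, \<psi> t) \<in> P" unfolding P_def using le t(1) by simp
      have "\<bar>v (\<phi> t) (\<psi> t) t - v (\<phi> t) (\<psi> t) t'\<bar> < d" using near[OF p, of t t'] that(3) by simp
      moreover have "d \<le> \<bar>v (\<phi> t) (\<psi> t) t - r (\<phi> t) (\<psi> t)\<bar>"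
        using that(1) p unfolding E_def E3_def by force
      ultimately have "v (\<phi> t) (\<psi> t) t' < r (\<phi> t) (\<psi> t)" using t(2) by linarith
      then show ?thesis unfolding \<psi>_def eq by (metis (mono_tags, lifting) Least_le eq)
    qed
    have "\<psi> t = \<psi> t'" if "t \<notin> E" "t' \<notin> E" "e t t' < min \<delta>1 d'" for t t'
      using \<psi>_mono[OF that] \<psi>_mono[of t' t] that sym[of t' t] by simp
    then show ?thesis using E \<psi>_le d' E1(2)
      by (intro exI[of _ E] exI[of _ I2] exI[of _ "min \<delta>1 d'"]) auto
  qed
  ultimately show ?thesis using \<psi>_meas unfolding index_controlled_def by blast
qed

end

text \<open>A deviation of e' at t forces a deviation of e at t, or t in E, or t + \<tau> in E; each
  of the three sets has density at most \<epsilon> / 3. The same l stands on both sides, so window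
  lengths that are uniform in \<tau> carry over.\<close>

lemma controlled_almost_period:
  assumes "kernel e" "kernel e'" and ctrl: "kernel_controlled e e'" and \<epsilon>: "\<epsilon> > 0"
  shows "\<exists>L>0. \<exists>\<delta>>0. \<forall>l\<ge>L. \<forall>\<tau>. almost_period e l \<delta> \<tau> \<longrightarrow> almost_period e' l \<epsilon> \<tau>"
proof -
  interpret e: kernel e by fact
  interpret e': kernel e' by fact
  obtain E \<delta>0 where E: "small E (\<epsilon> / 3)" "\<delta>0 > 0"
    and near: "\<And>t t'. t \<notin> E \<Longrightarrow> t' \<notin> E \<Longrightarrow> e t t' < \<delta>0 \<Longrightarrow> e' t t' < \<epsilon> / 3"
  proof -
    have "\<epsilon> / 3 > 0" using \<epsilon> by simp
    from ctrl[unfolded kernel_controlled_def, rule_format, OF this] show ?thesis using that by blast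
  qed
  obtain L where Em: "E \<in> sets lebesgue" and L: "L > 0" "\<And>l \<xi>. l \<ge> L \<Longrightarrow> window E \<xi> l \<le> \<epsilon> / 3 * l"
    using E(1) by (auto simp: small_def)
  define \<delta> where "\<delta> = min \<delta>0 (\<epsilon> / 3)"
  have \<delta>: "\<delta> > 0" unfolding \<delta>_def using E \<epsilon> by simp
  have "almost_period e' l \<epsilon> \<tau>" if l: "l \<ge> L" and \<tau>: "almost_period e l \<delta> \<tau>" for l \<tau>
    unfolding almost_period_def
  proof
    fix \<xi>
    have Em': "{t. t + \<tau> \<in> E} \<in> sets lebesgue" by (rule sets_lebesgue_translate[OF Em])
    have "{t. \<epsilon> \<le> e' t (t + \<tau>)} \<subseteq> {t. \<delta> \<le> e t (t + \<tau>)} \<union> (E \<union> {t. t + \<tau> \<in> E})"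
    proof
      fix t assume t: "t \<in> {t. \<epsilon> \<le> e' t (t + \<tau>)}"
      show "t \<in> {t. \<delta> \<le> e t (t + \<tau>)} \<union> (E \<union> {t. t + \<tau> \<in> E})"
      proof (rule ccontr)
        assume "t \<notin> {t. \<delta> \<le> e t (t + \<tau>)} \<union> (E \<union> {t. t + \<tau> \<in> E})"
        then have "e' t (t + \<tau>) < \<epsilon> / 3" by (intro near) (auto simp: \<delta>_def)
        then show False using t \<epsilon> by simp
      qed
    qed
    then have "window {t. \<epsilon> \<le> e' t (t + \<tau>)} \<xi> l \<le> window {t. \<delta> \<le> e t (t + \<tau>)} \<xi> l + window (E \<union> {t. t + \<tau> \<in> E}) \<xi> l"
      by (rule window_le_add[OF _ e'.deviation_sets e.deviation_sets sets.Un[OF Em Em']])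
    also have "window (E \<union> {t. t + \<tau> \<in> E}) \<xi> l \<le> window E \<xi> l + window E (\<xi> + \<tau>) l"
      using window_Un_le[OF Em Em'] unfolding window_translate .
    also have "\<dots> \<le> \<epsilon> / 3 * l + \<epsilon> / 3 * l" by (intro add_mono L l)
    also have "window {t. \<delta> \<le> e t (t + \<tau>)} \<xi> l \<le> \<delta> * l" using \<tau> by (simp add: almost_period_def)
    also have "\<delta> * l \<le> \<epsilon> / 3 * l" unfolding \<delta>_def using l L(1) by (intro mult_right_mono) auto
    finally show "window {t. \<epsilon> \<le> e' t (t + \<tau>)} \<xi> l \<le> \<epsilon> * l" by simp
  qed
  then show ?thesis using L(1) \<delta> by blast
qed

lemma controlled_ap_kernel:
  assumes "ap_kernel e" "kernel e'" "kernel_controlled e e'"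
  shows "ap_kernel e'"
proof -
  interpret e: ap_kernel e by fact
  interpret e': kernel e' by fact
  show ?thesis
  proof
    fix \<epsilon> :: real assume \<epsilon>: "\<epsilon> > 0"
    obtain L \<delta> where L: "L > 0" "\<delta> > 0" "\<And>l \<tau>. l \<ge> L \<Longrightarrow> almost_period e l \<delta> \<tau> \<Longrightarrow> almost_period e' l \<epsilon> \<tau>"
      using controlled_almost_period[OF e.kernel_axioms assms(2,3) \<epsilon>] by blast
    obtain l where l: "l > 0" "relatively_dense {\<tau>. almost_period e l (\<delta> / 2) \<tau>}"
      using e.almost_periodic[of "\<delta> / 2"] L(2) by auto
    have "almost_period e' (max l L) \<epsilon> \<tau>" if "almost_period e l (\<delta> / 2) \<tau>" for \<tau>
      using e.almost_period_scale[OF that l(1), of "max l L"] L(3)[of "max l L" \<tau>] by simp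
    then have "{\<tau>. almost_period e l (\<delta> / 2) \<tau>} \<subseteq> {\<tau>. almost_period e' (max l L) \<epsilon> \<tau>}" by blast
    then have "relatively_dense {\<tau>. almost_period e' (max l L) \<epsilon> \<tau>}"
      using l(2) unfolding relatively_dense_def by blast
    then show "\<exists>l>0. relatively_dense {\<tau>. almost_period e' l \<epsilon> \<tau>}" using l(1) by (intro exI[of _ "max l L"]) auto
  qed
qed

section \<open>Measurable and almost periodic functions\<close>

text \<open>Covers points and families of closed sets alike, with truncated as well as untruncated
  distances.\<close>

locale pseudometric =
  fixes X :: "'x set" and d :: "'x \<Rightarrow> 'x \<Rightarrow> real"
  assumes nonneg: "x \<in> X \<Longrightarrow> y \<in> X \<Longrightarrow> 0 \<le> d x y"
    and refl: "x \<in> X \<Longrightarrow> d x x = 0"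
    and sym: "x \<in> X \<Longrightarrow> y \<in> X \<Longrightarrow> d x y = d y x"
    and triangle: "x \<in> X \<Longrightarrow> y \<in> X \<Longrightarrow> z \<in> X \<Longrightarrow> d x z \<le> d x y + d y z"

lemma pseudometric_Metric_space: "Metric_space X d \<Longrightarrow> pseudometric X d"
  by (simp add: Metric_space_def pseudometric_def)

lemma (in pseudometric) pseudometric_trunc_dist: "pseudometric X (trunc_dist d)"
proof
  fix x y z assume *: "x \<in> X" "y \<in> X" "z \<in> X"
  show "trunc_dist d x z \<le> trunc_dist d x y + trunc_dist d y z"
    using triangle[OF *] nonneg[OF *(1,2)] nonneg[OF *(2,3)] unfolding trunc_dist_def by linarith
qed (auto simp: trunc_dist_def refl sym nonneg)

lemma trunc_dist_less_iff: "\<delta> \<le> 1 \<Longrightarrow> trunc_dist d x y < \<delta> \<longleftrightarrow> d x y < \<delta>"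
  by (auto simp: trunc_dist_def)

lemma relatively_dense_mono: "relatively_dense S \<Longrightarrow> S \<subseteq> T \<Longrightarrow> relatively_dense T"
  unfolding relatively_dense_def by (meson disjoint_iff subsetD)

definition time_kernel :: "('x \<Rightarrow> 'x \<Rightarrow> real) \<Rightarrow> (real \<Rightarrow> 'x) \<Rightarrow> real \<Rightarrow> real \<Rightarrow> real" where
  "time_kernel d f t s = trunc_dist d (f t) (f s)"

lemma AE_limit_measurable:
  fixes u :: "real \<Rightarrow> real"
  assumes w: "\<And>n. w n \<in> borel_measurable lebesgue"
    and ae: "\<And>n. AE t in lebesgue. \<bar>u t - w n t\<bar> \<le> 1 / real (Suc n)"
  shows "u \<in> borel_measurable lebesgue"
proof (rule borel_measurable_AE)
  show "(\<lambda>t. lim (\<lambda>n. w n t)) \<in> borel_measurable lebesgue"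
    using w by (rule borel_measurable_lim_metric)
  have "AE t in lebesgue. \<forall>n. \<bar>u t - w n t\<bar> \<le> 1 / real (Suc n)"
    using ae by (simp add: AE_all_countable)
  then show "AE t in lebesgue. lim (\<lambda>n. w n t) = u t"
  proof eventually_elim
    case (elim t)
    have "(\<lambda>n. w n t - u t) \<longlonglongrightarrow> 0"
    proof (rule Lim_null_comparison[OF _ LIMSEQ_Suc[OF lim_1_over_n]], rule always_eventually, rule allI)
      show "norm (w n t - u t) \<le> 1 / real (Suc n)" for n
        using elim[rule_format, of n] by (simp add: abs_minus_commute)
    qed
    then show ?case by (intro limI) (simp add: LIM_zero_iff)
  qed
qed

context pseudometric
begin

lemma abs_diff_le:
  assumes "x \<in> X" "y \<in> X" "z \<in> X"
  shows "\<bar>d x z - d y z\<bar> \<le> d x y"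
  using triangle[of x y z] triangle[of y x z] sym[of x y] assms by simp

text \<open>Replaces the partition into the sets \<open>T j\<close> by a measurable index function;
  its value on the null set outside all \<open>T j\<close> is arbitrary.\<close>

lemma elementary_approximation:
  assumes "f \<in> measurable_funs X d" "\<epsilon> > 0"
  shows "\<exists>(x :: nat \<Rightarrow> 'x) J. (\<forall>j. x j \<in> X) \<and> J \<in> measurable lebesgue (count_space UNIV) \<and>
    (AE t in lebesgue. d (f t) (x (J t)) < \<epsilon>)"
proof -
  obtain h where h: "elementary X h" "esssup lebesgue (\<lambda>t. ereal (d (f t) (h t))) < ereal \<epsilon>"
    using assms unfolding measurable_funs_def by blast
  from h(1)[unfolded elementary_def, THEN conjunct2]
  obtain x :: "nat \<Rightarrow> 'x" and T :: "nat \<Rightarrow> real set" where xT: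
    "(\<forall>j. x j \<in> X) \<and> (\<forall>j. T j \<in> sets lebesgue) \<and> disjoint_family T \<and>
        emeasure lebesgue (UNIV - (\<Union>j. T j)) = 0 \<and> (\<forall>j. \<forall>t\<in>T j. h t = x j)"
    by (elim exE) (rule that)
  have x: "\<And>j. x j \<in> X" and T: "\<And>j. T j \<in> sets lebesgue" "emeasure lebesgue (UNIV - (\<Union>j. T j)) = 0"
    and hT: "\<And>j t. t \<in> T j \<Longrightarrow> h t = x j"
    using xT by (elim conjE, metis)+
  define J where "J = (\<lambda>t. LEAST j. t \<in> T j)"
  have J: "J \<in> measurable lebesgue (count_space UNIV)"
    unfolding J_def using T(1) by (intro measurable_Least) (simp add: pred_def)
  have "AE t in lebesgue. ereal (d (f t) (h t)) \<le> esssup lebesgue (\<lambda>t. ereal (d (f t) (h t)))"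
    by (rule esssup_AE)
  moreover have "AE t in lebesgue. t \<in> (\<Union>j. T j)"
  proof (rule AE_I')
    show "UNIV - (\<Union>j. T j) \<in> null_sets lebesgue"
      using T by (intro null_setsI sets.Diff sets.countable_UN) auto
  qed auto
  ultimately have "AE t in lebesgue. d (f t) (x (J t)) < \<epsilon>"
  proof eventually_elim
    case (elim t)
    have "ereal (d (f t) (h t)) < ereal \<epsilon>" by (rule order_le_less_trans[OF elim(1) h(2)])
    moreover have "t \<in> T (J t)" unfolding J_def using elim(2) by (auto intro: LeastI)
    ultimately show ?case using hT by simp
  qed
  then show ?thesis using x J by blast
qed

lemma approximating_sequence:
  assumes "f \<in> measurable_funs X d"
  shows "\<exists>(y :: nat \<Rightarrow> nat \<Rightarrow> 'x) J. (\<forall>n j. y n j \<in> X) \<and> (\<forall>n. J n \<in> measurable lebesgue (count_space UNIV)) \<and>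
    (\<forall>n. AE t in lebesgue. d (f t) (y n (J n t)) < 1 / real (Suc n))"
proof -
  have "\<forall>n. \<exists>(y :: nat \<Rightarrow> 'x) J. (\<forall>j. y j \<in> X) \<and> J \<in> measurable lebesgue (count_space UNIV) \<and>
    (AE t in lebesgue. d (f t) (y (J t)) < 1 / real (Suc n))"
    by (intro allI elementary_approximation[OF assms]) simp
  then show ?thesis by metis
qed

lemma section_measurable:
  assumes f: "f \<in> measurable_funs X d" and x: "x \<in> X"
  shows "(\<lambda>t. d (f t) x) \<in> borel_measurable lebesgue"
proof -
  have fX: "f t \<in> X" for t using f by (auto simp: measurable_funs_def)
  obtain y J where y: "\<And>n j. y n j \<in> X" and J: "\<And>n. J n \<in> measurable lebesgue (count_space (UNIV :: nat set))"
    and ae: "\<And>n. AE t in lebesgue. d (f t) (y n (J n t)) < 1 / real (Suc n)"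
    using approximating_sequence[OF f] by blast
  show ?thesis
  proof (rule AE_limit_measurable[where w = "\<lambda>n t. d (y n (J n t)) x"])
    show "(\<lambda>t. d (y n (J n t)) x) \<in> borel_measurable lebesgue" for n
      by (rule measurable_compose[OF J]) simp
    show "AE t in lebesgue. \<bar>d (f t) x - d (y n (J n t)) x\<bar> \<le> 1 / real (Suc n)" for n
      using ae[of n]
    proof eventually_elim
      case (elim t)
      then show ?case using abs_diff_le[OF fX[of t] y[of n "J n t"] x] by linarith
    qed
  qed
qed

text \<open>The values of the approximating functions need not be values of f. Each is replaced by a
  time at which f comes within 1 / (n + 1) of it, if there is one.\<close>

lemma separating_times:
  assumes f: "f \<in> measurable_funs X d"
  shows "\<exists>s :: nat \<Rightarrow> real. AE t in lebesgue. \<forall>\<delta>>0. \<exists>j. d (f t) (f (s j)) < \<delta>"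
proof -
  have fX: "f t \<in> X" for t using f by (auto simp: measurable_funs_def)
  obtain y and J :: "nat \<Rightarrow> real \<Rightarrow> nat" where y: "\<And>n j. y n j \<in> X"
    and ae: "\<And>n. AE t in lebesgue. d (f t) (y n (J n t)) < 1 / real (Suc n)"
    using approximating_sequence[OF f] by blast
  define s where "s = (\<lambda>(n, j). SOME t. d (f t) (y n j) < 1 / real (Suc n))"
  have "AE t in lebesgue. \<forall>n. d (f t) (y n (J n t)) < 1 / real (Suc n)"
    using ae by (simp add: AE_all_countable)
  then have "AE t in lebesgue. \<forall>\<delta>>0. \<exists>j. d (f t) (f (s (prod_decode j))) < \<delta>"
  proof eventually_elim
    case (elim t)
    show ?case
    proof (intro allI impI)
      fix \<delta> :: real assume "\<delta> > 0"
      then obtain n where n: "1 / real (Suc n) < \<delta> / 2" using nat_approx_posE[of "\<delta> / 2"] by auto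
      have 1: "d (f t) (y n (J n t)) < 1 / real (Suc n)" using elim by blast
      then have 2: "d (f (s (n, J n t))) (y n (J n t)) < 1 / real (Suc n)"
        unfolding s_def prod.case by (rule someI)
      have "d (f t) (f (s (n, J n t))) < \<delta>"
        using triangle[of "f t" "y n (J n t)" "f (s (n, J n t))"] 1 2 n fX y sym by fastforce
      then show "\<exists>j. d (f t) (f (s (prod_decode j))) < \<delta>"
        by (metis prod_encode_inverse)
    qed
  qed
  then show ?thesis by (intro exI)
qed

text \<open>\<open>esssup\<close> is infinite on functions that are not measurable, so the distance
  from f to one approximation must first be shown measurable: it is a limit of the distances between
  that approximation and ever finer ones.\<close>

lemma measurable_funs_if_approx:
  assumes fX: "\<And>t. f t \<in> X"
    and approx: "\<And>\<epsilon>. \<epsilon> > 0 \<Longrightarrow> \<exists>(x :: nat \<Rightarrow> 'x) J. (\<forall>j. x j \<in> X) \<and> J \<in> measurable lebesgue (count_space UNIV) \<and>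
      (AE t in lebesgue. d (f t) (x (J t)) < \<epsilon>)"
  shows "f \<in> measurable_funs X d"
proof -
  have "\<forall>n. \<exists>(y :: nat \<Rightarrow> 'x) J. (\<forall>j. y j \<in> X) \<and> J \<in> measurable lebesgue (count_space UNIV) \<and>
    (AE t in lebesgue. d (f t) (y (J t)) < 1 / real (Suc n))"
    by (intro allI approx) simp
  then obtain y I where y: "\<And>n j. y n j \<in> X" and I: "\<And>n. I n \<in> measurable lebesgue (count_space (UNIV :: nat set))"
    and ae: "\<And>n. AE t in lebesgue. d (f t) (y n (I n t)) < 1 / real (Suc n)"
    by metis
  have "\<exists>h. elementary X h \<and> esssup lebesgue (\<lambda>t. ereal (d (f t) (h t))) < ereal \<epsilon>" if \<epsilon>: "\<epsilon> > 0" for \<epsilon>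
  proof -
    have "\<epsilon> / 2 > 0" using \<epsilon> by simp
    from approx[OF this] obtain x and J :: "real \<Rightarrow> nat" where x: "\<And>j. x j \<in> X"
      and J: "J \<in> measurable lebesgue (count_space UNIV)" and near: "AE t in lebesgue. d (f t) (x (J t)) < \<epsilon> / 2"
      by blast
    have T: "{t. J t = j} \<in> sets lebesgue" for j
      using measurable_sets[OF J, of "{j}"] by (simp add: vimage_def)
    have "elementary X (\<lambda>t. x (J t))"
      unfolding elementary_def
    proof (intro conjI exI allI ballI)
      show "(\<lambda>t. x (J t)) \<in> UNIV \<rightarrow> X" using x by simp
      show "x j \<in> X" for j by (rule x)
      show "{t. J t = j} \<in> sets lebesgue" for j by (rule T)
      show "disjoint_family (\<lambda>j. {t. J t = j})" by (auto simp: disjoint_family_on_def)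
      have "UNIV - (\<Union>j. {t. J t = j}) = {}" by blast
      then show "emeasure lebesgue (UNIV - (\<Union>j. {t. J t = j})) = 0" by (simp only: emeasure_empty)
      show "x (J t) = x j" if "t \<in> {t. J t = j}" for j t using that by simp
    qed
    moreover have "esssup lebesgue (\<lambda>t. ereal (d (f t) (x (J t)))) \<le> ereal (\<epsilon> / 2)"
    proof (rule esssup_I)
      have "(\<lambda>t. d (f t) (x (J t))) \<in> borel_measurable lebesgue"
      proof (rule AE_limit_measurable[where w = "\<lambda>n t. d (y n (I n t)) (x (J t))"])
        show "(\<lambda>t. d (y n (I n t)) (x (J t))) \<in> borel_measurable lebesgue" for n
          by (rule measurable_compose_countable[OF measurable_compose[OF I] J]) simp
        show "AE t in lebesgue. \<bar>d (f t) (x (J t)) - d (y n (I n t)) (x (J t))\<bar> \<le> 1 / real (Suc n)" for n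
          using ae[of n]
        proof eventually_elim
          case (elim t)
          then show ?case using abs_diff_le[OF fX[of t] y[of n "I n t"] x[of "J t"]] by linarith
        qed
      qed
      then show "(\<lambda>t. ereal (d (f t) (x (J t)))) \<in> borel_measurable lebesgue" by simp
      show "AE t in lebesgue. ereal (d (f t) (x (J t))) \<le> ereal (\<epsilon> / 2)"
        using near by eventually_elim simp
    qed
    then have "esssup lebesgue (\<lambda>t. ereal (d (f t) (x (J t)))) < ereal \<epsilon>"
      by (rule order_le_less_trans) (use \<epsilon> in simp)
    ultimately show ?thesis by blast
  qed
  then show ?thesis using fX by (auto simp: measurable_funs_def)
qed

lemma kernel_time_kernel:
  assumes f: "f \<in> measurable_funs X d"
  shows "kernel (time_kernel d f)"
proof
  have fX: "f t \<in> X" for t using f by (auto simp: measurable_funs_def)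
  interpret t: pseudometric X "trunc_dist d" by (rule pseudometric_trunc_dist)
  show "time_kernel d f t t = 0" for t using t.refl fX by (simp add: time_kernel_def)
  show "time_kernel d f t s = time_kernel d f s t" for t s using t.sym fX by (simp add: time_kernel_def)
  show "time_kernel d f t u \<le> time_kernel d f t s + time_kernel d f s u" for t s u
    using t.triangle fX by (simp add: time_kernel_def)
  show "time_kernel d f t s \<le> 1" for t s by (simp add: time_kernel_def trunc_dist_def)
  show "(\<lambda>t. time_kernel d f t s) \<in> borel_measurable lebesgue" for s
    unfolding time_kernel_def trunc_dist_def using section_measurable[OF f fX[of s]] by measurable
  obtain s :: "nat \<Rightarrow> real" where s: "AE t in lebesgue. \<forall>\<delta>>0. \<exists>j. d (f t) (f (s j)) < \<delta>"
    using separating_times[OF f] by blast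
  have le: "time_kernel d f t s \<le> d (f t) (f s)" for t s by (simp add: time_kernel_def trunc_dist_def)
  from s have "AE t in lebesgue. \<forall>\<delta>>0. \<exists>j. time_kernel d f t (s j) < \<delta>"
  proof eventually_elim
    case (elim t)
    then show ?case using le by (meson order_le_less_trans)
  qed
  then show "\<exists>s :: nat \<Rightarrow> real. AE t in lebesgue. \<forall>\<delta>>0. \<exists>j. time_kernel d f t (s j) < \<delta>" by (rule exI[of _ s])
qed

end

section \<open>Mean deviations compared with deviations in measure\<close>

lemma set_integrable_bounded_Icc:
  fixes u :: "real \<Rightarrow> real"
  assumes "u \<in> borel_measurable lebesgue" "\<And>t. \<bar>u t\<bar> \<le> B"
  shows "set_integrable lebesgue {a..b} u"
  unfolding set_integrable_def
  by (rule integrableI_bounded_set_indicator[where B = B]) (use assms in \<open>auto simp: emeasure_lborel_Icc_eq\<close>)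

lemma markov_window:
  fixes u :: "real \<Rightarrow> real"
  assumes u: "u \<in> borel_measurable lebesgue" "\<And>t. 0 \<le> u t" and int: "set_integrable lebesgue {\<xi>..\<xi> + l} u"
  shows "\<epsilon> * window {t. \<epsilon> \<le> u t} \<xi> l \<le> (LINT t:{\<xi>..\<xi> + l}|lebesgue. u t)"
proof -
  define B where "B = {t. \<epsilon> \<le> u t} \<inter> {\<xi>..\<xi> + l}"
  have "{t. \<epsilon> \<le> u t} \<in> sets lebesgue"
    using measurable_sets[OF u(1), of "{\<epsilon>..}"] by (simp add: vimage_def)
  then have B: "B \<in> lmeasurable" unfolding B_def by (rule lmeasurable_Int_Icc)
  have "\<epsilon> * measure lebesgue B = (LINT t|lebesgue. \<epsilon> * indicator B t)"
    using B by simp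
  also have "\<dots> \<le> (LINT t|lebesgue. indicator {\<xi>..\<xi> + l} t *\<^sub>R u t)"
  proof (rule integral_mono)
    show "integrable lebesgue (\<lambda>t. \<epsilon> * indicator B t)"
      using B by (intro integrable_mult_right integrable_real_indicator) (auto simp: fmeasurable_def)
    show "integrable lebesgue (\<lambda>t. indicator {\<xi>..\<xi> + l} t *\<^sub>R u t)" using int by (simp add: set_integrable_def)
    show "\<epsilon> * indicator B t \<le> indicator {\<xi>..\<xi> + l} t *\<^sub>R u t" for t
      using u(2)[of t] by (auto simp: B_def indicator_def)
  qed
  finally show ?thesis unfolding set_lebesgue_integral_def window_def B_def .
qed

lemma set_integral_le_window:
  fixes u :: "real \<Rightarrow> real"
  assumes u: "u \<in> borel_measurable lebesgue" "\<And>t. 0 \<le> u t" "\<And>t. u t \<le> 1" and "0 \<le> l" "0 \<le> \<epsilon>"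
  shows "(LINT t:{\<xi>..\<xi> + l}|lebesgue. u t) \<le> \<epsilon> * l + window {t. \<epsilon> \<le> u t} \<xi> l"
proof -
  define B where "B = {t. \<epsilon> \<le> u t} \<inter> {\<xi>..\<xi> + l}"
  have "{t. \<epsilon> \<le> u t} \<in> sets lebesgue"
    using measurable_sets[OF u(1), of "{\<epsilon>..}"] by (simp add: vimage_def)
  then have B: "B \<in> lmeasurable" unfolding B_def by (rule lmeasurable_Int_Icc)
  have I: "integrable lebesgue (\<lambda>t. \<epsilon> * indicator {\<xi>..\<xi> + l} t)"
    by (intro integrable_mult_right integrable_real_indicator) (auto simp: emeasure_lborel_Icc_eq)
  have J: "integrable lebesgue (indicator B :: real \<Rightarrow> real)"
    using B by (intro integrable_real_indicator) (auto simp: fmeasurable_def)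
  have "(LINT t|lebesgue. indicator {\<xi>..\<xi> + l} t *\<^sub>R u t) \<le> (LINT t|lebesgue. \<epsilon> * indicator {\<xi>..\<xi> + l} t + indicator B t)"
  proof (rule integral_mono)
    have "\<bar>u t\<bar> \<le> 1" for t using u(2,3)[of t] by simp
    then show "integrable lebesgue (\<lambda>t. indicator {\<xi>..\<xi> + l} t *\<^sub>R u t)"
      using set_integrable_bounded_Icc[OF u(1), of 1] by (simp add: set_integrable_def)
    show "integrable lebesgue (\<lambda>t. \<epsilon> * indicator {\<xi>..\<xi> + l} t + indicator B t)" using I J by (rule Bochner_Integration.integrable_add)
    show "indicator {\<xi>..\<xi> + l} t *\<^sub>R u t \<le> \<epsilon> * indicator {\<xi>..\<xi> + l} t + indicator B t" for t
      using u(2,3)[of t] assms(5) by (auto simp: B_def indicator_def)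
  qed
  also have "\<dots> = \<epsilon> * l + measure lebesgue B"
    using I J B assms(4) by simp
  finally show ?thesis unfolding set_lebesgue_integral_def window_def B_def .
qed

definition kernel_dist :: "(real \<Rightarrow> real \<Rightarrow> real) \<Rightarrow> real \<Rightarrow> real \<Rightarrow> real" where
  "kernel_dist e l \<tau> = (SUP \<xi>. (1 / l) * (LINT t:{\<xi>..\<xi> + l}|lebesgue. e t (t + \<tau>)))"

lemma weyl_dist_eq: "weyl_dist d l f (\<lambda>t. f (t + \<tau>)) = kernel_dist (time_kernel d f) l \<tau>"
  by (simp add: weyl_dist_def kernel_dist_def time_kernel_def)

context kernel
begin

text \<open>Markov's inequality; of the two factors \<epsilon> one is the threshold and the other
  the density.\<close>

lemma almost_period_if_dist:
  assumes "kernel_dist e l \<tau> < \<epsilon>\<^sup>2" "l > 0" "\<epsilon> > 0"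
  shows "almost_period e l \<epsilon> \<tau>"
  unfolding almost_period_def
proof
  fix \<xi>
  have le: "(LINT t:{\<xi>..\<xi> + l}|lebesgue. e t (t + \<tau>)) \<le> l" for \<xi>
  proof -
    have "(LINT t:{\<xi>..\<xi> + l}|lebesgue. e t (t + \<tau>)) \<le> 0 * l + window {t. 0 \<le> e t (t + \<tau>)} \<xi> l"
      by (rule set_integral_le_window) (use nonneg le_one assms in auto)
    also have "\<dots> \<le> 0 * l + l" by (rule add_left_mono) (rule window_le_length[OF deviation_sets], use assms in simp)
    finally show ?thesis by simp
  qed
  \<comment> \<open>A supremum of reals bounds its members only when they are bounded above.\<close>
  have "bdd_above (range (\<lambda>\<xi>. (1 / l) * (LINT t:{\<xi>..\<xi> + l}|lebesgue. e t (t + \<tau>))))"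
    using le assms by (intro bdd_aboveI[of _ 1]) (auto simp: divide_le_eq)
  then have "(1 / l) * (LINT t:{\<xi>..\<xi> + l}|lebesgue. e t (t + \<tau>)) \<le> kernel_dist e l \<tau>"
    unfolding kernel_dist_def by (rule cSUP_upper[rotated]) simp
  then have "(1 / l) * (LINT t:{\<xi>..\<xi> + l}|lebesgue. e t (t + \<tau>)) \<le> \<epsilon>\<^sup>2" using assms(1) by linarith
  then have "(LINT t:{\<xi>..\<xi> + l}|lebesgue. e t (t + \<tau>)) \<le> \<epsilon>\<^sup>2 * l" using assms(2) by (simp add: divide_le_eq)
  moreover have "\<epsilon> * window {t. \<epsilon> \<le> e t (t + \<tau>)} \<xi> l \<le> (LINT t:{\<xi>..\<xi> + l}|lebesgue. e t (t + \<tau>))"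
  proof (rule markov_window[OF shift_measurable nonneg])
    have "\<bar>e t (t + \<tau>)\<bar> \<le> 1" for t using nonneg[of t "t + \<tau>"] le_one[of t "t + \<tau>"] by simp
    then show "set_integrable lebesgue {\<xi>..\<xi> + l} (\<lambda>t. e t (t + \<tau>))"
      by (rule set_integrable_bounded_Icc[OF shift_measurable])
  qed
  ultimately have "\<epsilon> * window {t. \<epsilon> \<le> e t (t + \<tau>)} \<xi> l \<le> \<epsilon> * (\<epsilon> * l)" by (simp add: power2_eq_square)
  then show "window {t. \<epsilon> \<le> e t (t + \<tau>)} \<xi> l \<le> \<epsilon> * l" using assms(3) by simp
qed

text \<open>The integrand is at most \<epsilon> off the deviation set and at most 1 on it.\<close>

lemma dist_le_if_almost_period:
  assumes "almost_period e l \<epsilon> \<tau>" "l > 0"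
  shows "kernel_dist e l \<tau> \<le> 2 * \<epsilon>"
  unfolding kernel_dist_def
proof (rule cSUP_least)
  fix \<xi>
  have "(LINT t:{\<xi>..\<xi> + l}|lebesgue. e t (t + \<tau>)) \<le> \<epsilon> * l + window {t. \<epsilon> \<le> e t (t + \<tau>)} \<xi> l"
    by (rule set_integral_le_window) (use nonneg le_one almost_period_nonneg[OF assms] assms(2) in auto)
  also have "\<dots> \<le> \<epsilon> * l + \<epsilon> * l" using assms(1) by (simp add: almost_period_def)
  finally show "(1 / l) * (LINT t:{\<xi>..\<xi> + l}|lebesgue. e t (t + \<tau>)) \<le> 2 * \<epsilon>"
    using assms(2) by (simp add: divide_le_eq)
qed simp

lemma ap_kernel_iff:
  "ap_kernel e \<longleftrightarrow> (\<forall>\<epsilon>>0. \<exists>l>0. relatively_dense {\<tau>. kernel_dist e l \<tau> < \<epsilon>})"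
proof
  assume ap: "ap_kernel e"
  show "\<forall>\<epsilon>>0. \<exists>l>0. relatively_dense {\<tau>. kernel_dist e l \<tau> < \<epsilon>}"
  proof (intro allI impI)
    fix \<epsilon> :: real assume \<epsilon>: "\<epsilon> > 0"
    then obtain l where l: "l > 0" "relatively_dense {\<tau>. almost_period e l (\<epsilon> / 4) \<tau>}"
      using ap_kernel.almost_periodic[OF ap, of "\<epsilon> / 4"] by auto
    have "kernel_dist e l \<tau> < \<epsilon>" if "almost_period e l (\<epsilon> / 4) \<tau>" for \<tau>
      using dist_le_if_almost_period[OF that l(1)] \<epsilon> by linarith
    then have "{\<tau>. almost_period e l (\<epsilon> / 4) \<tau>} \<subseteq> {\<tau>. kernel_dist e l \<tau> < \<epsilon>}" by blast
    then show "\<exists>l>0. relatively_dense {\<tau>. kernel_dist e l \<tau> < \<epsilon>}"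
      using l(1) relatively_dense_mono[OF l(2)] by blast
  qed
next
  assume *: "\<forall>\<epsilon>>0. \<exists>l>0. relatively_dense {\<tau>. kernel_dist e l \<tau> < \<epsilon>}"
  show "ap_kernel e"
  proof
    fix \<epsilon> :: real assume \<epsilon>: "\<epsilon> > 0"
    then obtain l where l: "l > 0" "relatively_dense {\<tau>. kernel_dist e l \<tau> < \<epsilon>\<^sup>2}"
      using *[rule_format, of "\<epsilon>\<^sup>2"] by auto
    have "{\<tau>. kernel_dist e l \<tau> < \<epsilon>\<^sup>2} \<subseteq> {\<tau>. almost_period e l \<epsilon> \<tau>}"
      using almost_period_if_dist l(1) \<epsilon> by blast
    then show "\<exists>l>0. relatively_dense {\<tau>. almost_period e l \<epsilon> \<tau>}"
      using l(1) relatively_dense_mono[OF l(2)] by blast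
  qed
qed

end

definition kernel_returning :: "(real \<Rightarrow> real \<Rightarrow> real) \<Rightarrow> (nat \<Rightarrow> real) \<Rightarrow> bool" where
  "kernel_returning e \<tau> \<longleftrightarrow> (\<forall>\<epsilon>>0. \<exists>l>0. \<exists>j0. \<forall>j\<ge>j0. almost_period e l \<epsilon> (\<tau> j))"

lemma (in pseudometric) weyl_ap_iff:
  "f \<in> weyl_ap X d \<longleftrightarrow> f \<in> measurable_funs X d \<and> ap_kernel (time_kernel d f)"
proof (cases "f \<in> measurable_funs X d")
  case True
  then interpret kernel "time_kernel d f" by (rule kernel_time_kernel)
  show ?thesis using True by (simp add: weyl_ap_def weyl_dist_eq ap_kernel_iff)
qed (simp add: weyl_ap_def)

lemma (in pseudometric) returning_iff:
  assumes "f \<in> measurable_funs X d"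
  shows "returning d f \<tau> \<longleftrightarrow> kernel_returning (time_kernel d f) \<tau>"
proof -
  interpret kernel "time_kernel d f" using assms by (rule kernel_time_kernel)
  show ?thesis
  proof
    assume *: "returning d f \<tau>"
    show "kernel_returning (time_kernel d f) \<tau>"
      unfolding kernel_returning_def
    proof (intro allI impI)
      fix \<epsilon> :: real assume \<epsilon>: "\<epsilon> > 0"
      then have "\<epsilon>\<^sup>2 > 0" by simp
      then obtain l j0 where l: "l > 0" "\<forall>j\<ge>j0. kernel_dist (time_kernel d f) l (\<tau> j) < \<epsilon>\<^sup>2"
        using * unfolding returning_def weyl_dist_eq by blast
      then show "\<exists>l>0. \<exists>j0. \<forall>j\<ge>j0. almost_period (time_kernel d f) l \<epsilon> (\<tau> j)"
        using almost_period_if_dist[OF _ l(1) \<epsilon>] by blast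
    qed
  next
    assume *: "kernel_returning (time_kernel d f) \<tau>"
    show "returning d f \<tau>"
      unfolding returning_def weyl_dist_eq
    proof (intro allI impI)
      fix \<epsilon> :: real assume \<epsilon>: "\<epsilon> > 0"
      then have "\<epsilon> / 4 > 0" by simp
      then obtain l j0 where l: "l > 0" "\<forall>j\<ge>j0. almost_period (time_kernel d f) l (\<epsilon> / 4) (\<tau> j)"
        using * unfolding kernel_returning_def by blast
      have "kernel_dist (time_kernel d f) l (\<tau> j) < \<epsilon>" if "j \<ge> j0" for j
        using dist_le_if_almost_period[of l "\<epsilon> / 4" "\<tau> j"] l that \<epsilon> by auto
      then show "\<exists>l>0. \<exists>j0. \<forall>j\<ge>j0. kernel_dist (time_kernel d f) l (\<tau> j) < \<epsilon>"
        using l(1) by blast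
    qed
  qed
qed

section \<open>Hausdorff distance and the module inclusion\<close>

context pseudometric
begin

lemma bdd_below_dist: "x \<in> X \<Longrightarrow> A \<subseteq> X \<Longrightarrow> bdd_below (d x ` A)"
  by (rule bdd_belowI[of _ 0]) (auto intro: nonneg)

lemma point_set_dist_le: "x \<in> X \<Longrightarrow> A \<subseteq> X \<Longrightarrow> y \<in> A \<Longrightarrow> point_set_dist d x A \<le> d x y"
  unfolding point_set_dist_def by (rule cINF_lower[OF bdd_below_dist])

lemma point_set_dist_ge: "A \<noteq> {} \<Longrightarrow> (\<And>y. y \<in> A \<Longrightarrow> c \<le> d x y) \<Longrightarrow> c \<le> point_set_dist d x A"
  unfolding point_set_dist_def by (rule cINF_greatest)

lemma point_set_dist_nonneg: "x \<in> X \<Longrightarrow> A \<subseteq> X \<Longrightarrow> A \<noteq> {} \<Longrightarrow> 0 \<le> point_set_dist d x A"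
  by (rule point_set_dist_ge) (auto intro: nonneg)

lemma point_set_dist_lessD: "x \<in> X \<Longrightarrow> A \<subseteq> X \<Longrightarrow> A \<noteq> {} \<Longrightarrow> point_set_dist d x A < c \<Longrightarrow> \<exists>y\<in>A. d x y < c"
  by (meson not_le point_set_dist_ge)

lemma point_set_dist_triangle:
  assumes "x \<in> X" "y \<in> X" "A \<subseteq> X" "A \<noteq> {}"
  shows "point_set_dist d x A \<le> d x y + point_set_dist d y A"
proof -
  have "point_set_dist d x A - d x y \<le> point_set_dist d y A"
  proof (rule point_set_dist_ge[OF assms(4)])
    fix z assume z: "z \<in> A"
    then have "point_set_dist d x A \<le> d x z" using assms by (intro point_set_dist_le)
    also have "\<dots> \<le> d x y + d y z" using assms z by (intro triangle) auto
    finally show "point_set_dist d x A - d x y \<le> d y z" by simp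
  qed
  then show ?thesis by simp
qed

end

text \<open>Serves for closed sets with the truncated distance and for bounded closed sets with the
  distance itself. The assumption \<open>bounded\<close> makes the real suprema in
  \<open>hausdorff_dist\<close> genuine.\<close>

locale hausdorff_family = pseudometric X d for X :: "'x set" and d +
  fixes S :: "'x set set"
  assumes nonempty: "A \<in> S \<Longrightarrow> A \<noteq> {}" and subset: "A \<in> S \<Longrightarrow> A \<subseteq> X"
    and bounded: "A \<in> S \<Longrightarrow> B \<in> S \<Longrightarrow> bdd_above ((\<lambda>x. point_set_dist d x B) ` A)"
begin

lemma point_set_dist_le_hausdorff:
  "A \<in> S \<Longrightarrow> B \<in> S \<Longrightarrow> x \<in> A \<Longrightarrow> point_set_dist d x B \<le> hausdorff_dist d A B"
  unfolding hausdorff_dist_def by (rule max.coboundedI1) (rule cSUP_upper[OF _ bounded])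

lemma hausdorff_commute: "hausdorff_dist d A B = hausdorff_dist d B A"
  by (simp add: hausdorff_dist_def max.commute)

lemma hausdorff_le:
  assumes "A \<in> S" "B \<in> S" "\<And>x. x \<in> A \<Longrightarrow> point_set_dist d x B \<le> c" "\<And>x. x \<in> B \<Longrightarrow> point_set_dist d x A \<le> c"
  shows "hausdorff_dist d A B \<le> c"
  unfolding hausdorff_dist_def
  by (intro max.boundedI cSUP_least nonempty[OF assms(1)] nonempty[OF assms(2)]) (fact assms(3,4))+

lemma point_set_dist_le_add_hausdorff:
  assumes "x \<in> X" "A \<in> S" "B \<in> S"
  shows "point_set_dist d x B \<le> point_set_dist d x A + hausdorff_dist d A B"
proof -
  have "point_set_dist d x B - hausdorff_dist d A B \<le> point_set_dist d x A"
  proof (rule point_set_dist_ge[OF nonempty[OF assms(2)]])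
    fix a assume a: "a \<in> A"
    have "point_set_dist d x B \<le> d x a + point_set_dist d a B"
      by (rule point_set_dist_triangle) (use assms a subset nonempty in auto)
    also have "point_set_dist d a B \<le> hausdorff_dist d A B" by (rule point_set_dist_le_hausdorff) fact+
    finally show "point_set_dist d x B - hausdorff_dist d A B \<le> d x a" by simp
  qed
  then show ?thesis by simp
qed

lemma pseudometric_hausdorff: "pseudometric S (hausdorff_dist d)"
proof
  fix A B C assume A: "A \<in> S" and B: "B \<in> S"
  obtain a where a: "a \<in> A" using nonempty[OF A] by blast
  have "0 \<le> point_set_dist d a B" by (rule point_set_dist_nonneg) (use a A B subset nonempty in auto)
  also have "\<dots> \<le> hausdorff_dist d A B" by (rule point_set_dist_le_hausdorff) fact+
  finally show "0 \<le> hausdorff_dist d A B" .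
  show "hausdorff_dist d A B = hausdorff_dist d B A" by (rule hausdorff_commute)
  assume C: "C \<in> S"
  show "hausdorff_dist d A C \<le> hausdorff_dist d A B + hausdorff_dist d B C"
  proof (rule hausdorff_le[OF A C])
    fix x assume "x \<in> A"
    then show "point_set_dist d x C \<le> hausdorff_dist d A B + hausdorff_dist d B C"
      using point_set_dist_le_add_hausdorff[of x B C] point_set_dist_le_hausdorff[of A B x] A B C subset[OF A] by auto
  next
    fix x assume "x \<in> C"
    then show "point_set_dist d x A \<le> hausdorff_dist d A B + hausdorff_dist d B C"
      using point_set_dist_le_add_hausdorff[of x B A] point_set_dist_le_hausdorff[of C B x] A B C subset[OF C]
      by (auto simp: hausdorff_commute)
  qed
next
  fix A assume A: "A \<in> S"
  obtain a where a: "a \<in> A" using nonempty[OF A] by blast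
  have 0: "point_set_dist d x A \<le> 0" if "x \<in> A" for x
    using point_set_dist_le[of x A x] refl[of x] subset[OF A] that by auto
  have "hausdorff_dist d A A \<le> 0" by (rule hausdorff_le[OF A A 0 0])
  moreover have "0 \<le> point_set_dist d a A" by (rule point_set_dist_nonneg) (use a A subset nonempty in auto)
  then have "0 \<le> hausdorff_dist d A A" using point_set_dist_le_hausdorff[OF A A a] by linarith
  ultimately show "hausdorff_dist d A A = 0" by simp
qed

end

context Metric_space
begin

lemma cl_sets_subset: "A \<in> cl_sets M d \<Longrightarrow> A \<subseteq> M"
  unfolding cl_sets_def mem_Collect_eq using closedin_subset topspace_mtopology by blast

lemma hausdorff_family_cl_sets: "hausdorff_family M (trunc_dist d) (cl_sets M d)"
proof -
  interpret t: pseudometric M "trunc_dist d"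
    by (rule pseudometric.pseudometric_trunc_dist[OF pseudometric_Metric_space]) (rule Metric_space_axioms)
  show ?thesis
  proof
    fix A B assume A: "A \<in> cl_sets M d" and B: "B \<in> cl_sets M d"
    show A': "A \<noteq> {}" "A \<subseteq> M" using A cl_sets_subset by (auto simp: cl_sets_def)
    obtain b where b: "b \<in> B" using B by (auto simp: cl_sets_def)
    have "point_set_dist (trunc_dist d) x B \<le> 1" if "x \<in> A" for x
    proof -
      have "point_set_dist (trunc_dist d) x B \<le> trunc_dist d x b"
        by (rule t.point_set_dist_le) (use that A' b cl_sets_subset[OF B] in auto)
      also have "\<dots> \<le> 1" by (simp add: trunc_dist_def)
      finally show ?thesis .
    qed
    then show "bdd_above ((\<lambda>x. point_set_dist (trunc_dist d) x B) ` A)" by (intro bdd_aboveI[of _ 1]) auto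
  qed
qed

lemma hausdorff_family_clb_sets: "hausdorff_family M d (clb_sets M d)"
proof -
  interpret p: pseudometric M d by (rule pseudometric_Metric_space) (rule Metric_space_axioms)
  show ?thesis
  proof
    fix A B assume A: "A \<in> clb_sets M d" and B: "B \<in> clb_sets M d"
    have A1: "A \<in> cl_sets M d" and B1: "B \<in> cl_sets M d" using A B by (auto simp: clb_sets_def)
    show A': "A \<noteq> {}" "A \<subseteq> M" using A1 cl_sets_subset by (auto simp: cl_sets_def)
    obtain b where b: "b \<in> B" using B1 by (auto simp: cl_sets_def)
    obtain x0 R where R: "A \<subseteq> mcball x0 R" using A by (auto simp: clb_sets_def mbounded_def)
    have bM: "b \<in> M" using b cl_sets_subset[OF B1] by blast
    have "point_set_dist d x B \<le> R + d x0 b" if x: "x \<in> A" for x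
    proof -
      have *: "x0 \<in> M" "x \<in> M" "d x0 x \<le> R" using R x by auto
      have "point_set_dist d x B \<le> d x b"
        by (rule p.point_set_dist_le) (use * b cl_sets_subset[OF B1] in auto)
      also have "\<dots> \<le> d x x0 + d x0 b" by (rule triangle) (use * bM in auto)
      finally show ?thesis using * commute[of x x0] by simp
    qed
    then show "bdd_above ((\<lambda>x. point_set_dist d x B) ` A)" by (intro bdd_aboveI[of _ "R + d x0 b"]) auto
  qed
qed

text \<open>Below 1 truncation is invisible, so closeness in the truncated Hausdorff distance
  provides truly nearby points and controls untruncated distances even where these are
  large.\<close>

lemma point_set_dist_near:
  assumes A: "A \<in> cl_sets M d" and B: "B \<in> cl_sets M d" and x: "x \<in> M"
    and near: "hausdorff_dist (trunc_dist d) A B < \<delta>" "\<delta> \<le> 1"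
  shows "point_set_dist d x B \<le> point_set_dist d x A + \<delta>"
proof -
  interpret p: pseudometric M d by (rule pseudometric_Metric_space) (rule Metric_space_axioms)
  interpret h: hausdorff_family M "trunc_dist d" "cl_sets M d" by (rule hausdorff_family_cl_sets)
  have AM: "A \<subseteq> M" "B \<subseteq> M" "A \<noteq> {}" "B \<noteq> {}" using h.subset h.nonempty A B by auto
  have "point_set_dist d x B - \<delta> \<le> point_set_dist d x A"
  proof (rule p.point_set_dist_ge[OF AM(3)])
    fix a assume a: "a \<in> A"
    have "point_set_dist (trunc_dist d) a B < \<delta>"
      using h.point_set_dist_le_hausdorff[OF A B a] near(1) by linarith
    then obtain b where b: "b \<in> B" "trunc_dist d a b < \<delta>"
      using h.point_set_dist_lessD[of a B \<delta>] a AM by auto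
    then have ab: "d a b < \<delta>" using near(2) by (simp add: trunc_dist_less_iff)
    have "point_set_dist d x B \<le> d x b" by (rule p.point_set_dist_le) (use x AM b in auto)
    also have "\<dots> \<le> d x a + d a b" by (rule triangle) (use x a b AM in auto)
    finally show "point_set_dist d x B - \<delta> \<le> d x a" using ab by simp
  qed
  then show ?thesis by simp
qed

text \<open>Turns the vanishing distance of a limit of approximate selections into membership in
  \<open>F t\<close>.\<close>

lemma point_set_dist_zero_iff:
  assumes A: "A \<in> cl_sets M d" and x: "x \<in> M" and z: "point_set_dist d x A \<le> 0"
  shows "x \<in> A"
proof (rule ccontr)
  interpret p: pseudometric M d by (rule pseudometric_Metric_space) (rule Metric_space_axioms)
  assume "x \<notin> A"
  moreover have "closedin mtopology A" "A \<noteq> {}" using A by (auto simp: cl_sets_def)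
  ultimately obtain r where r: "r > 0" "disjnt A (mball x r)" using x unfolding closedin_metric by blast
  have "\<exists>y\<in>A. d x y < r"
    by (rule p.point_set_dist_lessD) (use x z r cl_sets_subset[OF A] \<open>A \<noteq> {}\<close> in auto)
  then obtain y where "y \<in> A" "d x y < r" by blast
  then have "y \<in> mball x r" using x cl_sets_subset[OF A] by auto
  then show False using r(2) \<open>y \<in> A\<close> by (auto simp: disjnt_def)
qed

end

section \<open>Two almost periodic kernels at once\<close>

lemma almost_period_max:
  assumes "kernel e1" "kernel e2" "almost_period e1 l \<epsilon> \<tau>" "almost_period e2 l \<epsilon> \<tau>"
    and "0 \<le> \<epsilon>"
  shows "almost_period (\<lambda>t s. max (e1 t s) (e2 t s)) l (2 * \<epsilon>) \<tau>"
  unfolding almost_period_def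
proof
  fix \<xi>
  interpret e1: kernel e1 by fact
  interpret e2: kernel e2 by fact
  have m: "{t. 2 * \<epsilon> \<le> max (e1 t (t + \<tau>)) (e2 t (t + \<tau>))} \<in> sets lebesgue"
  proof -
    have "{t. 2 * \<epsilon> \<le> max (e1 t (t + \<tau>)) (e2 t (t + \<tau>))} = {t. 2 * \<epsilon> \<le> e1 t (t + \<tau>)} \<union> {t. 2 * \<epsilon> \<le> e2 t (t + \<tau>)}"
      by (auto simp: le_max_iff_disj)
    then show ?thesis using sets.Un[OF e1.deviation_sets e2.deviation_sets] by simp
  qed
  have "{t. 2 * \<epsilon> \<le> max (e1 t (t + \<tau>)) (e2 t (t + \<tau>))} \<subseteq> {t. \<epsilon> \<le> e1 t (t + \<tau>)} \<union> {t. \<epsilon> \<le> e2 t (t + \<tau>)}"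
    using assms(5) by (auto simp: le_max_iff_disj)
  then have "window {t. 2 * \<epsilon> \<le> max (e1 t (t + \<tau>)) (e2 t (t + \<tau>))} \<xi> l
      \<le> window {t. \<epsilon> \<le> e1 t (t + \<tau>)} \<xi> l + window {t. \<epsilon> \<le> e2 t (t + \<tau>)} \<xi> l"
    by (rule window_le_add[OF _ m e1.deviation_sets e2.deviation_sets])
  also have "\<dots> \<le> \<epsilon> * l + \<epsilon> * l" using assms by (intro add_mono) (auto simp: almost_period_def)
  finally show "window {t. 2 * \<epsilon> \<le> max (e1 t (t + \<tau>)) (e2 t (t + \<tau>))} \<xi> l \<le> 2 * \<epsilon> * l" by simp
qed

lemma kernel_max:
  assumes "kernel e1" "kernel e2"
  shows "kernel (\<lambda>t s. max (e1 t s) (e2 t s))"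
proof
  interpret e1: kernel e1 by fact
  interpret e2: kernel e2 by fact
  show "max (e1 t t) (e2 t t) = 0" for t by (simp add: e1.refl e2.refl)
  show "max (e1 t s) (e2 t s) = max (e1 s t) (e2 s t)" for t s using e1.sym[of t s] e2.sym[of t s] by simp
  show "max (e1 t u) (e2 t u) \<le> max (e1 t s) (e2 t s) + max (e1 s u) (e2 s u)" for t s u
    using e1.triangle[of t u s] e2.triangle[of t u s] by linarith
  show "max (e1 t s) (e2 t s) \<le> 1" for t s using e1.le_one e2.le_one by simp
  show "(\<lambda>t. max (e1 t s) (e2 t s)) \<in> borel_measurable lebesgue" for s
    using e1.section_measurable[of s] e2.section_measurable[of s] by simp
  obtain s1 :: "nat \<Rightarrow> real" where s1: "AE t in lebesgue. \<forall>\<delta>>0. \<exists>j. e1 t (s1 j) < \<delta>" using e1.separable by blast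
  obtain s2 :: "nat \<Rightarrow> real" where s2: "AE t in lebesgue. \<forall>\<delta>>0. \<exists>j. e2 t (s2 j) < \<delta>" using e2.separable by blast
  \<comment> \<open>A time in the intersection of a ball of the first family with one of the second;
    triples with empty intersection are never called upon.\<close>
  define s where "s = (\<lambda>(n, i, j). SOME t. e1 t (s1 i) < 1 / real (Suc n) \<and> e2 t (s2 j) < 1 / real (Suc n))"
  have "AE t in lebesgue. \<forall>\<delta>>0. \<exists>p. max (e1 t (s p)) (e2 t (s p)) < \<delta>"
    using s1 s2
  proof eventually_elim
    case (elim t)
    show ?case
    proof (intro allI impI)
      fix \<delta> :: real assume "\<delta> > 0"
      then obtain n where n: "1 / real (Suc n) < \<delta> / 2" using nat_approx_posE[of "\<delta> / 2"] by auto
      have pos: "1 / real (Suc n) > 0" by simp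
      obtain i where i: "e1 t (s1 i) < 1 / real (Suc n)" using elim(1) pos by blast
      obtain j where j: "e2 t (s2 j) < 1 / real (Suc n)" using elim(2) pos by blast
      have "e1 (s (n, i, j)) (s1 i) < 1 / real (Suc n) \<and> e2 (s (n, i, j)) (s2 j) < 1 / real (Suc n)"
        unfolding s_def prod.case by (rule someI[of _ t]) (use i j in blast)
      then have "max (e1 t (s (n, i, j))) (e2 t (s (n, i, j))) < \<delta>"
        using i j n e1.triangle[of t "s (n, i, j)" "s1 i"] e2.triangle[of t "s (n, i, j)" "s2 j"]
          e1.sym[of "s1 i" "s (n, i, j)"] e2.sym[of "s2 j" "s (n, i, j)"] by linarith
      then show "\<exists>p. max (e1 t (s p)) (e2 t (s p)) < \<delta>" by blast
    qed
  qed
  then have "AE t in lebesgue. \<forall>\<delta>>0. \<exists>k. max (e1 t (s (from_nat k))) (e2 t (s (from_nat k))) < \<delta>"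
  proof eventually_elim
    case (elim t)
    then show ?case by (metis from_nat_to_nat)
  qed
  then show "\<exists>s :: nat \<Rightarrow> real. AE t in lebesgue. \<forall>\<delta>>0. \<exists>j. max (e1 t (s j)) (e2 t (s j)) < \<delta>"
    by (rule exI[of _ "\<lambda>k. s (from_nat k)"])
qed

text \<open>A common almost period needs a common window length; \<open>kernel_norm_uniform\<close>
  supplies for each kernel a length that does not depend on \<tau>.\<close>

lemma joint_uniform:
  assumes "ap_kernel e1" "ap_kernel e2" "\<epsilon> > 0"
  shows "\<exists>\<delta>>0. \<exists>L>0. \<forall>\<tau>. kernel_norm e1 \<tau> + kernel_norm e2 \<tau> < \<delta> \<longrightarrow>
    (\<forall>l\<ge>L. almost_period (\<lambda>t s. max (e1 t s) (e2 t s)) l \<epsilon> \<tau>)"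
proof -
  interpret e1: ap_kernel e1 by fact
  interpret e2: ap_kernel e2 by fact
  interpret N1: pseudonorm "kernel_norm e1" by (rule e1.pseudonorm_kernel_norm)
  interpret N2: pseudonorm "kernel_norm e2" by (rule e2.pseudonorm_kernel_norm)
  define \<delta> where "\<delta> = \<epsilon> / 8"
  have \<delta>: "\<delta> > 0" unfolding \<delta>_def using assms(3) by simp
  obtain L1 where L1: "L1 > 0" "\<And>\<tau> l. kernel_norm e1 \<tau> < \<delta> \<Longrightarrow> l \<ge> L1 \<Longrightarrow> almost_period e1 l (4 * \<delta>) \<tau>"
    using e1.kernel_norm_uniform[OF \<delta>] by blast
  obtain L2 where L2: "L2 > 0" "\<And>\<tau> l. kernel_norm e2 \<tau> < \<delta> \<Longrightarrow> l \<ge> L2 \<Longrightarrow> almost_period e2 l (4 * \<delta>) \<tau>"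
    using e2.kernel_norm_uniform[OF \<delta>] by blast
  have "almost_period (\<lambda>t s. max (e1 t s) (e2 t s)) l \<epsilon> \<tau>"
    if \<tau>: "kernel_norm e1 \<tau> + kernel_norm e2 \<tau> < \<delta>" and l: "l \<ge> max L1 L2" for \<tau> l
  proof -
    have "almost_period (\<lambda>t s. max (e1 t s) (e2 t s)) l (2 * (4 * \<delta>)) \<tau>"
    proof (rule almost_period_max)
      show "kernel e1" "kernel e2" by unfold_locales
      show "almost_period e1 l (4 * \<delta>) \<tau>" using L1(2)[of \<tau> l] N2.nonneg[of \<tau>] \<tau> l by simp
      show "almost_period e2 l (4 * \<delta>) \<tau>" using L2(2)[of \<tau> l] N1.nonneg[of \<tau>] \<tau> l by simp
      show "0 \<le> 4 * \<delta>" using \<delta> by simp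
    qed
    then show ?thesis by (simp add: \<delta>_def)
  qed
  then show ?thesis using \<delta> L1(1) by (intro exI[of _ \<delta>] conjI exI[of _ "max L1 L2"]) auto
qed

text \<open>Relatively dense sets of almost periods of the two kernels need not meet. Total
  boundedness of the sum of the norms helps: every \<xi> + M is near some s of a finite net, and
  \<xi> + M - s is then a common almost period in {\<xi>..\<xi> + 2 * M}.\<close>

lemma ap_kernel_max:
  assumes "ap_kernel e1" "ap_kernel e2"
  shows "ap_kernel (\<lambda>t s. max (e1 t s) (e2 t s))"
proof -
  interpret e1: ap_kernel e1 by fact
  interpret e2: ap_kernel e2 by fact
  interpret m: kernel "\<lambda>t s. max (e1 t s) (e2 t s)" by (rule kernel_max) unfold_locales
  interpret N: pseudonorm "\<lambda>\<tau>. kernel_norm e1 \<tau> + kernel_norm e2 \<tau>"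
    by (rule pseudonorm_add[OF e1.pseudonorm_kernel_norm e2.pseudonorm_kernel_norm])
  show ?thesis
  proof
    fix \<epsilon> :: real assume \<epsilon>: "\<epsilon> > 0"
    obtain \<delta> L where L: "\<delta> > 0" "L > 0"
      "\<And>\<tau> l. kernel_norm e1 \<tau> + kernel_norm e2 \<tau> < \<delta> \<Longrightarrow> l \<ge> L \<Longrightarrow> almost_period (\<lambda>t s. max (e1 t s) (e2 t s)) l \<epsilon> \<tau>"
      using joint_uniform[OF assms \<epsilon>] by blast
    obtain S where S: "finite S" "\<And>\<tau>. \<exists>s\<in>S. kernel_norm e1 (\<tau> - s) + kernel_norm e2 (\<tau> - s) < \<delta>"
      using N.totally_bounded[OF L(1)] by blast
    define M where "M = Max (insert 1 (abs ` S))"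
    have M: "M > 0" "\<And>s. s \<in> S \<Longrightarrow> \<bar>s\<bar> \<le> M"
    proof -
      have "1 \<le> M" unfolding M_def using S(1) by (intro Max_ge) auto
      then show "M > 0" by simp
      show "\<bar>s\<bar> \<le> M" if "s \<in> S" for s unfolding M_def using S(1) that by (intro Max_ge) auto
    qed
    have "relatively_dense {\<tau>. almost_period (\<lambda>t s. max (e1 t s) (e2 t s)) L \<epsilon> \<tau>}"
      unfolding relatively_dense_def
    proof (intro exI[of _ "2 * M"] conjI allI)
      fix \<xi>
      obtain s where s: "s \<in> S" "kernel_norm e1 (\<xi> + M - s) + kernel_norm e2 (\<xi> + M - s) < \<delta>" using S(2) by blast
      have "\<xi> + M - s \<in> {\<xi>..\<xi> + 2 * M}" using M(2)[OF s(1)] by auto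
      moreover have "almost_period (\<lambda>t s. max (e1 t s) (e2 t s)) L \<epsilon> (\<xi> + M - s)" using L(3)[OF s(2)] by simp
      ultimately show "{\<xi>..\<xi> + 2 * M} \<inter> {\<tau>. almost_period (\<lambda>t s. max (e1 t s) (e2 t s)) L \<epsilon> \<tau>} \<noteq> {}" by blast
    qed (use M in simp)
    then show "\<exists>l>0. relatively_dense {\<tau>. almost_period (\<lambda>t s. max (e1 t s) (e2 t s)) l \<epsilon> \<tau>}" using L(2) by blast
  qed
qed

section \<open>From returning sequences to the module inclusion\<close>

lemma (in ap_kernel) returning_kernel_norm:
  assumes "kernel_returning e \<tau>"
  shows "(\<lambda>j. kernel_norm e (\<tau> j)) \<longlonglongrightarrow> 0"
proof (rule LIMSEQ_I)
  fix r :: real assume r: "r > 0"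
  interpret pseudonorm "kernel_norm e" by (rule pseudonorm_kernel_norm)
  have "r / 4 > 0" using r by simp
  then obtain l j0 where l: "l > 0" "\<forall>j\<ge>j0. almost_period e l (r / 4) (\<tau> j)"
    using assms unfolding kernel_returning_def by blast
  have "norm (kernel_norm e (\<tau> j) - 0) < r" if "j \<ge> j0" for j
    using kernel_norm_le_scale[of "r / 4" l "\<tau> j"] l that r nonneg[of "\<tau> j"] by auto
  then show "\<exists>no. \<forall>n\<ge>no. norm (kernel_norm e (\<tau> n) - 0) < r" by blast
qed

lemma (in pseudometric) Mod_if_lipschitz:
  assumes f: "f \<in> weyl_ap X d" and lip: "\<And>r. norm (cis (\<mu> * r) - 1) \<le> C * kernel_norm (time_kernel d f) r"
  shows "\<mu> \<in> Mod d f"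
  unfolding Mod_def
proof (intro CollectI allI impI)
  fix \<tau> assume ret: "returning d f \<tau>"
  interpret ap_kernel "time_kernel d f" using f weyl_ap_iff by blast
  have "kernel_returning (time_kernel d f) \<tau>" using ret f returning_iff weyl_ap_iff by blast
  then have "(\<lambda>j. C * kernel_norm (time_kernel d f) (\<tau> j)) \<longlonglongrightarrow> C * 0"
    by (intro tendsto_mult_left returning_kernel_norm)
  then have "(\<lambda>j. C * kernel_norm (time_kernel d f) (\<tau> j)) \<longlonglongrightarrow> 0"
    by (simp only: mult_zero_right)
  moreover have "\<forall>\<^sub>F j in sequentially. norm (cis (\<mu> * \<tau> j) - 1) \<le> C * kernel_norm (time_kernel d f) (\<tau> j)"
    by (rule always_eventually, rule allI, rule lip)
  ultimately have "(\<lambda>j. cis (\<mu> * \<tau> j) - 1) \<longlonglongrightarrow> 0"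
    by (rule Lim_null_comparison[rotated])
  then have "(\<lambda>j. cis (\<mu> * \<tau> j)) \<longlonglongrightarrow> 1" by (rule LIM_zero_cancel)
  then show "(\<lambda>j. exp (\<i> * complex_of_real (\<mu> * \<tau> j))) \<longlonglongrightarrow> 1"
    unfolding cis_conv_exp .
qed

text \<open>If \<mu> were not continuous for the sum of the two norms, there would be shifts with
  norms tending to 0 and characters away from 1; they would form a sequence returning for f, against
  the choice of \<mu>. Continuity allows \<open>pseudonorm_character_split\<close> to be
  applied.\<close>

theorem Mod_subset_module_sum:
  assumes "pseudometric X dX" "pseudometric Y dY" "pseudometric Z dZ"
    and F: "F \<in> weyl_ap X dX" and g: "g \<in> weyl_ap Y dY" and f: "f \<in> measurable_funs Z dZ"
    and ctrl: "kernel_controlled (\<lambda>t s. max (time_kernel dX F t s) (time_kernel dY g t s)) (time_kernel dZ f)"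
  shows "Mod dZ f \<subseteq> module_sum (Mod dX F) (Mod dY g)"
proof
  interpret X: pseudometric X dX by fact
  interpret Y: pseudometric Y dY by fact
  interpret Z: pseudometric Z dZ by fact
  let ?e1 = "time_kernel dX F" and ?e2 = "time_kernel dY g"
  define e where "e = (\<lambda>t s. max (?e1 t s) (?e2 t s))"
  have ap1: "ap_kernel ?e1" and ap2: "ap_kernel ?e2" using F g X.weyl_ap_iff Y.weyl_ap_iff by auto
  interpret e1: ap_kernel ?e1 by (rule ap1)
  interpret e2: ap_kernel ?e2 by (rule ap2)
  interpret N1: pseudonorm "kernel_norm ?e1" by (rule e1.pseudonorm_kernel_norm)
  interpret N2: pseudonorm "kernel_norm ?e2" by (rule e2.pseudonorm_kernel_norm)
  have ke: "kernel e" unfolding e_def by (rule kernel_max) unfold_locales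
  have kf: "kernel (time_kernel dZ f)" by (rule Z.kernel_time_kernel[OF f])
  fix \<mu> assume \<mu>: "\<mu> \<in> Mod dZ f"
  have "\<exists>\<delta>>0. \<forall>\<tau>. kernel_norm ?e1 \<tau> + kernel_norm ?e2 \<tau> < \<delta> \<longrightarrow> norm (cis (\<mu> * \<tau>) - 1) < \<epsilon>" if \<epsilon>: "\<epsilon> > 0" for \<epsilon>
  proof (rule ccontr)
    assume neg: "\<not> ?thesis"
    have "\<exists>\<tau>. kernel_norm ?e1 \<tau> + kernel_norm ?e2 \<tau> < 1 / real (Suc j) \<and> \<not> norm (cis (\<mu> * \<tau>) - 1) < \<epsilon>" for j
    proof -
      have "1 / real (Suc j) > 0" by simp
      then show ?thesis using neg by blast
    qed
    then obtain \<tau> where \<tau>: "\<And>j. kernel_norm ?e1 (\<tau> j) + kernel_norm ?e2 (\<tau> j) < 1 / real (Suc j)"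
      and far: "\<And>j. \<not> norm (cis (\<mu> * \<tau> j) - 1) < \<epsilon>" by metis
    have "kernel_returning (time_kernel dZ f) \<tau>"
      unfolding kernel_returning_def
    proof (intro allI impI)
      fix \<epsilon>' :: real assume "\<epsilon>' > 0"
      then obtain L \<delta> where L: "L > 0" "\<delta> > 0" "\<And>l \<tau>. l \<ge> L \<Longrightarrow> almost_period e l \<delta> \<tau> \<Longrightarrow> almost_period (time_kernel dZ f) l \<epsilon>' \<tau>"
        using controlled_almost_period[OF ke kf ctrl[folded e_def], of \<epsilon>'] by blast
      \<comment> \<open>A returning sequence needs one window length for all large j, and
        \<open>L'\<close> is uniform over all shifts of small norm.\<close>
      obtain \<delta>' L' where L': "\<delta>' > 0" "L' > 0" "\<And>\<tau> l. kernel_norm ?e1 \<tau> + kernel_norm ?e2 \<tau> < \<delta>' \<Longrightarrow> l \<ge> L' \<Longrightarrow> almost_period e l \<delta> \<tau>"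
        using joint_uniform[OF ap1 ap2 L(2), folded e_def] by blast
      obtain j0 where j0: "1 / real (Suc j0) < \<delta>'" using nat_approx_posE[OF L'(1)] by blast
      have "almost_period (time_kernel dZ f) (max L L') \<epsilon>' (\<tau> j)" if "j \<ge> j0" for j
      proof -
        have "1 / real (Suc j) \<le> 1 / real (Suc j0)" using that by (intro divide_left_mono) auto
        then have "kernel_norm ?e1 (\<tau> j) + kernel_norm ?e2 (\<tau> j) < \<delta>'" using \<tau>[of j] j0 by linarith
        then show ?thesis using L(3) L'(3) by simp
      qed
      then show "\<exists>l>0. \<exists>j0. \<forall>j\<ge>j0. almost_period (time_kernel dZ f) l \<epsilon>' (\<tau> j)"
        using L(1) by (intro exI[of _ "max L L'"]) auto
    qed
    then have "returning dZ f \<tau>" using Z.returning_iff[OF f] by blast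
    then have "(\<lambda>j. exp (\<i> * complex_of_real (\<mu> * \<tau> j))) \<longlonglongrightarrow> 1" using \<mu> unfolding Mod_def by blast
    then have "(\<lambda>j. cis (\<mu> * \<tau> j)) \<longlonglongrightarrow> 1" unfolding cis_conv_exp .
    then obtain j where "norm (cis (\<mu> * \<tau> j) - 1) < \<epsilon>" using LIMSEQ_D[OF _ \<epsilon>] by blast
    then show False using far by blast
  qed
  from pseudonorm_character_split[OF N1.pseudonorm_axioms N2.pseudonorm_axioms this]
  obtain \<nu> C where \<nu>: "\<And>r. norm (cis (\<nu> * r) - 1) \<le> C * kernel_norm ?e2 r"
    "\<And>r. norm (cis ((\<mu> - \<nu>) * r) - 1) \<le> C * kernel_norm ?e1 r" by blast
  have "\<nu> \<in> Mod dY g" by (rule Y.Mod_if_lipschitz[OF g \<nu>(1)])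
  moreover have "\<mu> - \<nu> \<in> Mod dX F" by (rule X.Mod_if_lipschitz[OF F \<nu>(2)])
  ultimately have "(\<mu> - \<nu>) + \<nu> \<in> module_sum (Mod dX F) (Mod dY g)"
    unfolding module_sum_def by (intro group_closure_add group_closure.base) auto
  then show "\<mu> \<in> module_sum (Mod dX F) (Mod dY g)" by simp
qed

section \<open>Selections\<close>

context pseudometric
begin

text \<open>The index of the glued approximation must record both the piece and the index within it,
  so pairs are encoded as numbers.\<close>

lemma measurable_funs_glue:
  assumes h: "\<And>k :: nat. h k \<in> measurable_funs X d" and \<kappa>: "\<kappa> \<in> measurable lebesgue (count_space UNIV)"
  shows "(\<lambda>t. h (\<kappa> t) t) \<in> measurable_funs X d"
proof (rule measurable_funs_if_approx)
  show "h (\<kappa> t) t \<in> X" for t using h[of "\<kappa> t"] by (auto simp: measurable_funs_def)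
  fix \<epsilon> :: real assume \<epsilon>: "\<epsilon> > 0"
  have "\<forall>k. \<exists>(x :: nat \<Rightarrow> 'x) J. (\<forall>j. x j \<in> X) \<and> J \<in> measurable lebesgue (count_space UNIV) \<and>
    (AE t in lebesgue. d (h k t) (x (J t)) < \<epsilon>)"
    by (intro allI elementary_approximation[OF h \<epsilon>])
  then obtain x J where x: "\<And>k j. x k j \<in> X" and J: "\<And>k. J k \<in> measurable lebesgue (count_space (UNIV :: nat set))"
    and ae: "\<And>k. AE t in lebesgue. d (h k t) (x k (J k t)) < \<epsilon>"
    by metis
  define y where "y = (\<lambda>p. x (fst (prod_decode p)) (snd (prod_decode p)))"
  define I where "I = (\<lambda>t. prod_encode (\<kappa> t, J (\<kappa> t) t))"
  have "(\<lambda>t. prod_encode (k, J k t)) \<in> measurable lebesgue (count_space UNIV)" for k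
    by (rule measurable_compose[OF J]) simp
  then have "I \<in> measurable lebesgue (count_space UNIV)"
    unfolding I_def by (rule measurable_compose_countable[OF _ \<kappa>])
  moreover have "y p \<in> X" for p unfolding y_def by (rule x)
  moreover have "AE t in lebesgue. \<forall>k. d (h k t) (x k (J k t)) < \<epsilon>" using ae by (simp add: AE_all_countable)
  then have "AE t in lebesgue. d (h (\<kappa> t) t) (y (I t)) < \<epsilon>"
  proof eventually_elim
    case (elim t)
    then show ?case by (simp add: y_def I_def)
  qed
  ultimately show "\<exists>(x :: nat \<Rightarrow> 'x) J. (\<forall>j. x j \<in> X) \<and> J \<in> measurable lebesgue (count_space UNIV) \<and>
      (AE t in lebesgue. d (h (\<kappa> t) t) (x (J t)) < \<epsilon>)" by blast
qed

end

lemma kernel_ucI: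
  assumes C: "C > 0" and lip: "\<And>t t' \<delta>. 0 < \<delta> \<Longrightarrow> \<delta> \<le> 1 \<Longrightarrow> e t t' < \<delta> \<Longrightarrow> \<bar>v t - v t'\<bar> \<le> C * \<delta>"
  shows "kernel_uc e v"
  unfolding kernel_uc_def
proof (intro allI impI)
  fix \<epsilon> :: real assume \<epsilon>: "\<epsilon> > 0"
  define \<delta> where "\<delta> = min 1 (\<epsilon> / (2 * C))"
  have \<delta>: "\<delta> > 0" "\<delta> \<le> 1" unfolding \<delta>_def using \<epsilon> C by auto
  have "C * \<delta> \<le> C * (\<epsilon> / (2 * C))" unfolding \<delta>_def using C by (intro mult_left_mono) auto
  also have "\<dots> = \<epsilon> / 2" using C by simp
  finally have "\<bar>v t - v t'\<bar> < \<epsilon>" if "e t t' < \<delta>" for t t'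
    using lip[OF \<delta> that] \<epsilon> by linarith
  then show "\<exists>\<delta>>0. \<forall>t t'. e t t' < \<delta> \<longrightarrow> \<bar>v t - v t'\<bar> < \<epsilon>" using \<delta>(1) by blast
qed

lemma kernel_uc_max:
  assumes "kernel_uc e v" "kernel_uc e w"
  shows "kernel_uc e (\<lambda>t. max (v t) (w t))"
  unfolding kernel_uc_def
proof (intro allI impI)
  fix \<epsilon> :: real assume \<epsilon>: "\<epsilon> > 0"
  obtain a where a: "a > 0" "\<forall>t t'. e t t' < a \<longrightarrow> \<bar>v t - v t'\<bar> < \<epsilon>" using assms(1) \<epsilon> unfolding kernel_uc_def by blast
  obtain b where b: "b > 0" "\<forall>t t'. e t t' < b \<longrightarrow> \<bar>w t - w t'\<bar> < \<epsilon>" using assms(2) \<epsilon> unfolding kernel_uc_def by blast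
  have "\<bar>max (v t) (w t) - max (v t') (w t')\<bar> < \<epsilon>" if "e t t' < min a b" for t t'
  proof -
    have "\<bar>v t - v t'\<bar> < \<epsilon>" "\<bar>w t - w t'\<bar> < \<epsilon>" using a(2) b(2) that by auto
    then show ?thesis by linarith
  qed
  then show "\<exists>\<delta>>0. \<forall>t t'. e t t' < \<delta> \<longrightarrow> \<bar>max (v t) (w t) - max (v t') (w t')\<bar> < \<epsilon>"
    using a(1) b(1) by (intro exI[of _ "min a b"]) auto
qed

lemma kernel_uc_const_minus:
  assumes "kernel_uc e v"
  shows "kernel_uc e (\<lambda>t. c - v t)"
proof -
  have "\<bar>(c - v t) - (c - v t')\<bar> = \<bar>v t - v t'\<bar>" for t t' by simp
  then show ?thesis using assms unfolding kernel_uc_def by (simp only:)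
qed

lemma index_controlled_const: "index_controlled e (\<lambda>_. k)"
  unfolding index_controlled_def
proof (intro conjI allI impI)
  fix \<epsilon> :: real assume "\<epsilon> > 0"
  then have "small {} \<epsilon>" using small_mono[OF small_null[of "{}"], of "{}" \<epsilon>] by simp
  then show "\<exists>E I \<delta>. small E \<epsilon> \<and> \<delta> > 0 \<and> (\<forall>t. t \<notin> E \<longrightarrow> k \<le> I) \<and> (\<forall>t t'. t \<notin> E \<longrightarrow> t' \<notin> E \<longrightarrow> e t t' < \<delta> \<longrightarrow> k = k)"
    by (intro exI[of _ "{}"] exI[of _ k] exI[of _ "1 :: real"]) simp
qed simp

locale selection_problem = Metric_space U \<rho> for U :: "'a set" and \<rho> +
  fixes F :: "real \<Rightarrow> 'a set" and g :: "real \<Rightarrow> 'a"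
  assumes complete: "mcomplete"
    and F: "F \<in> weyl_ap (cl_sets U \<rho>) (hausdorff_dist (trunc_dist \<rho>))"
    and g: "g \<in> weyl_ap U \<rho>"
begin

sublocale point: pseudometric U \<rho>
  by (rule pseudometric_Metric_space) (rule Metric_space_axioms)

sublocale cl: hausdorff_family U "trunc_dist \<rho>" "cl_sets U \<rho>"
  by (rule hausdorff_family_cl_sets)

sublocale setdist: pseudometric "cl_sets U \<rho>" "hausdorff_dist (trunc_dist \<rho>)"
  by (rule cl.pseudometric_hausdorff)

definition e :: "real \<Rightarrow> real \<Rightarrow> real" where
  "e t s = max (time_kernel (hausdorff_dist (trunc_dist \<rho>)) F t s) (time_kernel \<rho> g t s)"

lemma e_eq: "e = (\<lambda>t s. max (time_kernel (hausdorff_dist (trunc_dist \<rho>)) F t s) (time_kernel \<rho> g t s))"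
  by (simp add: fun_eq_iff e_def)

sublocale ker: ap_kernel e
  unfolding e_eq by (rule ap_kernel_max) (use F g setdist.weyl_ap_iff point.weyl_ap_iff in auto)

lemma g_in: "g t \<in> U"
  using g point.weyl_ap_iff by (auto simp: measurable_funs_def)

lemma F_in: "F t \<in> cl_sets U \<rho>"
  using F setdist.weyl_ap_iff by (auto simp: measurable_funs_def)

lemma F_subset: "F t \<subseteq> U" and F_nonempty: "F t \<noteq> {}"
  using cl.subset[OF F_in] cl.nonempty[OF F_in] by auto

definition gap :: "real \<Rightarrow> real" where
  "gap t = point_set_dist \<rho> (g t) (F t)"

lemma gap_nonneg: "0 \<le> gap t"
  unfolding gap_def by (rule point.point_set_dist_nonneg[OF g_in F_subset F_nonempty])

lemma near_point: "e t t' < \<delta> \<Longrightarrow> \<delta> \<le> 1 \<Longrightarrow> \<rho> (g t) (g t') < \<delta>"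
  by (simp add: e_def time_kernel_def trunc_dist_less_iff)

lemma near_set: "e t t' < \<delta> \<Longrightarrow> \<delta> \<le> 1 \<Longrightarrow> x \<in> U \<Longrightarrow> point_set_dist \<rho> x (F t') \<le> point_set_dist \<rho> x (F t) + \<delta>"
  by (rule point_set_dist_near[OF F_in F_in]) (simp_all add: e_def time_kernel_def trunc_dist_less_iff)

lemma near_set': "e t t' < \<delta> \<Longrightarrow> \<delta> \<le> 1 \<Longrightarrow> x \<in> U \<Longrightarrow> \<bar>point_set_dist \<rho> x (F t) - point_set_dist \<rho> x (F t')\<bar> \<le> \<delta>"
  using near_set[of t t' \<delta> x] near_set[of t' t \<delta> x] ker.sym[of t t'] by simp

lemma uc_point_set_dist: "x \<in> U \<Longrightarrow> kernel_uc e (\<lambda>t. point_set_dist \<rho> x (F t))"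
  by (rule kernel_ucI[of 1]) (use near_set' in auto)

lemma uc_point: "x \<in> U \<Longrightarrow> kernel_uc e (\<lambda>t. \<rho> x (g t))"
proof (rule kernel_ucI[of 1])
  fix t t' \<delta> assume x: "x \<in> U" and *: "\<delta> \<le> (1 :: real)" "e t t' < \<delta>"
  have "\<bar>\<rho> x (g t) - \<rho> x (g t')\<bar> \<le> \<rho> (g t) (g t')"
    using point.abs_diff_le[OF g_in[of t] g_in[of t'] x] commute by simp
  then show "\<bar>\<rho> x (g t) - \<rho> x (g t')\<bar> \<le> 1 * \<delta>" using near_point[OF *(2,1)] by simp
qed simp

lemma uc_gap: "kernel_uc e gap"
proof (rule kernel_ucI[of 2])
  have *: "gap t \<le> gap t' + 2 * \<delta>" if "\<delta> \<le> 1" "e t t' < \<delta>" for t t' \<delta>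
  proof -
    have "gap t \<le> \<rho> (g t) (g t') + point_set_dist \<rho> (g t') (F t)"
      unfolding gap_def by (rule point.point_set_dist_triangle[OF g_in g_in F_subset F_nonempty])
    also have "point_set_dist \<rho> (g t') (F t) \<le> gap t' + \<delta>"
      using near_set[of t' t \<delta> "g t'"] that g_in ker.sym[of t t'] unfolding gap_def by simp
    finally show ?thesis using near_point[OF that(2,1)] by simp
  qed
  show "\<bar>gap t - gap t'\<bar> \<le> 2 * \<delta>" if "0 < \<delta>" "\<delta> \<le> 1" "e t t' < \<delta>" for t t' \<delta>
    using *[of \<delta> t t'] *[of \<delta> t' t] that ker.sym[of t t'] by simp
qed simp

text \<open>A countable set that contains near-values of \<open>g\<close> and is closed under choosing almost nearest
  points in the sets \<open>F (s j)\<close>; its members are indexed by the list of choices that produce them.\<close>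

lemma choice_points:
  fixes s :: "nat \<Rightarrow> real"
  shows "\<exists>u :: nat \<Rightarrow> 'a. (\<forall>i. u i \<in> U) \<and> (\<forall>j. \<exists>i. u i = g (s j)) \<and>
    (\<forall>k j. \<forall>\<epsilon>>0. \<exists>i. u i \<in> F (s j) \<and> \<rho> (u k) (u i) < point_set_dist \<rho> (u k) (F (s j)) + \<epsilon>)"
proof -
  define sel where "sel = (\<lambda>(j, q) x. SOME y. y \<in> F (s j) \<and> \<rho> x y < point_set_dist \<rho> x (F (s j)) + 1 / real (Suc q))"
  have sel: "sel (j, q) x \<in> F (s j) \<and> \<rho> x (sel (j, q) x) < point_set_dist \<rho> x (F (s j)) + 1 / real (Suc q)"
    if "x \<in> U" for j q x
  proof -
    have "\<exists>y\<in>F (s j). \<rho> x y < point_set_dist \<rho> x (F (s j)) + 1 / real (Suc q)"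
      by (rule point.point_set_dist_lessD[OF that F_subset F_nonempty]) simp
    then have "\<exists>y. y \<in> F (s j) \<and> \<rho> x y < point_set_dist \<rho> x (F (s j)) + 1 / real (Suc q)" by blast
    from someI_ex[OF this] show ?thesis unfolding sel_def prod.case .
  qed
  define w where "w = (\<lambda>(j0 :: nat, ps :: (nat \<times> nat) list). foldr sel ps (g (s j0)))"
  have w_in: "w (j0, ps) \<in> U" for j0 ps
  proof (induction ps)
    case Nil
    then show ?case by (simp add: w_def g_in)
  next
    case (Cons p ps)
    have "sel (fst p, snd p) (w (j0, ps)) \<in> F (s (fst p))" using sel[OF Cons] by blast
    then show ?case using F_subset by (auto simp: w_def)
  qed
  define u where "u = (\<lambda>i :: nat. w (from_nat i))"
  have u_in: "u i \<in> U" for i unfolding u_def by (metis surj_pair w_in)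
  moreover have "\<exists>i. u i = g (s j)" for j
    by (rule exI[of _ "to_nat (j, [] :: (nat \<times> nat) list)"]) (simp add: u_def w_def)
  moreover have "\<exists>i. u i \<in> F (s j) \<and> \<rho> (u k) (u i) < point_set_dist \<rho> (u k) (F (s j)) + \<epsilon>" if "\<epsilon> > 0" for k j \<epsilon>
  proof -
    obtain q where q: "1 / real (Suc q) < \<epsilon>" using nat_approx_posE[OF \<open>\<epsilon> > 0\<close>] by blast
    obtain j0 ps where k: "(from_nat k :: nat \<times> (nat \<times> nat) list) = (j0, ps)" by (metis surj_pair)
    have "u (to_nat (j0, (j, q) # ps)) = sel (j, q) (u k)"
      by (simp add: u_def k w_def)
    then have "u (to_nat (j0, (j, q) # ps)) \<in> F (s j) \<and> \<rho> (u k) (u (to_nat (j0, (j, q) # ps))) < point_set_dist \<rho> (u k) (F (s j)) + \<epsilon>"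
      using sel[OF u_in[of k], of j q] q by auto
    then show ?thesis by blast
  qed
  ultimately show ?thesis by blast
qed

text \<open>Each stage moves to a point almost in \<open>F t\<close>, by little more than the
  distance from \<open>F t\<close>. After the first move these distances are below
  \<open>c n\<close>, so the later moves are summable; only the first can be long, and it exceeds
  \<open>gap t\<close> by a fraction of \<epsilon> at most.\<close>

lemma approximate_selection:
  assumes \<epsilon>: "\<epsilon> > 0"
  shows "\<exists>f. f \<in> measurable_funs U \<rho> \<and> kernel_controlled e (time_kernel \<rho> f) \<and>
    (AE t in lebesgue. f t \<in> F t) \<and> (AE t in lebesgue. \<rho> (f t) (g t) \<le> gap t + \<epsilon>)"
proof -
  obtain s :: "nat \<Rightarrow> real" where s: "AE t in lebesgue. \<forall>\<delta>>0. \<exists>j. e t (s j) < \<delta>" using ker.separable by blast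
  have s': "AE t in lebesgue. \<exists>j. e t (s j) < \<delta>" if "\<delta> > 0" for \<delta>
    using s by eventually_elim (use that in blast)
  obtain u :: "nat \<Rightarrow> 'a" where u_in: "\<And>i. u i \<in> U" and u_g: "\<And>j. \<exists>i. u i = g (s j)"
    and u_F: "\<And>k j \<epsilon>. \<epsilon> > 0 \<Longrightarrow> \<exists>i. u i \<in> F (s j) \<and> \<rho> (u k) (u i) < point_set_dist \<rho> (u k) (F (s j)) + \<epsilon>"
    using choice_points[of s] by blast
  define P where "P = (\<lambda>k t. point_set_dist \<rho> (u k) (F t))"
  \<comment> \<open>The exponent makes \<open>c 0\<close> equal to \<epsilon> / 16. The total excess
    over the gap is then at most 4 * c 0 + c 0 + 2 * (\<epsilon> / 8), which is below
    \<epsilon>.\<close>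
  define c where "c = (\<lambda>n :: nat. \<epsilon> / 2 ^ (n + 4))"
  have c: "c n > 0" for n unfolding c_def using \<epsilon> by simp
  have start: "\<exists>\<phi>. index_controlled e \<phi> \<and> (AE t in lebesgue. \<rho> (u (\<phi> t)) (g t) < \<epsilon> / 8)"
  proof -
    define \<delta> where "\<delta> = min (1 / 2) (\<epsilon> / 32)"
    have \<delta>: "\<delta> > 0" "2 * \<delta> \<le> 1" "2 * \<delta> \<le> \<epsilon> / 16" unfolding \<delta>_def using \<epsilon> by auto
    show ?thesis
    \<comment> \<open>There is no earlier stage: the previous index is the constant 0, and v does
      not depend on it.\<close>
    proof (rule ker.first_index[where v = "\<lambda>k i t. \<rho> (u i) (g t)", OF index_controlled_const[of e 0] _ _ s'[OF \<delta>(1)] \<delta>(1)])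
      show "kernel_uc e (\<lambda>t. \<rho> (u i) (g t))" for i by (rule uc_point[OF u_in])
      show "\<epsilon> / 16 < \<epsilon> / 8" using \<epsilon> by simp
      fix j
      obtain i where i: "u i = g (s j)" using u_g by blast
      have "\<rho> (u i) (g t) \<le> \<epsilon> / 16" if "e t (s j) < 2 * \<delta>" for t
        using near_point[OF that \<delta>(2)] \<delta>(3) i commute[of "g t" "u i"] by simp
      then show "\<exists>i. \<forall>t. e t (s j) < 2 * \<delta> \<longrightarrow> \<rho> (u i) (g t) \<le> \<epsilon> / 16" by blast
    qed
  qed
  have step: "\<exists>\<psi>. index_controlled e \<psi> \<and> (AE t in lebesgue. P (\<psi> t) t < a \<and> \<rho> (u (\<phi> t)) (u (\<psi> t)) < P (\<phi> t) t + a)"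
    if \<phi>: "index_controlled e \<phi>" and a: "a > 0" for \<phi> a
  proof -
    define \<delta> where "\<delta> = min (1 / 2) (a / 16)"
    have \<delta>: "\<delta> > 0" "2 * \<delta> \<le> 1" "2 * \<delta> \<le> a / 8" unfolding \<delta>_def using a by auto
    \<comment> \<open>The maximum expresses both requirements, nearness to \<open>F t\<close> and a
      short move, by a single inequality.\<close>
    define v where "v = (\<lambda>k i t. max (P i t) (\<rho> (u k) (u i) - P k t))"
    have "\<exists>\<psi>. index_controlled e \<psi> \<and> (AE t in lebesgue. v (\<phi> t) (\<psi> t) t < a)"
    proof (rule ker.first_index[OF \<phi> _ _ s'[OF \<delta>(1)] \<delta>(1)])
      show "kernel_uc e (v k i)" for k i
        unfolding v_def P_def by (intro kernel_uc_max kernel_uc_const_minus uc_point_set_dist u_in)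
      show "a / 2 < a" using a by simp
      fix k j
      have "a / 4 > 0" using a by simp
      then obtain i where i: "u i \<in> F (s j)" "\<rho> (u k) (u i) < P k (s j) + a / 4"
        using u_F unfolding P_def by blast
      have "v k i t \<le> a / 2" if t: "e t (s j) < 2 * \<delta>" for t
      proof -
        have "P i (s j) \<le> 0"
          unfolding P_def using point.point_set_dist_le[OF u_in[of i] F_subset i(1)] point.refl[OF u_in[of i]] by simp
        then have "P i t \<le> 2 * \<delta>" using near_set'[OF t \<delta>(2) u_in[of i]] unfolding P_def by linarith
        moreover have "P k (s j) \<le> P k t + 2 * \<delta>" using near_set'[OF t \<delta>(2) u_in[of k]] unfolding P_def by linarith
        ultimately show ?thesis unfolding v_def using i(2) \<delta>(3) a by (intro max.boundedI) linarith+
      qed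
      then show "\<exists>i. \<forall>t. e t (s j) < 2 * \<delta> \<longrightarrow> v k i t \<le> a / 2" by blast
    qed
    then obtain \<psi> where \<psi>: "index_controlled e \<psi>" "AE t in lebesgue. v (\<phi> t) (\<psi> t) t < a" by blast
    from \<psi>(2) have "AE t in lebesgue. P (\<psi> t) t < a \<and> \<rho> (u (\<phi> t)) (u (\<psi> t)) < P (\<phi> t) t + a"
    proof eventually_elim
      case (elim t)
      then show ?case unfolding v_def by simp
    qed
    then show ?thesis using \<psi>(1) by blast
  qed
  have "\<exists>\<phi>. \<forall>n. (index_controlled e (\<phi> n) \<and> (n = 0 \<longrightarrow> (AE t in lebesgue. \<rho> (u (\<phi> n t)) (g t) < \<epsilon> / 8))) \<and>
    (AE t in lebesgue. P (\<phi> (Suc n) t) t < c n \<and> \<rho> (u (\<phi> n t)) (u (\<phi> (Suc n) t)) < P (\<phi> n t) t + c n)"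
  proof (rule dependent_nat_choice)
    show "\<exists>\<phi>. index_controlled e \<phi> \<and> ((0 :: nat) = 0 \<longrightarrow> (AE t in lebesgue. \<rho> (u (\<phi> t)) (g t) < \<epsilon> / 8))" using start by simp
    fix \<phi> :: "real \<Rightarrow> nat" and n :: nat
    assume "index_controlled e \<phi> \<and> (n = 0 \<longrightarrow> (AE t in lebesgue. \<rho> (u (\<phi> t)) (g t) < \<epsilon> / 8))"
    then show "\<exists>\<psi>. (index_controlled e \<psi> \<and> (Suc n = 0 \<longrightarrow> (AE t in lebesgue. \<rho> (u (\<psi> t)) (g t) < \<epsilon> / 8))) \<and>
      (AE t in lebesgue. P (\<psi> t) t < c n \<and> \<rho> (u (\<phi> t)) (u (\<psi> t)) < P (\<phi> t) t + c n)"
      using step[of \<phi> "c n"] c[of n] by auto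
  qed
  then obtain \<phi> where all: "\<forall>n. (index_controlled e (\<phi> n) \<and> (n = 0 \<longrightarrow> (AE t in lebesgue. \<rho> (u (\<phi> n t)) (g t) < \<epsilon> / 8))) \<and>
    (AE t in lebesgue. P (\<phi> (Suc n) t) t < c n \<and> \<rho> (u (\<phi> n t)) (u (\<phi> (Suc n) t)) < P (\<phi> n t) t + c n)"
    by (elim exE)
  have \<phi>: "index_controlled e (\<phi> n)" for n
    using all[rule_format, of n] by (elim conjE)
  have \<phi>0: "AE t in lebesgue. \<rho> (u (\<phi> 0 t)) (g t) < \<epsilon> / 8"
    using all[rule_format, THEN conjunct1, THEN conjunct2, of 0] by (rule mp) (rule HOL.refl)
  have \<phi>S: "AE t in lebesgue. P (\<phi> (Suc n) t) t < c n \<and> \<rho> (u (\<phi> n t)) (u (\<phi> (Suc n) t)) < P (\<phi> n t) t + c n" for n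
    using all[THEN spec, of n] by (elim conjE)
  define good where "good = (\<lambda>t. \<rho> (u (\<phi> 0 t)) (g t) < \<epsilon> / 8 \<and>
    (\<forall>n. P (\<phi> (Suc n) t) t < c n \<and> \<rho> (u (\<phi> n t)) (u (\<phi> (Suc n) t)) < P (\<phi> n t) t + c n))"
  have good_ae: "AE t in lebesgue. good t"
  proof -
    have "AE t in lebesgue. \<forall>n. P (\<phi> (Suc n) t) t < c n \<and> \<rho> (u (\<phi> n t)) (u (\<phi> (Suc n) t)) < P (\<phi> n t) t + c n"
      using \<phi>S by (simp add: AE_all_countable)
    with \<phi>0 show ?thesis unfolding good_def by eventually_elim blast
  qed
  \<comment> \<open>Starts at the first stage whose points are already nearly in
    \<open>F t\<close>.\<close>
  define x where "x = (\<lambda>n t. u (\<phi> (Suc n) t))"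
  have x_in: "x n t \<in> U" for n t unfolding x_def by (rule u_in)
  have c_half: "c (Suc n) = c n / 2" for n by (simp add: c_def power_add)
  have x_step: "\<rho> (x n t) (x (Suc n) t) < 2 * c n" if "good t" for n t
  proof -
    have "P (\<phi> (Suc n) t) t < c n" "\<rho> (x n t) (x (Suc n) t) < P (\<phi> (Suc n) t) t + c (Suc n)"
      using that unfolding good_def x_def by blast+
    then show ?thesis using c_half[of n] c[of n] by linarith
  qed
  \<comment> \<open>Since 2 * c n = 4 * c n - 4 * c (Suc n), the bounds on the steps
    telescope.\<close>
  have x_dist: "\<rho> (x n t) (x (n + m) t) \<le> 4 * c n - 4 * c (n + m)" if "good t" for n m t
  proof (induction m)
    case 0
    then show ?case using point.refl[OF x_in] by simp
  next
    case (Suc m)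
    have "\<rho> (x n t) (x (n + Suc m) t) \<le> \<rho> (x n t) (x (n + m) t) + \<rho> (x (n + m) t) (x (Suc (n + m)) t)"
      using triangle[OF x_in x_in x_in] by simp
    then show ?case using Suc x_step[OF that, of "n + m"] c_half[of "n + m"] by simp
  qed
  have c_lim: "c \<longlonglongrightarrow> 0"
  proof -
    have "(\<lambda>n. (\<epsilon> / 16) * (1 / 2) ^ n) \<longlonglongrightarrow> (\<epsilon> / 16) * 0"
      by (intro tendsto_mult_left LIMSEQ_realpow_zero) auto
    then show ?thesis unfolding c_def by (simp add: power_add power_one_over divide_simps mult.commute)
  qed
  have limit: "\<exists>y\<in>U. \<forall>n. \<rho> (x n t) y \<le> 4 * c n" if "good t" for t
  proof -
    have "MCauchy (\<lambda>n. x n t)"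
      unfolding MCauchy_def
    proof (intro conjI allI impI)
      show "range (\<lambda>n. x n t) \<subseteq> U" using x_in by auto
      fix r :: real assume r: "r > 0"
      then have "r / 4 > 0" by simp
      from order_tendstoD(2)[OF c_lim this] obtain N where N: "\<And>n. n \<ge> N \<Longrightarrow> c n < r / 4"
        unfolding eventually_sequentially by blast
      have *: "\<rho> (x n t) (x n' t) < r" if "N \<le> n" "n \<le> n'" for n n'
        using x_dist[OF \<open>good t\<close>, of n "n' - n"] N[OF that(1)] c[of n'] that by simp
      have "\<rho> (x n t) (x n' t) < r" if "N \<le> n" "N \<le> n'" for n n'
        using *[of n n'] *[of n' n] that commute[of "x n t" "x n' t"] by (cases "n \<le> n'") auto
      then show "\<exists>N. \<forall>n n'. N \<le> n \<longrightarrow> N \<le> n' \<longrightarrow> \<rho> (x n t) (x n' t) < r" by blast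
    qed
    then obtain y where y: "limitin mtopology (\<lambda>n. x n t) y sequentially"
      using complete unfolding mcomplete_def by blast
    have yU: "y \<in> U" using y limitin_mspace by blast
    have "\<rho> (x n t) y \<le> 4 * c n" for n
    proof (rule field_le_epsilon)
      fix r :: real assume "r > 0"
      then have "eventually (\<lambda>m. x m t \<in> U \<and> \<rho> (x m t) y < r) sequentially"
        using y unfolding limitin_metric by blast
      then obtain N where N: "\<And>m. m \<ge> N \<Longrightarrow> \<rho> (x m t) y < r" unfolding eventually_sequentially by blast
      have "\<rho> (x n t) y \<le> \<rho> (x n t) (x (n + N) t) + \<rho> (x (n + N) t) y" by (rule triangle[OF x_in x_in yU])
      then show "\<rho> (x n t) y \<le> 4 * c n + r"
        using x_dist[OF that, of n N] N[of "n + N"] c[of "n + N"] by simp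
    qed
    then show ?thesis using yU by blast
  qed
  \<comment> \<open>On the null set where \<open>good\<close> fails, any point of U will do.\<close>
  define f where "f = (\<lambda>t. if good t then SOME y. y \<in> U \<and> (\<forall>n. \<rho> (x n t) y \<le> 4 * c n) else g t)"
  have f_good: "f t \<in> U \<and> (\<forall>n. \<rho> (x n t) (f t) \<le> 4 * c n)" if "good t" for t
  proof -
    have "\<exists>y. y \<in> U \<and> (\<forall>n. \<rho> (x n t) y \<le> 4 * c n)" using limit[OF that] by blast
    from someI_ex[OF this] show ?thesis unfolding f_def if_P[OF that] .
  qed
  have f_in: "f t \<in> U" for t
    using f_good[of t] g_in[of t] by (cases "good t") (auto simp: f_def)
  have tail_le: "\<exists>n. 4 * c n < r" if "r > 0" for r
  proof -
    have "r / 4 > 0" using that by simp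
    from order_tendstoD(2)[OF c_lim this] obtain N where "c N < r / 4" unfolding eventually_sequentially by blast
    then show ?thesis by (intro exI[of _ N]) simp
  qed
  have \<phi>_meas: "\<phi> n \<in> measurable lebesgue (count_space UNIV)" for n using \<phi> by (simp add: index_controlled_def)
  have meas: "f \<in> measurable_funs U \<rho>"
  proof (rule point.measurable_funs_if_approx[OF f_in])
    fix r :: real assume "r > 0"
    then obtain n where n: "4 * c n < r" using tail_le by blast
    have "AE t in lebesgue. \<rho> (f t) (u (\<phi> (Suc n) t)) < r"
      using good_ae
    proof eventually_elim
      case (elim t)
      have "\<rho> (x n t) (f t) \<le> 4 * c n" using f_good[OF elim] by blast
      then show ?case using n commute[of "f t"] unfolding x_def by simp
    qed
    then show "\<exists>(x :: nat \<Rightarrow> 'a) J. (\<forall>j. x j \<in> U) \<and> J \<in> measurable lebesgue (count_space UNIV) \<and>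
      (AE t in lebesgue. \<rho> (f t) (x (J t)) < r)" using u_in \<phi>_meas[of "Suc n"] by blast
  qed
  \<comment> \<open>Where the indices of stage n + 1 at t and t' agree, f t and f t' lie within 4 *
    c n of the same point.\<close>
  have ctrl: "kernel_controlled e (time_kernel \<rho> f)"
    unfolding kernel_controlled_def
  proof (intro allI impI)
    fix r :: real assume r: "r > 0"
    then have "r / 2 > 0" by simp
    then obtain n where n: "4 * c n < r / 2" using tail_le by blast
    obtain E I \<delta> where E: "small E r" "\<delta> > 0" "\<And>t t'. t \<notin> E \<Longrightarrow> t' \<notin> E \<Longrightarrow> e t t' < \<delta> \<Longrightarrow> \<phi> (Suc n) t = \<phi> (Suc n) t'"
      using \<phi>[of "Suc n"] r unfolding index_controlled_def by blast
    obtain N where N: "N \<in> null_sets lebesgue" "{t. \<not> good t} \<subseteq> N"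
      using good_ae by (auto simp: eventually_ae_filter)
    have "small (E \<union> N) (r + 0)" by (rule small_Un[OF E(1) small_null[OF N(1)]])
    then have small: "small (E \<union> N) r" by simp
    have "time_kernel \<rho> f t t' < r" if "t \<notin> E \<union> N" "t' \<notin> E \<union> N" "e t t' < \<delta>" for t t'
    proof -
      have "good t" "good t'" using N(2) that by auto
      then have "\<rho> (x n t) (f t) \<le> 4 * c n" "\<rho> (x n t') (f t') \<le> 4 * c n" using f_good by auto
      moreover have "x n t = x n t'" unfolding x_def using E(3)[of t t'] that by simp
      ultimately have "\<rho> (f t) (f t') < r"
        using triangle[OF f_in[of t] x_in[of n t] f_in[of t']] commute[of "f t" "x n t"] n by simp
      then show ?thesis by (simp add: time_kernel_def trunc_dist_def)
    qed
    then show "\<exists>E \<delta>. small E r \<and> \<delta> > 0 \<and> (\<forall>t t'. t \<notin> E \<longrightarrow> t' \<notin> E \<longrightarrow> e t t' < \<delta> \<longrightarrow> time_kernel \<rho> f t t' < r)"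
      using small E(2) by blast
  qed
  have "AE t in lebesgue. f t \<in> F t"
    using good_ae
  proof eventually_elim
    case (elim t)
    have "point_set_dist \<rho> (f t) (F t) \<le> 0"
    proof (rule field_le_epsilon)
      fix r :: real assume r: "r > 0"
      then have "r / 2 > 0" by simp
      then obtain n where n: "4 * c n < r / 2" using tail_le by blast
      have "point_set_dist \<rho> (f t) (F t) \<le> \<rho> (f t) (x n t) + point_set_dist \<rho> (x n t) (F t)"
        by (rule point.point_set_dist_triangle[OF f_in x_in F_subset F_nonempty])
      moreover have "\<rho> (x n t) (f t) \<le> 4 * c n" using f_good[OF elim] by blast
      moreover have "point_set_dist \<rho> (x n t) (F t) < c n" using elim unfolding good_def x_def P_def by blast
      ultimately show "point_set_dist \<rho> (f t) (F t) \<le> 0 + r" using n c[of n] commute[of "f t" "x n t"] by simp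
    qed
    then show ?case by (rule point_set_dist_zero_iff[OF F_in f_in])
  qed
  moreover have "AE t in lebesgue. \<rho> (f t) (g t) \<le> gap t + \<epsilon>"
    using good_ae
  proof eventually_elim
    case (elim t)
    have 1: "\<rho> (u (\<phi> 0 t)) (g t) < \<epsilon> / 8" using elim unfolding good_def by blast
    have 2: "\<rho> (u (\<phi> 0 t)) (x 0 t) < P (\<phi> 0 t) t + c 0" using elim unfolding good_def x_def by simp
    have 3: "P (\<phi> 0 t) t \<le> \<rho> (u (\<phi> 0 t)) (g t) + gap t"
      unfolding P_def gap_def by (rule point.point_set_dist_triangle[OF u_in g_in F_subset F_nonempty])
    have 4: "\<rho> (x 0 t) (f t) \<le> 4 * c 0" using f_good[OF elim] by blast
    have 5: "\<rho> (f t) (g t) \<le> \<rho> (f t) (x 0 t) + (\<rho> (x 0 t) (u (\<phi> 0 t)) + \<rho> (u (\<phi> 0 t)) (g t))"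
      using triangle[OF f_in[of t] x_in[of 0 t] g_in[of t]] triangle[OF x_in[of 0 t] u_in[of "\<phi> 0 t"] g_in[of t]] by linarith
    have "c 0 = \<epsilon> / 16" by (simp add: c_def)
    then show ?case using 1 2 3 4 5 commute[of "f t" "x 0 t"] commute[of "x 0 t" "u (\<phi> 0 t)"] \<epsilon> by simp
  qed
  ultimately show ?thesis using meas ctrl by (intro exI[of _ f] conjI)
qed


text \<open>Approximate selections with finer and finer error are used where \<open>gap\<close> is closer and closer to \<open>0\<close>;
  since they are then close to \<open>g\<close>, almost periodicity survives at \<open>gap t = 0\<close>, where the
  selection is \<open>g\<close> itself.\<close>

lemma selection:
  assumes \<eta>: "\<eta> \<in> gauge_funs"
  shows "\<exists>f. f \<in> measurable_funs U \<rho> \<and> kernel_controlled e (time_kernel \<rho> f) \<and>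
    (AE t in lebesgue. f t \<in> F t) \<and> (AE t in lebesgue. \<rho> (f t) (g t) \<le> gap t + \<eta> (gap t))"
proof -
  have gap_meas [measurable]: "gap \<in> borel_measurable lebesgue" by (rule ker.uc_measurable[OF uc_gap])
  have \<eta>0: "\<eta> 0 = 0" and \<eta>_pos: "\<And>t. t > 0 \<Longrightarrow> \<eta> t > 0" and \<eta>_mono: "\<And>a b. 0 \<le> a \<Longrightarrow> a \<le> b \<Longrightarrow> \<eta> a \<le> \<eta> b"
    using \<eta> by (auto simp: gauge_funs_def mono_on_def)
  \<comment> \<open>The thresholds between layers are good radii for \<open>gap\<close>, so that
    times near a change of layer have small density.\<close>
  have "\<forall>k. \<exists>r. (1 / 2) ^ Suc k < r \<and> r < (1 / 2) ^ k \<and> (\<forall>\<epsilon>>0. \<exists>\<delta>>0. small {t. \<bar>gap t - r\<bar> < \<delta>} \<epsilon>)"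
    by (intro allI ker.good_radius[OF uc_gap]) simp
  then obtain \<theta> :: "nat \<Rightarrow> real" where \<theta>: "\<And>k. (1 / 2) ^ Suc k < \<theta> k" "\<And>k. \<theta> k < (1 / 2) ^ k"
    and \<theta>_good: "\<And>k \<epsilon>. \<epsilon> > 0 \<Longrightarrow> \<exists>\<delta>>0. small {t. \<bar>gap t - \<theta> k\<bar> < \<delta>} \<epsilon>"
    by metis
  have \<theta>_pos: "\<theta> k > 0" for k using \<theta>(1)[of k] zero_less_power[of "1 / 2 :: real" "Suc k"] by linarith
  have \<theta>_small: "\<exists>k. \<theta> k < r" if "r > 0" for r
  proof -
    obtain k where "(1 / 2 :: real) ^ k < r" using real_arch_pow_inv[OF \<open>r > 0\<close>, of "1 / 2"] by auto
    then show ?thesis using \<theta>(2)[of k] by (intro exI[of _ k]) linarith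
  qed
  \<comment> \<open>The entry \<open>\<eta> (\<theta> k)\<close> gives the required estimate, since
    \<eta> is monotone and \<theta> k \<le> gap t on layer k; only values of \<eta> at thresholds
    enter, as \<eta> may be discontinuous. The entry \<open>\<theta> k\<close> forces f towards g as
    the gap tends to 0.\<close>
  define \<epsilon> where "\<epsilon> = (\<lambda>k. min (\<eta> (\<theta> k)) (\<theta> k))"
  have \<epsilon>_pos: "\<epsilon> k > 0" for k unfolding \<epsilon>_def using \<theta>_pos[of k] \<eta>_pos[of "\<theta> k"] by simp
  have "\<forall>k. \<exists>f. f \<in> measurable_funs U \<rho> \<and> kernel_controlled e (time_kernel \<rho> f) \<and>
    (AE t in lebesgue. f t \<in> F t) \<and> (AE t in lebesgue. \<rho> (f t) (g t) \<le> gap t + \<epsilon> k)"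
    using approximate_selection[OF \<epsilon>_pos] by blast
  from choice[OF this] obtain h where h_all: "\<forall>k. h k \<in> measurable_funs U \<rho> \<and> kernel_controlled e (time_kernel \<rho> (h k)) \<and>
    (AE t in lebesgue. h k t \<in> F t) \<and> (AE t in lebesgue. \<rho> (h k t) (g t) \<le> gap t + \<epsilon> k)"
    by (elim exE)
  note h = h_all[THEN spec, THEN conjunct1] h_all[THEN spec, THEN conjunct2, THEN conjunct1]
    h_all[THEN spec, THEN conjunct2, THEN conjunct2, THEN conjunct1]
    h_all[THEN spec, THEN conjunct2, THEN conjunct2, THEN conjunct2]
  define layer where "layer = (\<lambda>t. LEAST k. \<theta> k \<le> gap t)"
  \<comment> \<open>Index 0 is reserved for times of gap 0, which lie in no layer because all
    thresholds are positive.\<close>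
  define \<kappa> where "\<kappa> = (\<lambda>t. if gap t \<le> 0 then 0 else Suc (layer t))"
  define H where "H = (\<lambda>k. case k of 0 \<Rightarrow> g | Suc k \<Rightarrow> h k)"
  define f where "f = (\<lambda>t. H (\<kappa> t) t)"
  have f_zero: "f t = g t" if "gap t \<le> 0" for t using that by (simp add: f_def \<kappa>_def H_def)
  have f_pos: "f t = h (layer t) t" if "gap t > 0" for t using that by (simp add: f_def \<kappa>_def H_def)
  have layer: "\<theta> (layer t) \<le> gap t" if "gap t > 0" for t
  proof -
    obtain k where "\<theta> k < gap t" using \<theta>_small[OF \<open>gap t > 0\<close>] by blast
    then have "\<theta> k \<le> gap t" by simp
    then show ?thesis unfolding layer_def by (rule LeastI)
  qed
  have layer_meas: "layer \<in> measurable lebesgue (count_space UNIV)" unfolding layer_def by measurable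
  have \<kappa>_meas: "\<kappa> \<in> measurable lebesgue (count_space UNIV)"
    unfolding \<kappa>_def
  proof (rule measurable_If)
    show "(\<lambda>t. Suc (layer t)) \<in> measurable lebesgue (count_space UNIV)"
      by (rule measurable_compose[OF layer_meas]) simp
    show "{t \<in> space lebesgue. gap t \<le> 0} \<in> sets lebesgue" by measurable
  qed simp
  have H_meas: "H k \<in> measurable_funs U \<rho>" for k
    unfolding H_def using h(1) g point.weyl_ap_iff by (cases k) auto
  have meas: "f \<in> measurable_funs U \<rho>"
    unfolding f_def by (rule point.measurable_funs_glue[OF H_meas \<kappa>_meas])
  have f_in: "f t \<in> U" for t using meas by (auto simp: measurable_funs_def)
  define good where "good = (\<lambda>t. \<forall>k. h k t \<in> F t \<and> \<rho> (h k t) (g t) \<le> gap t + \<epsilon> k)"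
  have good_ae: "AE t in lebesgue. good t"
  proof -
    have "AE t in lebesgue. \<forall>k. h k t \<in> F t" "AE t in lebesgue. \<forall>k. \<rho> (h k t) (g t) \<le> gap t + \<epsilon> k"
      using h(3,4) by (simp_all add: AE_all_countable)
    then show ?thesis unfolding good_def by eventually_elim blast
  qed
  have f_near: "\<rho> (f t) (g t) \<le> gap t + \<epsilon> (layer t)" if "good t" "gap t > 0" for t
    using that f_pos[OF that(2)] unfolding good_def by simp
  have "AE t in lebesgue. f t \<in> F t"
    using good_ae
  proof eventually_elim
    case (elim t)
    show ?case
    proof (cases "gap t \<le> 0")
      case True
      then show ?thesis using f_zero point_set_dist_zero_iff[OF F_in g_in] unfolding gap_def by simp
    next
      case False
      then show ?thesis using f_pos[of t] elim unfolding good_def by simp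
    qed
  qed
  moreover have "AE t in lebesgue. \<rho> (f t) (g t) \<le> gap t + \<eta> (gap t)"
    using good_ae
  proof eventually_elim
    case (elim t)
    show ?case
    proof (cases "gap t \<le> 0")
      case True
      then have "gap t = 0" using gap_nonneg[of t] by simp
      then show ?thesis using f_zero[OF True] \<eta>0 point.refl[OF g_in] by simp
    next
      case False
      then have pos: "gap t > 0" by simp
      have "\<epsilon> (layer t) \<le> \<eta> (\<theta> (layer t))" by (simp add: \<epsilon>_def)
      also have "\<dots> \<le> \<eta> (gap t)" by (rule \<eta>_mono[OF less_imp_le[OF \<theta>_pos] layer[OF pos]])
      finally show ?thesis using f_near[OF elim pos] by simp
    qed
  qed
  moreover have "kernel_controlled e (time_kernel \<rho> f)"
    unfolding kernel_controlled_def
  proof (intro allI impI)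
    fix r :: real assume r: "r > 0"
    then have "r / 8 > 0" by simp
    then obtain K where K: "\<theta> K < r / 8" using \<theta>_small by blast
    \<comment> \<open>Two exceptional sets for each of the layers 0 to K share the density
      r.\<close>
    define r' where "r' = r / (2 * real (Suc K))"
    have r': "r' > 0" "real (Suc K) * r' = r / 2"
      unfolding r'_def using r by (simp_all add: divide_simps del: of_nat_Suc)
    have r'_le: "r' \<le> r"
    proof -
      have "1 * r' \<le> real (Suc K) * r'" using r'(1) by (intro mult_right_mono) auto
      then show ?thesis using r'(2) r by simp
    qed
    have "\<forall>k. \<exists>E \<delta>. small E r' \<and> \<delta> > 0 \<and> (\<forall>t t'. t \<notin> E \<longrightarrow> t' \<notin> E \<longrightarrow> e t t' < \<delta> \<longrightarrow> time_kernel \<rho> (h k) t t' < r')"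
      using h(2) r'(1) unfolding kernel_controlled_def by blast
    then obtain E \<delta> where E: "\<And>k. small (E k) r'" and \<delta>: "\<And>k. \<delta> k > 0"
      and h_near: "\<And>k t t'. t \<notin> E k \<Longrightarrow> t' \<notin> E k \<Longrightarrow> e t t' < \<delta> k \<Longrightarrow> time_kernel \<rho> (h k) t t' < r'"
      by metis
    have "\<exists>d>0. \<forall>k\<in>{..K}. d \<le> \<delta> k"
      by (rule finite_common_bound) (use \<delta> in auto)
    then obtain d1 where d1: "d1 > 0" "\<And>k. k \<le> K \<Longrightarrow> d1 \<le> \<delta> k" by auto
    have "\<exists>d>0. \<forall>k\<in>{..K}. small {t. \<bar>gap t - \<theta> k\<bar> < d} r'"
    proof (rule finite_common_bound)
      show "\<exists>d>0. small {t. \<bar>gap t - \<theta> k\<bar> < d} r'" for k by (rule \<theta>_good[OF r'(1)])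
      show "small {t. \<bar>gap t - \<theta> k\<bar> < d'} r'" if "small {t. \<bar>gap t - \<theta> k\<bar> < d} r'" "0 < d'" "d' \<le> d" for k d d'
        by (rule small_mono[OF that(1)]) (use that ker.level_sets[OF gap_meas] in auto)
    qed simp
    then obtain d2 where d2: "d2 > 0" "\<And>k. k \<le> K \<Longrightarrow> small {t. \<bar>gap t - \<theta> k\<bar> < d2} r'" by auto
    obtain d3 where d3: "d3 > 0" "\<And>t t'. e t t' < d3 \<Longrightarrow> \<bar>gap t - gap t'\<bar> < d2"
      using uc_gap d2(1) unfolding kernel_uc_def by blast
    define d where "d = min (min d1 d3) (min 1 (r / 4))"
    have d: "d > 0" "d \<le> d1" "d \<le> d3" "d \<le> 1" "d \<le> r / 4" unfolding d_def using d1 d3 r by auto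
    obtain N where N: "N \<in> null_sets lebesgue" "{t. \<not> good t} \<subseteq> N"
      using good_ae by (auto simp: eventually_ae_filter)
    define E' where "E' = (\<Union>k\<in>{..K}. E k) \<union> (\<Union>k\<in>{..K}. {t. \<bar>gap t - \<theta> k\<bar> < d2}) \<union> N"
    have "small E' ((\<Sum>k\<in>{..K}. r') + (\<Sum>k\<in>{..K}. r') + 0)"
      unfolding E'_def by (intro small_Un small_UN small_null N E d2(2)) auto
    moreover have "(\<Sum>k\<in>{..K}. r') + (\<Sum>k\<in>{..K}. r') + 0 = r" using r'(2) by (simp add: algebra_simps)
    ultimately have E': "small E' r" by (simp only:)
    \<comment> \<open>Below the last threshold f is within twice the gap of g, so all deeper layers
      are compared through g and not with one another.\<close>
    have bottom: "\<rho> (f t) (g t) \<le> 2 * (r / 8)" if "t \<notin> E'" "gap t < \<theta> K" for t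
    proof (cases "gap t \<le> 0")
      case True
      then show ?thesis using f_zero[OF True] point.refl[OF g_in] r by simp
    next
      case False
      then have pos: "gap t > 0" by simp
      have "good t" using that(1) N(2) unfolding E'_def by blast
      then have "\<rho> (f t) (g t) \<le> gap t + \<epsilon> (layer t)" using pos by (rule f_near)
      also have "\<epsilon> (layer t) \<le> \<theta> (layer t)" by (simp add: \<epsilon>_def)
      also have "\<dots> \<le> gap t" by (rule layer[OF pos])
      finally show ?thesis using that(2) K by simp
    qed
    have "time_kernel \<rho> f t t' < r" if t: "t \<notin> E'" "t' \<notin> E'" "e t t' < d" for t t'
    proof -
      \<comment> \<open>Both gaps avoid the shells of radius d2 and differ by less than d2, so no
        threshold up to K separates them.\<close>
      have same: "\<theta> k \<le> gap t \<longleftrightarrow> \<theta> k \<le> gap t'" if k: "k \<le> K" for k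
      proof -
        have "\<bar>gap t - gap t'\<bar> < d2" using d3(2)[of t t'] t(3) d(3) by simp
        moreover have "\<not> \<bar>gap t - \<theta> k\<bar> < d2" "\<not> \<bar>gap t' - \<theta> k\<bar> < d2" using t(1,2) k unfolding E'_def by auto
        ultimately show ?thesis by linarith
      qed
      show ?thesis
      proof (cases "\<theta> K \<le> gap t")
        case True
        then have True': "\<theta> K \<le> gap t'" using same[of K] by simp
        have le: "layer t \<le> K" "layer t' \<le> K" unfolding layer_def using True True' by (auto intro: Least_le)
        have pos: "gap t > 0" "gap t' > 0" using True True' \<theta>_pos[of K] by linarith+
        have "layer t = layer t'"
        proof (rule antisym)
          have "\<theta> (layer t') \<le> gap t" using layer[OF pos(2)] same[OF le(2)] by simp
          then show "layer t \<le> layer t'" unfolding layer_def by (rule Least_le)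
          have "\<theta> (layer t) \<le> gap t'" using layer[OF pos(1)] same[OF le(1)] by simp
          then show "layer t' \<le> layer t" unfolding layer_def by (rule Least_le)
        qed
        then have "time_kernel \<rho> f t t' = time_kernel \<rho> (h (layer t)) t t'"
          unfolding time_kernel_def using f_pos[OF pos(1)] f_pos[OF pos(2)] by simp
        also have "\<dots> < r'"
          by (rule h_near) (use t le d(2) d1(2)[OF le(1)] in \<open>auto simp: E'_def\<close>)
        finally show ?thesis using r'_le by simp
      next
        case False
        then have *: "gap t < \<theta> K" "gap t' < \<theta> K" using same[of K] by auto
        have "\<rho> (f t) (f t') \<le> \<rho> (f t) (g t) + (\<rho> (g t) (g t') + \<rho> (g t') (f t'))"
          using triangle[OF f_in[of t] g_in[of t] f_in[of t']] triangle[OF g_in[of t] g_in[of t'] f_in[of t']] by linarith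
        moreover have "\<rho> (g t) (g t') < r / 4" using near_point[OF t(3) d(4)] d(5) by simp
        ultimately have "\<rho> (f t) (f t') < r"
          using bottom[OF t(1) *(1)] bottom[OF t(2) *(2)] commute[of "g t'" "f t'"] r by linarith
        then show ?thesis by (simp add: time_kernel_def trunc_dist_def)
      qed
    qed
    then show "\<exists>E \<delta>. small E r \<and> \<delta> > 0 \<and> (\<forall>t t'. t \<notin> E \<longrightarrow> t' \<notin> E \<longrightarrow> e t t' < \<delta> \<longrightarrow> time_kernel \<rho> f t t' < r)"
      using E' d(1) by blast
  qed
  ultimately show ?thesis using meas by (intro exI[of _ f] conjI)
qed

end

section \<open>The spaces of degree p\<close>

text \<open>Extended values spare integrability conditions in the estimates; only the comparison
  with \<open>weyl_dist_p\<close> returns to real integrals.\<close>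

definition nn_window :: "(real \<Rightarrow> ennreal) \<Rightarrow> real \<Rightarrow> real \<Rightarrow> ennreal" where
  "nn_window u a l = (\<integral>\<^sup>+t\<in>{a..a + l}. u t \<partial>lebesgue)"

lemma mult_indicator_Icc_measurable:
  fixes u :: "real \<Rightarrow> ennreal"
  assumes "u \<in> borel_measurable lebesgue"
  shows "(\<lambda>t. u t * indicator {a..b} t) \<in> borel_measurable lebesgue"
  by (rule borel_measurable_times_ennreal[OF assms borel_measurable_indicator]) auto

lemma scaleR_indicator_Icc_measurable:
  fixes v :: "real \<Rightarrow> real"
  assumes "v \<in> borel_measurable lebesgue"
  shows "(\<lambda>t. indicator {a..b} t *\<^sub>R v t) \<in> borel_measurable lebesgue"
  by (rule borel_measurable_scaleR[OF borel_measurable_indicator assms]) auto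

lemma nn_window_mono_AE: "AE t in lebesgue. u t \<le> v t \<Longrightarrow> nn_window u a l \<le> nn_window v a l"
  unfolding nn_window_def by (rule nn_integral_mono_AE) (auto elim!: eventually_mono intro: mult_right_mono)

lemma nn_window_add:
  assumes "u \<in> borel_measurable lebesgue" "v \<in> borel_measurable lebesgue"
  shows "nn_window (\<lambda>t. u t + v t) a l = nn_window u a l + nn_window v a l"
  unfolding nn_window_def distrib_right by (intro nn_integral_add mult_indicator_Icc_measurable assms)

lemma nn_window_cmult:
  assumes "u \<in> borel_measurable lebesgue"
  shows "nn_window (\<lambda>t. c * u t) a l = c * nn_window u a l"
  unfolding nn_window_def mult.assoc by (intro nn_integral_cmult mult_indicator_Icc_measurable assms)

lemma nn_window_const: "0 \<le> l \<Longrightarrow> nn_window (\<lambda>t. c) a l = c * ennreal l"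
  unfolding nn_window_def by (simp add: nn_integral_cmult_indicator)

lemma nn_window_indicator:
  assumes E: "E \<in> sets lebesgue"
  shows "nn_window (indicator E) a l = ennreal (window E a l)"
proof -
  have "nn_window (indicator E) a l = (\<integral>\<^sup>+t. indicator (E \<inter> {a..a + l}) t \<partial>lebesgue)"
    unfolding nn_window_def by (rule nn_integral_cong) (simp add: indicator_inter_arith)
  also have "\<dots> = emeasure lebesgue (E \<inter> {a..a + l})"
    using lmeasurable_Int_Icc[OF E] by (intro nn_integral_indicator) (rule fmeasurableD)
  also have "\<dots> = ennreal (window E a l)"
    unfolding window_def using lmeasurable_Int_Icc[OF E] by (rule emeasure_eq_measure2)
  finally show ?thesis .
qed

lemma nn_window_shift:
  assumes u: "u \<in> borel_measurable lebesgue"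
  shows "nn_window (\<lambda>t. u (t + \<tau>)) a l = nn_window u (a + \<tau>) l"
proof -
  have "(\<lambda>t. u t * indicator {a + \<tau>..a + \<tau> + l} t) \<in> borel_measurable lebesgue" by (rule mult_indicator_Icc_measurable[OF u])
  from nn_integral_real_affine_lebesgue[OF this, of 1 \<tau>]
  have "nn_window u (a + \<tau>) l = (\<integral>\<^sup>+t. u (\<tau> + t) * indicator {a + \<tau>..a + \<tau> + l} (\<tau> + t) \<partial>lebesgue)"
    by (simp add: nn_window_def)
  also have "\<dots> = nn_window (\<lambda>t. u (t + \<tau>)) a l"
    unfolding nn_window_def by (rule nn_integral_cong) (auto simp: indicator_def add.commute)
  finally show ?thesis by simp
qed

lemma nn_window_interval_mono: "b \<le> a \<Longrightarrow> a + l \<le> b + m \<Longrightarrow> nn_window u a l \<le> nn_window u b m"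
  unfolding nn_window_def by (rule nn_integral_mono) (auto simp: indicator_def)

lemma nn_window_scale:
  assumes u: "u \<in> borel_measurable lebesgue" and l: "0 < l" and c: "0 \<le> c"
    and le: "\<And>\<xi>. nn_window u \<xi> l \<le> ennreal (c * l)" and l': "l \<le> l'"
  shows "nn_window u \<xi> l' \<le> ennreal (2 * c * l')"
proof -
  have n: "nn_window u \<xi> (real n * l) \<le> ennreal (real n * (c * l))" for n \<xi>
  proof (induction n)
    case 0
    have "AE t in lebesgue. t \<noteq> \<xi>" by (rule AE_I'[of "{\<xi>}"]) (auto intro: null_sets_completionI)
    then have "AE t in lebesgue. u t * indicator {\<xi>..\<xi> + real 0 * l} t = 0"
      by eventually_elim (auto simp: indicator_def)
    then have "nn_window u \<xi> (real 0 * l) = 0"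
      unfolding nn_window_def by (subst nn_integral_0_iff_AE[OF mult_indicator_Icc_measurable[OF u]])
    then show ?case by simp
  next
    case (Suc n)
    have "nn_window u \<xi> (real (Suc n) * l) \<le> (\<integral>\<^sup>+t. u t * indicator {\<xi>..\<xi> + real n * l} t
        + u t * indicator {\<xi> + real n * l..\<xi> + real n * l + l} t \<partial>lebesgue)"
      unfolding nn_window_def by (rule nn_integral_mono) (auto simp: indicator_def algebra_simps)
    also have "\<dots> = nn_window u \<xi> (real n * l) + nn_window u (\<xi> + real n * l) l"
      unfolding nn_window_def by (intro nn_integral_add mult_indicator_Icc_measurable u)
    also have "\<dots> \<le> ennreal (real n * (c * l)) + ennreal (c * l)" by (intro add_mono Suc le)
    also have "\<dots> = ennreal (real (Suc n) * (c * l))"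
      using c l by (simp add: ennreal_plus[symmetric] algebra_simps del: ennreal_plus)
    finally show ?case .
  qed
  define n where "n = nat \<lceil>l' / l\<rceil>"
  have "l' / l \<le> real n" unfolding n_def by (rule real_nat_ceiling_ge)
  then have "nn_window u \<xi> l' \<le> nn_window u \<xi> (real n * l)"
    using l by (intro nn_window_interval_mono) (auto simp: field_simps)
  also have "\<dots> \<le> ennreal (real n * (c * l))" by (rule n)
  also have "\<dots> \<le> ennreal (2 * c * l')"
  proof (rule ennreal_leI)
    have "1 \<le> l' / l" using l l' by simp
    then have "real n \<le> 2 * (l' / l)" unfolding n_def by linarith
    then have "real n * (c * l) \<le> 2 * (l' / l) * (c * l)" using c l by (intro mult_right_mono) auto
    also have "\<dots> = 2 * c * l'" using l by simp
    finally show "real n * (c * l) \<le> 2 * c * l'" .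
  qed
  finally show ?thesis .
qed

text \<open>The set integral below is a Bochner integral, which is \<open>0\<close> on non-integrable functions; the bound
  on \<open>nn_window\<close> excludes this case and makes the supremum a genuine one.\<close>

lemma nn_window_le_if_SUP_less:
  fixes v :: "real \<Rightarrow> real"
  assumes v: "v \<in> borel_measurable lebesgue" "\<And>t. 0 \<le> v t" and p: "p > 0" and l: "l > 0" and \<eta>: "\<eta> > 0"
    and fin: "\<And>\<xi>. nn_window (\<lambda>t. ennreal (v t)) \<xi> l \<le> ennreal K"
    and less: "(SUP \<xi>. (1 / l) * (LINT t:{\<xi>..\<xi> + l}|lebesgue. v t)) powr (1 / p) < \<eta> powr (1 / p)"
  shows "nn_window (\<lambda>t. ennreal (v t)) \<xi> l \<le> ennreal (\<eta> * l)"
proof -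
  have eq: "nn_window (\<lambda>t. ennreal (v t)) \<xi> l = ennreal (LINT t:{\<xi>..\<xi> + l}|lebesgue. v t)" for \<xi>
  proof -
    have 1: "nn_window (\<lambda>t. ennreal (v t)) \<xi> l = (\<integral>\<^sup>+t. ennreal (indicator {\<xi>..\<xi> + l} t *\<^sub>R v t) \<partial>lebesgue)"
      unfolding nn_window_def by (rule nn_integral_cong) (auto simp: indicator_def)
    have meas: "(\<lambda>t. indicator {\<xi>..\<xi> + l} t *\<^sub>R v t) \<in> borel_measurable lebesgue" by (rule scaleR_indicator_Icc_measurable[OF v(1)])
    have nn: "AE t in lebesgue. 0 \<le> indicator {\<xi>..\<xi> + l} t *\<^sub>R v t" using v(2) by (intro AE_I2) (simp add: indicator_def)
    have "(\<integral>\<^sup>+t. ennreal (indicator {\<xi>..\<xi> + l} t *\<^sub>R v t) \<partial>lebesgue) < \<infinity>"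
      using fin[of \<xi>] unfolding 1 by (rule order_le_less_trans) simp
    then have "integrable lebesgue (\<lambda>t. indicator {\<xi>..\<xi> + l} t *\<^sub>R v t)"
      by (rule integrableI_nonneg[OF meas nn])
    then show ?thesis
      unfolding 1 set_lebesgue_integral_def by (rule nn_integral_eq_integral[OF _ nn])
  qed
  have nonneg: "0 \<le> (LINT t:{\<xi>..\<xi> + l}|lebesgue. v t)" for \<xi>
    unfolding set_lebesgue_integral_def using v(2) by (intro Bochner_Integration.integral_nonneg) (simp add: indicator_def)
  have bdd: "bdd_above (range (\<lambda>\<xi>. (1 / l) * (LINT t:{\<xi>..\<xi> + l}|lebesgue. v t)))"
  proof (rule bdd_aboveI2)
    fix \<xi>
    have "ennreal (LINT t:{\<xi>..\<xi> + l}|lebesgue. v t) \<le> ennreal (max 0 K)"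
      using fin[of \<xi>] unfolding eq by (rule order_trans) (rule ennreal_leI, simp)
    then have "(LINT t:{\<xi>..\<xi> + l}|lebesgue. v t) \<le> max 0 K" by (simp only: ennreal_le_iff[of "max 0 K"] max.cobounded1)
    then show "(1 / l) * (LINT t:{\<xi>..\<xi> + l}|lebesgue. v t) \<le> (1 / l) * max 0 K"
      using l by (intro mult_left_mono) auto
  qed
  define s where "s = (SUP \<xi>. (1 / l) * (LINT t:{\<xi>..\<xi> + l}|lebesgue. v t))"
  have le: "(1 / l) * (LINT t:{\<xi>..\<xi> + l}|lebesgue. v t) \<le> s" for \<xi>
    unfolding s_def by (rule cSUP_upper[OF _ bdd]) simp
  have "s < \<eta>"
  proof (rule ccontr)
    assume "\<not> s < \<eta>"
    then have "\<eta> powr (1 / p) \<le> s powr (1 / p)" using \<eta> p by (intro powr_mono2) auto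
    then show False using less unfolding s_def by simp
  qed
  then have "(1 / l) * (LINT t:{\<xi>..\<xi> + l}|lebesgue. v t) \<le> \<eta>" using le[of \<xi>] by linarith
  then have "(LINT t:{\<xi>..\<xi> + l}|lebesgue. v t) \<le> \<eta> * l" using l by (simp add: divide_le_eq)
  then show ?thesis unfolding eq by (rule ennreal_leI)
qed

lemma SUP_powr_le_if_nn_window_le:
  fixes v :: "real \<Rightarrow> real"
  assumes v: "v \<in> borel_measurable lebesgue" "\<And>t. 0 \<le> v t" and p: "p > 0" and l: "l > 0" and c: "c \<ge> 0"
    and le: "\<And>\<xi>. nn_window (\<lambda>t. ennreal (v t)) \<xi> l \<le> ennreal (c * l)"
  shows "(SUP \<xi>. (1 / l) * (LINT t:{\<xi>..\<xi> + l}|lebesgue. v t)) powr (1 / p) \<le> c powr (1 / p)"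
proof -
  have int_le: "(1 / l) * (LINT t:{\<xi>..\<xi> + l}|lebesgue. v t) \<le> c" for \<xi>
  proof -
    have meas: "(\<lambda>t. indicator {\<xi>..\<xi> + l} t *\<^sub>R v t) \<in> borel_measurable lebesgue" by (rule scaleR_indicator_Icc_measurable[OF v(1)])
    have nn: "AE t in lebesgue. 0 \<le> indicator {\<xi>..\<xi> + l} t *\<^sub>R v t" using v(2) by (intro AE_I2) (simp add: indicator_def)
    have "(LINT t:{\<xi>..\<xi> + l}|lebesgue. v t) = enn2real (\<integral>\<^sup>+t. ennreal (indicator {\<xi>..\<xi> + l} t *\<^sub>R v t) \<partial>lebesgue)"
      unfolding set_lebesgue_integral_def by (rule integral_eq_nn_integral[OF meas nn])
    also have "(\<integral>\<^sup>+t. ennreal (indicator {\<xi>..\<xi> + l} t *\<^sub>R v t) \<partial>lebesgue) = nn_window (\<lambda>t. ennreal (v t)) \<xi> l"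
      unfolding nn_window_def by (rule nn_integral_cong) (auto simp: indicator_def)
    also have "enn2real \<dots> \<le> enn2real (ennreal (c * l))" by (rule enn2real_mono[OF le]) simp
    also have "\<dots> = c * l" using c l by simp
    finally show ?thesis using l by (simp add: divide_le_eq)
  qed
  have nonneg: "0 \<le> (1 / l) * (LINT t:{0..0 + l}|lebesgue. v t)"
    unfolding set_lebesgue_integral_def using v(2) l
    by (intro mult_nonneg_nonneg Bochner_Integration.integral_nonneg) (simp_all add: indicator_def)
  have bdd: "bdd_above (range (\<lambda>\<xi>. (1 / l) * (LINT t:{\<xi>..\<xi> + l}|lebesgue. v t)))"
    by (rule bdd_aboveI2[OF int_le])
  have "0 \<le> (SUP \<xi>. (1 / l) * (LINT t:{\<xi>..\<xi> + l}|lebesgue. v t))"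
    using nonneg cSUP_upper[OF UNIV_I bdd, of 0] by (rule order_trans)
  moreover have "(SUP \<xi>. (1 / l) * (LINT t:{\<xi>..\<xi> + l}|lebesgue. v t)) \<le> c"
    by (rule cSUP_least) (use int_le in auto)
  ultimately show ?thesis using p by (intro powr_mono2) auto
qed

lemma ennreal_mult_add:
  "0 \<le> a \<Longrightarrow> 0 \<le> b \<Longrightarrow> 0 \<le> c \<Longrightarrow> ennreal a * (ennreal b + ennreal c) = ennreal (a * (b + c))"
  by (simp add: ennreal_mult' ennreal_plus[symmetric] del: ennreal_plus)

lemma powr_add_le:
  fixes a b p :: real
  assumes "0 \<le> a" "0 \<le> b" "0 \<le> p"
  shows "(a + b) powr p \<le> 2 powr p * (a powr p + b powr p)"
proof -
  have "(a + b) powr p \<le> (2 * max a b) powr p" using assms by (intro powr_mono2) auto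
  also have "\<dots> = 2 powr p * max a b powr p" using assms by (simp add: powr_mult)
  also have "max a b powr p \<le> a powr p + b powr p" by (simp add: max_def)
  finally show ?thesis by simp
qed

text \<open>The measurability known for kernels concerns the truncated distance, whereas p-th powers
  involve the distance itself.\<close>

lemma (in pseudometric) shift_dist_measurable:
  assumes f: "f \<in> measurable_funs X d"
  shows "(\<lambda>t. d (f t) (f (t + \<tau>))) \<in> borel_measurable lebesgue"
proof -
  have fX: "f t \<in> X" for t using f by (auto simp: measurable_funs_def)
  obtain y J where y: "\<And>n j. y n j \<in> X" and J: "\<And>n. J n \<in> measurable lebesgue (count_space (UNIV :: nat set))"
    and ae: "\<And>n. AE t in lebesgue. d (f t) (y n (J n t)) < 1 / real (Suc n)"
    using approximating_sequence[OF f] by blast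
  show ?thesis
  proof (rule AE_limit_measurable[where w = "\<lambda>n t. d (f (t + \<tau>)) (y n (J n t))"])
    show "(\<lambda>t. d (f (t + \<tau>)) (y n (J n t))) \<in> borel_measurable lebesgue" for n
      by (rule measurable_compose_countable[OF borel_measurable_translate[OF section_measurable[OF f y]] J])
    show "AE t in lebesgue. \<bar>d (f t) (f (t + \<tau>)) - d (f (t + \<tau>)) (y n (J n t))\<bar> \<le> 1 / real (Suc n)" for n
      using ae[of n]
    proof eventually_elim
      case (elim t)
      then show ?case
        using abs_diff_le[OF fX[of t] y[of n "J n t"] fX[of "t + \<tau>"]] sym[OF y[of n "J n t"] fX[of "t + \<tau>"]] by linarith
    qed
  qed
qed

context pseudometric
begin

context
  fixes F :: "real \<Rightarrow> 'x" and x0 :: 'x and p :: real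
  assumes F: "F \<in> weyl_ap_p X d x0 p" and x0: "x0 \<in> X" and p: "p \<ge> 1"
begin

lemma Mp_F: "F \<in> Mp_funs X d x0 p" and meas_F: "F \<in> measurable_funs X d"
  using F by (auto simp: weyl_ap_p_def Mp_funs_def)

lemma F_in: "F t \<in> X"
  using meas_F by (auto simp: measurable_funs_def)

lemma radius_measurable: "(\<lambda>t. d (F t) x0) \<in> borel_measurable lebesgue"
  by (rule section_measurable[OF meas_F x0])

lemma unit_window_bound: "\<exists>K\<ge>0. \<forall>\<xi>. nn_window (\<lambda>t. ennreal (d (F t) x0 powr p)) \<xi> 1 \<le> ennreal (K * 1)"
proof -
  define S where "S = (SUP \<xi>::real. \<integral>\<^sup>+t\<in>{\<xi>..\<xi> + 1}. ennreal (d (F t) x0 powr p) \<partial>lebesgue)"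
  have "S < \<infinity>" unfolding S_def using Mp_F by (simp add: Mp_funs_def)
  then obtain K where K: "K \<ge> 0" "S = ennreal K" by (cases S) auto
  have "nn_window (\<lambda>t. ennreal (d (F t) x0 powr p)) \<xi> 1 \<le> ennreal (K * 1)" for \<xi>
    unfolding nn_window_def K(2)[symmetric] mult_1_right S_def by (rule SUP_upper) simp
  then show ?thesis using K(1) by blast
qed

lemma radius_window_finite: "\<exists>K. \<forall>\<xi>. nn_window (\<lambda>t. ennreal (d (F t) x0 powr p)) \<xi> l \<le> ennreal K"
proof -
  obtain K where K: "K \<ge> 0" "\<And>\<xi>. nn_window (\<lambda>t. ennreal (d (F t) x0 powr p)) \<xi> 1 \<le> ennreal (K * 1)"
    using unit_window_bound by blast
  have meas: "(\<lambda>t. ennreal (d (F t) x0 powr p)) \<in> borel_measurable lebesgue"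
    using radius_measurable by measurable
  have "nn_window (\<lambda>t. ennreal (d (F t) x0 powr p)) \<xi> l \<le> ennreal (2 * K * max 1 l)" for \<xi>
  proof -
    have "nn_window (\<lambda>t. ennreal (d (F t) x0 powr p)) \<xi> l \<le> nn_window (\<lambda>t. ennreal (d (F t) x0 powr p)) \<xi> (max 1 l)"
      by (rule nn_window_interval_mono) auto
    also have "\<dots> \<le> ennreal (2 * K * max 1 l)" by (rule nn_window_scale[OF meas _ K]) auto
    finally show ?thesis .
  qed
  then show ?thesis by blast
qed

text \<open>With this finiteness the integrals and the supremum in \<open>weyl_dist_p\<close> are
  genuine, as \<open>nn_window_le_if_SUP_less\<close> requires.\<close>

lemma shift_window_finite: "\<exists>K. \<forall>\<xi>. nn_window (\<lambda>t. ennreal (d (F t) (F (t + \<tau>)) powr p)) \<xi> l \<le> ennreal K"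
proof -
  obtain K where K: "\<And>\<xi>. nn_window (\<lambda>t. ennreal (d (F t) x0 powr p)) \<xi> l \<le> ennreal K"
    using radius_window_finite by blast
  define r where "r = (\<lambda>t. ennreal (d (F t) x0 powr p))"
  have meas [measurable]: "r \<in> borel_measurable lebesgue" unfolding r_def using radius_measurable by measurable
  have meas' [measurable]: "(\<lambda>t. r (t + \<tau>)) \<in> borel_measurable lebesgue" by (rule borel_measurable_translate[OF meas])
  have "nn_window (\<lambda>t. ennreal (d (F t) (F (t + \<tau>)) powr p)) \<xi> l \<le> ennreal (2 powr p * (max 0 K + max 0 K))" for \<xi>
  proof -
    have "ennreal (d (F t) (F (t + \<tau>)) powr p) \<le> ennreal (2 powr p) * (r t + r (t + \<tau>))" for t
    proof -
      have "d (F t) (F (t + \<tau>)) powr p \<le> (d (F t) x0 + d (F (t + \<tau>)) x0) powr p"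
        using triangle[OF F_in x0 F_in, of t "t + \<tau>"] sym[OF x0 F_in, of "t + \<tau>"] nonneg[OF F_in F_in] p
        by (intro powr_mono2) auto
      also have "\<dots> \<le> 2 powr p * (d (F t) x0 powr p + d (F (t + \<tau>)) x0 powr p)"
        using nonneg[OF F_in x0] p by (intro powr_add_le) auto
      finally have "ennreal (d (F t) (F (t + \<tau>)) powr p) \<le> ennreal (2 powr p * (d (F t) x0 powr p + d (F (t + \<tau>)) x0 powr p))"
        by (rule ennreal_leI)
      then show ?thesis by (simp add: r_def ennreal_mult')
    qed
    then have "nn_window (\<lambda>t. ennreal (d (F t) (F (t + \<tau>)) powr p)) \<xi> l \<le> nn_window (\<lambda>t. ennreal (2 powr p) * (r t + r (t + \<tau>))) \<xi> l"
      by (intro nn_window_mono_AE AE_I2)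
    also have "\<dots> = ennreal (2 powr p) * (nn_window r \<xi> l + nn_window (\<lambda>t. r (t + \<tau>)) \<xi> l)"
      by (subst nn_window_cmult, measurable) (simp add: nn_window_add)
    also have "nn_window (\<lambda>t. r (t + \<tau>)) \<xi> l = nn_window r (\<xi> + \<tau>) l" by (rule nn_window_shift[OF meas])
    also have "ennreal (2 powr p) * (nn_window r \<xi> l + nn_window r (\<xi> + \<tau>) l)
        \<le> ennreal (2 powr p) * (ennreal (max 0 K) + ennreal (max 0 K))"
    proof -
      have "nn_window r \<zeta> l \<le> ennreal (max 0 K)" for \<zeta>
        unfolding r_def by (rule order_trans[OF K ennreal_leI]) simp
      then show ?thesis by (intro mult_left_mono add_mono) auto
    qed
    also have "\<dots> = ennreal (2 powr p * (max 0 K + max 0 K))"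
      by (rule ennreal_mult_add) auto
    finally show ?thesis .
  qed
  then show ?thesis by blast
qed

text \<open>Uniform integrability: large values are controlled on one reference window and transported
  from there by almost periods.\<close>

lemma uniformly_integrable:
  assumes \<epsilon>: "\<epsilon> > 0"
  shows "\<exists>B>0. \<exists>L>0. \<forall>l\<ge>L. \<forall>\<xi>.
    nn_window (\<lambda>t. ennreal (d (F t) x0 powr p) * indicator {t. B < d (F t) x0} t) \<xi> l \<le> ennreal (\<epsilon> * l)"
proof -
  define w where "w = (\<lambda>t. d (F t) x0)"
  have w_meas [measurable]: "w \<in> borel_measurable lebesgue" unfolding w_def by (rule radius_measurable)
  have w_nonneg: "0 \<le> w t" for t unfolding w_def by (rule nonneg[OF F_in x0])
  \<comment> \<open>Two terms \<eta> * l with the factor 2 powr p give \<epsilon> / 2 * l on windows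
    of length l; passing to longer windows doubles the density to \<epsilon>.\<close>
  define \<eta> where "\<eta> = \<epsilon> / (4 * 2 powr p)"
  have \<eta>: "\<eta> > 0" unfolding \<eta>_def using \<epsilon> by simp
  have "\<eta> powr (1 / p) > 0" using \<eta> by simp
  then obtain l where l: "l > 0" "relatively_dense {\<tau>. weyl_dist_p d p l F (\<lambda>t. F (t + \<tau>)) < \<eta> powr (1 / p)}"
    using F unfolding weyl_ap_p_def by blast
  then obtain a where a: "a > 0" "\<And>\<xi>. {\<xi>..\<xi> + a} \<inter> {\<tau>. weyl_dist_p d p l F (\<lambda>t. F (t + \<tau>)) < \<eta> powr (1 / p)} \<noteq> {}"
    unfolding relatively_dense_def by blast
  define G where "G = (\<lambda>\<tau> t. d (F t) (F (t + \<tau>)))"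
  have G_meas [measurable]: "G \<tau> \<in> borel_measurable lebesgue" for \<tau> unfolding G_def by (rule shift_dist_measurable[OF meas_F])
  have G_nonneg: "0 \<le> G \<tau> t" for \<tau> t unfolding G_def by (rule nonneg[OF F_in F_in])
  have G_window: "nn_window (\<lambda>t. ennreal (G \<tau> t powr p)) \<xi> l \<le> ennreal (\<eta> * l)"
    if \<tau>: "weyl_dist_p d p l F (\<lambda>t. F (t + \<tau>)) < \<eta> powr (1 / p)" for \<tau> \<xi>
  proof -
    obtain K where K: "\<And>\<xi>. nn_window (\<lambda>t. ennreal (G \<tau> t powr p)) \<xi> l \<le> ennreal K"
      using shift_window_finite unfolding G_def by blast
    show ?thesis
    proof (rule nn_window_le_if_SUP_less[OF _ _ _ l(1) \<eta> K])
      show "(\<lambda>t. G \<tau> t powr p) \<in> borel_measurable lebesgue" by measurable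
      show "(SUP \<xi>. (1 / l) * (LINT t:{\<xi>..\<xi> + l}|lebesgue. G \<tau> t powr p)) powr (1 / p) < \<eta> powr (1 / p)"
        using \<tau> unfolding weyl_dist_p_def G_def .
    qed (use p in auto)
  qed
  define T where "T = (\<lambda>B t. ennreal (w t powr p) * indicator {t. B < w t} t)"
  have T_sets: "{t. B < w t} \<in> sets lebesgue" for B
    using measurable_sets[OF w_meas, of "{B<..}"] by (simp add: vimage_def)
  have T_meas [measurable]: "T B \<in> borel_measurable lebesgue" for B
    unfolding T_def by (intro borel_measurable_times_ennreal borel_measurable_indicator T_sets) measurable
  have "(\<lambda>n. nn_window (T (real n)) 0 (a + l)) \<longlonglongrightarrow> (\<integral>\<^sup>+t. 0 \<partial>(lebesgue :: real measure))"
    unfolding nn_window_def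
  proof (rule nn_integral_dominated_convergence[where w = "\<lambda>t. ennreal (w t powr p) * indicator {0..0 + (a + l)} t"])
    show "(\<lambda>t. T (real n) t * indicator {0..0 + (a + l)} t) \<in> borel_measurable lebesgue" for n
      by (rule mult_indicator_Icc_measurable[OF T_meas])
    show "(\<lambda>t. ennreal (w t powr p) * indicator {0..0 + (a + l)} t) \<in> borel_measurable lebesgue"
      by (rule mult_indicator_Icc_measurable) measurable
    show "AE t in lebesgue. T (real n) t * indicator {0..0 + (a + l)} t \<le> ennreal (w t powr p) * indicator {0..0 + (a + l)} t" for n
      by (rule AE_I2) (auto simp: T_def indicator_def)
    obtain K where "nn_window (\<lambda>t. ennreal (w t powr p)) 0 (a + l) \<le> ennreal K"
      using radius_window_finite unfolding w_def by blast
    then show "(\<integral>\<^sup>+t. ennreal (w t powr p) * indicator {0..0 + (a + l)} t \<partial>lebesgue) < \<infinity>"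
      unfolding nn_window_def by (rule order_le_less_trans) simp
    show "AE t in lebesgue. (\<lambda>n. T (real n) t * indicator {0..0 + (a + l)} t) \<longlonglongrightarrow> 0"
    proof (rule AE_I2)
      fix t
      obtain N where "w t \<le> real N" using real_arch_simple by blast
      then have "eventually (\<lambda>n. T (real n) t * indicator {0..0 + (a + l)} t = 0) sequentially"
        unfolding eventually_sequentially T_def by (intro exI[of _ N]) (auto simp: indicator_def)
      then show "(\<lambda>n. T (real n) t * indicator {0..0 + (a + l)} t) \<longlonglongrightarrow> 0" by (rule tendsto_eventually)
    qed
  qed simp
  then have "(\<lambda>n. nn_window (T (real n)) 0 (a + l)) \<longlonglongrightarrow> 0" by simp
  moreover have "ennreal (\<eta> * l) > 0" using \<eta> l(1) by simp
  ultimately have "eventually (\<lambda>n. nn_window (T (real n)) 0 (a + l) < ennreal (\<eta> * l)) sequentially"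
    by (rule order_tendstoD(2))
  then obtain n where n: "nn_window (T (real n)) 0 (a + l) < ennreal (\<eta> * l)"
    unfolding eventually_sequentially by blast
  \<comment> \<open>If w t exceeds B while w (t + \<tau>) \<le> n, then \<open>G \<tau> t\<close>
    exceeds half of w t, so G alone bounds the large value.\<close>
  define B where "B = 2 * real n + 1"
  have base: "nn_window (T B) \<xi> l \<le> ennreal ((\<epsilon> / 2) * l)" for \<xi>
  proof -
    obtain \<tau> where \<tau>: "\<tau> \<in> {- \<xi>..- \<xi> + a}" "weyl_dist_p d p l F (\<lambda>t. F (t + \<tau>)) < \<eta> powr (1 / p)"
      using a(2)[of "- \<xi>"] by blast
    have shift_meas [measurable]: "(\<lambda>t. T (real n) (t + \<tau>)) \<in> borel_measurable lebesgue"
      by (rule borel_measurable_translate[OF T_meas])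
    have "T B t \<le> ennreal (2 powr p) * (T (real n) (t + \<tau>) + ennreal (G \<tau> t powr p))" for t
    proof (cases "B < w t")
      case True
      have tri: "w t \<le> G \<tau> t + w (t + \<tau>)"
        unfolding w_def G_def by (rule triangle[OF F_in F_in x0])
      have "w t powr p \<le> 2 powr p * (indicator {t. real n < w t} (t + \<tau>) * w (t + \<tau>) powr p + G \<tau> t powr p)"
      proof (cases "real n < w (t + \<tau>)")
        case True
        have "w t powr p \<le> (G \<tau> t + w (t + \<tau>)) powr p" using tri w_nonneg p by (intro powr_mono2) auto
        also have "\<dots> \<le> 2 powr p * (G \<tau> t powr p + w (t + \<tau>) powr p)"
          using w_nonneg G_nonneg p by (intro powr_add_le) auto
        finally show ?thesis using True by (simp add: add.commute)
      next
        case False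
        then have "w t \<le> 2 * G \<tau> t" using tri \<open>B < w t\<close> unfolding B_def by linarith
        then have "w t powr p \<le> (2 * G \<tau> t) powr p" using w_nonneg p by (intro powr_mono2) auto
        then show ?thesis using False G_nonneg by (simp add: powr_mult)
      qed
      then have "ennreal (w t powr p) \<le> ennreal (2 powr p * (indicator {t. real n < w t} (t + \<tau>) * w (t + \<tau>) powr p + G \<tau> t powr p))"
        by (rule ennreal_leI)
      also have "\<dots> = ennreal (2 powr p) * (T (real n) (t + \<tau>) + ennreal (G \<tau> t powr p))"
        by (cases "real n < w (t + \<tau>)") (simp_all add: T_def ennreal_mult')
      finally show ?thesis using True by (simp add: T_def)
    qed (simp add: T_def)
    then have "nn_window (T B) \<xi> l \<le> nn_window (\<lambda>t. ennreal (2 powr p) * (T (real n) (t + \<tau>) + ennreal (G \<tau> t powr p))) \<xi> l"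
      by (intro nn_window_mono_AE AE_I2)
    also have "\<dots> = ennreal (2 powr p) * (nn_window (\<lambda>t. T (real n) (t + \<tau>)) \<xi> l + nn_window (\<lambda>t. ennreal (G \<tau> t powr p)) \<xi> l)"
      by (subst nn_window_cmult, measurable) (simp add: nn_window_add)
    also have "\<dots> \<le> ennreal (2 powr p) * (ennreal (\<eta> * l) + ennreal (\<eta> * l))"
    proof (intro mult_left_mono add_mono)
      have "nn_window (\<lambda>t. T (real n) (t + \<tau>)) \<xi> l = nn_window (T (real n)) (\<xi> + \<tau>) l" by (rule nn_window_shift[OF T_meas])
      also have "\<dots> \<le> nn_window (T (real n)) 0 (a + l)" by (rule nn_window_interval_mono) (use \<tau>(1) in auto)
      also have "\<dots> \<le> ennreal (\<eta> * l)" using n by simp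
      finally show "nn_window (\<lambda>t. T (real n) (t + \<tau>)) \<xi> l \<le> ennreal (\<eta> * l)" .
      show "nn_window (\<lambda>t. ennreal (G \<tau> t powr p)) \<xi> l \<le> ennreal (\<eta> * l)" by (rule G_window[OF \<tau>(2)])
    qed simp
    also have "\<dots> = ennreal (2 powr p * (\<eta> * l + \<eta> * l))"
      using \<eta> l(1) by (intro ennreal_mult_add) auto
    also have "2 powr p * (\<eta> * l + \<eta> * l) = (\<epsilon> / 2) * l"
      unfolding \<eta>_def by (simp add: field_simps)
    finally show ?thesis .
  qed
  have "nn_window (T B) \<xi> l' \<le> ennreal (\<epsilon> * l')" if "l' \<ge> l" for l' \<xi>
    using nn_window_scale[OF T_meas l(1) _ base that, of \<xi>] \<epsilon> by simp
  moreover have "B > 0" unfolding B_def by simp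
  ultimately show ?thesis using l(1) unfolding T_def w_def by blast
qed

end

end

text \<open>Vitali's principle. Membership in \<open>F t\<close> bounds the distance from f t to
  \<open>x0\<close> by that from \<open>F t\<close> to \<open>A0\<close> plus a constant, so the
  p-th powers for f inherit uniform integrability from F. Since f is almost periodic in measure, its
  shift deviations are small in p-th mean.\<close>

lemma (in Metric_space) weyl_ap_p_selection:
  assumes f: "f \<in> weyl_ap M d" and F: "F \<in> weyl_ap_p (clb_sets M d) (hausdorff_dist d) A0 p"
    and sel: "AE t in lebesgue. f t \<in> F t" and p: "p \<ge> 1" and A0: "A0 \<in> clb_sets M d" and x0: "x0 \<in> M"
  shows "f \<in> weyl_ap_p M d x0 p"
proof -
  interpret pt: pseudometric M d by (rule pseudometric_Metric_space) (rule Metric_space_axioms)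
  interpret fam: hausdorff_family M d "clb_sets M d" by (rule hausdorff_family_clb_sets)
  interpret hd: pseudometric "clb_sets M d" "hausdorff_dist d" by (rule fam.pseudometric_hausdorff)
  have f_meas: "f \<in> measurable_funs M d" and f_ap: "ap_kernel (time_kernel d f)"
    using f pt.weyl_ap_iff by blast+
  interpret ker: ap_kernel "time_kernel d f" by (rule f_ap)
  have f_in: "f t \<in> M" for t using f_meas by (auto simp: measurable_funs_def)
  note F_in = hd.F_in[OF F A0 p]
  define w where "w = (\<lambda>t. hausdorff_dist d (F t) A0)"
  have w_meas [measurable]: "w \<in> borel_measurable lebesgue" unfolding w_def by (rule hd.radius_measurable[OF F A0 p])
  have w_nonneg: "0 \<le> w t" for t unfolding w_def by (rule hd.nonneg[OF F_in A0])
  obtain y0 R where R: "A0 \<subseteq> mcball y0 R" using A0 by (auto simp: clb_sets_def mbounded_def)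
  obtain a0 where a0: "a0 \<in> A0" using fam.nonempty[OF A0] by blast
  have "y0 \<in> M" "d y0 a0 \<le> R" using R a0 by auto
  moreover have "0 \<le> d y0 a0" by simp
  ultimately have y0: "y0 \<in> M" "0 \<le> R" by linarith+
  \<comment> \<open>The summand 1 pays for a point of \<open>A0\<close> that only nearly attains the
    distance; R and \<open>d y0 x0\<close> lead from there to \<open>x0\<close>.\<close>
  define C where "C = 1 + R + d y0 x0"
  have C: "C \<ge> 1" unfolding C_def using y0 by simp
  have near: "AE t in lebesgue. d (f t) x0 \<le> w t + C"
    using sel
  proof eventually_elim
    case (elim t)
    have "point_set_dist d (f t) A0 \<le> w t"
      unfolding w_def by (rule fam.point_set_dist_le_hausdorff[OF F_in A0 elim])
    then have "point_set_dist d (f t) A0 < w t + 1" by simp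
    then obtain a where a: "a \<in> A0" "d (f t) a < w t + 1"
      using pt.point_set_dist_lessD[OF f_in fam.subset[OF A0] fam.nonempty[OF A0]] by blast
    have aM: "a \<in> M" "d a y0 \<le> R" using R a(1) commute[of a y0] by auto
    have "d (f t) x0 \<le> d (f t) a + (d a y0 + d y0 x0)"
      using triangle[OF f_in[of t] aM(1) x0] triangle[OF aM(1) y0(1) x0] by linarith
    then show ?case using a(2) aM(2) unfolding C_def by linarith
  qed
  have Mp: "f \<in> Mp_funs M d x0 p"
  proof -
    obtain K where K: "K \<ge> 0" "\<And>\<xi>. nn_window (\<lambda>t. ennreal (w t powr p)) \<xi> 1 \<le> ennreal (K * 1)"
      using hd.unit_window_bound[OF F A0 p] unfolding w_def by blast
    have "nn_window (\<lambda>t. ennreal (d (f t) x0 powr p)) \<xi> 1 \<le> ennreal (2 powr p * (K + C powr p))" for \<xi>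
    proof -
      have "AE t in lebesgue. ennreal (d (f t) x0 powr p) \<le> ennreal (2 powr p) * (ennreal (w t powr p) + ennreal (C powr p))"
        using near
      proof eventually_elim
        case (elim t)
        have "d (f t) x0 powr p \<le> (w t + C) powr p" using elim p by (intro powr_mono2) auto
        also have "\<dots> \<le> 2 powr p * (w t powr p + C powr p)" using w_nonneg C p by (intro powr_add_le) auto
        finally show ?case by (subst ennreal_mult_add) (auto intro: ennreal_leI)
      qed
      then have "nn_window (\<lambda>t. ennreal (d (f t) x0 powr p)) \<xi> 1
          \<le> nn_window (\<lambda>t. ennreal (2 powr p) * (ennreal (w t powr p) + ennreal (C powr p))) \<xi> 1"
        by (rule nn_window_mono_AE)
      also have "\<dots> = ennreal (2 powr p) * (nn_window (\<lambda>t. ennreal (w t powr p)) \<xi> 1 + ennreal (C powr p))"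
        by (subst nn_window_cmult, measurable) (simp add: nn_window_add nn_window_const)
      also have "\<dots> \<le> ennreal (2 powr p) * (ennreal K + ennreal (C powr p))"
        using K(2)[of \<xi>] by (intro mult_left_mono add_right_mono) auto
      also have "\<dots> = ennreal (2 powr p * (K + C powr p))" by (rule ennreal_mult_add) (use K(1) in auto)
      finally show ?thesis .
    qed
    then have "(SUP \<xi>::real. \<integral>\<^sup>+t\<in>{\<xi>..\<xi> + 1}. ennreal (d (f t) x0 powr p) \<partial>lebesgue) \<le> ennreal (2 powr p * (K + C powr p))"
      unfolding nn_window_def by (intro SUP_least)
    also have "\<dots> < \<infinity>" by simp
    finally show ?thesis using f_meas by (simp add: Mp_funs_def)
  qed
  have "\<exists>l>0. relatively_dense {\<tau>. weyl_dist_p d p l f (\<lambda>t. f (t + \<tau>)) < \<epsilon>}" if \<epsilon>: "\<epsilon> > 0" for \<epsilon>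
  proof -
    \<comment> \<open>Half of \<epsilon>, because only a non-strict bound on the supremum is
      obtained.\<close>
    define c where "c = (\<epsilon> / 2) powr p"
    have c: "c > 0" "c powr (1 / p) = \<epsilon> / 2" unfolding c_def using \<epsilon> p by (auto simp: powr_powr)
    define \<epsilon>1 where "\<epsilon>1 = c / (8 * 4 powr p)"
    have \<epsilon>1: "\<epsilon>1 > 0" "4 powr p * (2 * \<epsilon>1) = c / 4" unfolding \<epsilon>1_def using c by auto
    obtain B0 L where B0: "B0 > 0" "L > 0"
      and ui: "\<And>l \<xi>. l \<ge> L \<Longrightarrow> nn_window (\<lambda>t. ennreal (w t powr p) * indicator {t. B0 < w t} t) \<xi> l \<le> ennreal (\<epsilon>1 * l)"
      using hd.uniformly_integrable[OF F A0 p \<epsilon>1(1)] unfolding w_def by blast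
    \<comment> \<open>If the deviation v t exceeds B, the larger of w t and w (t + \<tau>), called m
      below, exceeds both B0 and C. Then v t \<le> 4 * m, and m is one of the large values
      controlled by \<open>ui\<close>.\<close>
    define B where "B = 2 * C + 2 * max B0 C"
    have B: "B > 0" unfolding B_def using C by simp
    \<comment> \<open>Small deviations contribute at most \<delta> to the mean, and moderate ones at
      most B powr p on a set of density \<delta>.\<close>
    define \<delta> where "\<delta> = min 1 (c / (4 * (1 + B powr p)))"
    have Bp: "1 + B powr p > 0" by (simp add: add_pos_nonneg)
    have \<delta>: "\<delta> > 0" "\<delta> \<le> 1" "(1 + B powr p) * \<delta> \<le> c / 4"
    proof -
      show "\<delta> > 0" unfolding \<delta>_def using c Bp by simp
      show "\<delta> \<le> 1" unfolding \<delta>_def by simp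
      have "(1 + B powr p) * \<delta> \<le> (1 + B powr p) * (c / (4 * (1 + B powr p)))"
        unfolding \<delta>_def using Bp by (intro mult_left_mono) auto
      also have "\<dots> = c / 4"
      proof -
        have "q * (c / (4 * q)) = c / 4" if "q > 0" for q :: real using that by simp
        from this[OF Bp] show ?thesis .
      qed
      finally show "(1 + B powr p) * \<delta> \<le> c / 4" .
    qed
    obtain l1 where l1: "l1 > 0" "relatively_dense {\<tau>. almost_period (time_kernel d f) l1 (\<delta> / 2) \<tau>}"
      using ker.almost_periodic[of "\<delta> / 2"] \<delta>(1) by auto
    define l where "l = max l1 L"
    have l: "l > 0" "l1 \<le> l" "L \<le> l" unfolding l_def using l1 by auto
    define T where "T = (\<lambda>t. ennreal (w t powr p) * indicator {t. B0 < w t} t)"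
    have T_sets: "{t. B0 < w t} \<in> sets lebesgue"
      using measurable_sets[OF w_meas, of "{B0<..}"] by (simp add: vimage_def)
    have T_meas [measurable]: "T \<in> borel_measurable lebesgue"
      unfolding T_def by (intro borel_measurable_times_ennreal borel_measurable_indicator T_sets) measurable
    have "weyl_dist_p d p l f (\<lambda>t. f (t + \<tau>)) < \<epsilon>" if \<tau>: "almost_period (time_kernel d f) l1 (\<delta> / 2) \<tau>" for \<tau>
    proof -
      define v where "v = (\<lambda>t. d (f t) (f (t + \<tau>)))"
      have v_meas [measurable]: "v \<in> borel_measurable lebesgue" unfolding v_def by (rule pt.shift_dist_measurable[OF f_meas])
      have v_nonneg: "0 \<le> v t" for t by (simp add: v_def)
      define E where "E = {t. \<delta> \<le> time_kernel d f t (t + \<tau>)}"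
      have E_sets: "E \<in> sets lebesgue" unfolding E_def by (rule ker.deviation_sets)
      have "almost_period (time_kernel d f) l \<delta> \<tau>"
        using ker.almost_period_scale[OF \<tau> l1(1) l(2)] by simp
      then have E_window: "window E \<xi> l \<le> \<delta> * l" for \<xi> unfolding E_def by (simp add: almost_period_def)
      have T_shift [measurable]: "(\<lambda>t. T (t + \<tau>)) \<in> borel_measurable lebesgue" by (rule borel_measurable_translate[OF T_meas])
      have E_ind [measurable]: "(indicator E :: real \<Rightarrow> ennreal) \<in> borel_measurable lebesgue"
        by (rule borel_measurable_indicator[OF E_sets])
      \<comment> \<open>One summand for each of the regimes v < \<delta>, \<delta> \<le> v \<le> B
        and v > B.\<close>
      define b where "b = (\<lambda>t. ennreal \<delta> + (ennreal (B powr p) * indicator E t + ennreal (4 powr p) * (T t + T (t + \<tau>))))"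
      have "AE t in lebesgue. ennreal (v t powr p) \<le> b t"
        using near AE_translate[OF near, of \<tau>]
      proof eventually_elim
        case (elim t)
        consider "v t < \<delta>" | "\<delta> \<le> v t" "v t \<le> B" | "B < v t" by linarith
        then show ?case
        proof cases
          case 1
          have "v t powr p \<le> \<delta> powr p" using 1 v_nonneg p by (intro powr_mono2) auto
          also have "\<dots> \<le> \<delta> powr 1" using \<delta> p by (intro powr_mono') auto
          also have "\<dots> = \<delta>" using \<delta> by simp
          finally have "ennreal (v t powr p) \<le> ennreal \<delta>" by (rule ennreal_leI)
          also have "\<dots> \<le> b t" unfolding b_def by simp
          finally show ?thesis .
        next
          case 2
          have "t \<in> E" unfolding E_def time_kernel_def trunc_dist_def using 2(1) \<delta>(2) by (simp add: v_def)
          have "v t powr p \<le> B powr p" using 2 v_nonneg p by (intro powr_mono2) auto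
          then have "ennreal (v t powr p) \<le> ennreal (B powr p) * indicator E t" using \<open>t \<in> E\<close> by (simp add: ennreal_leI)
          also have "\<dots> \<le> ennreal (B powr p) * indicator E t + ennreal (4 powr p) * (T t + T (t + \<tau>))" by simp
          also have "\<dots> \<le> b t" unfolding b_def by simp
          finally show ?thesis .
        next
          case 3
          define m where "m = max (w t) (w (t + \<tau>))"
          have "v t \<le> d (f t) x0 + d (f (t + \<tau>)) x0"
            unfolding v_def using triangle[OF f_in[of t] x0 f_in[of "t + \<tau>"]] commute[of x0 "f (t + \<tau>)"] by simp
          then have vm: "v t \<le> 2 * C + 2 * m" using elim unfolding m_def by linarith
          then have m: "max B0 C < m" using 3 unfolding B_def by linarith
          have "v t powr p \<le> (4 * m) powr p" using vm m v_nonneg p by (intro powr_mono2) auto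
          also have "\<dots> = 4 powr p * m powr p" using m C by (simp add: powr_mult)
          finally have "ennreal (v t powr p) \<le> ennreal (4 powr p) * ennreal (m powr p)"
            by (simp add: ennreal_mult'[symmetric] ennreal_leI)
          also have "ennreal (m powr p) \<le> T t + T (t + \<tau>)"
          proof (cases "w t \<le> w (t + \<tau>)")
            case True
            then have "T (t + \<tau>) = ennreal (m powr p)" using m unfolding T_def m_def by simp
            then show ?thesis by simp
          next
            case False
            then have "T t = ennreal (m powr p)" using m unfolding T_def m_def by simp
            then show ?thesis by simp
          qed
          then have "ennreal (4 powr p) * ennreal (m powr p) \<le> ennreal (4 powr p) * (T t + T (t + \<tau>))" by (rule mult_left_mono) simp
          also have "\<dots> \<le> ennreal (B powr p) * indicator E t + ennreal (4 powr p) * (T t + T (t + \<tau>))" by simp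
          also have "\<dots> \<le> b t" unfolding b_def by simp
          finally show ?thesis .
        qed
      qed
      then have 1: "nn_window (\<lambda>t. ennreal (v t powr p)) \<xi> l \<le> nn_window b \<xi> l" for \<xi> by (rule nn_window_mono_AE)
      have 2: "nn_window b \<xi> l \<le> ennreal (c * l)" for \<xi>
      proof -
        have "nn_window b \<xi> l = nn_window (\<lambda>t. ennreal \<delta>) \<xi> l + (nn_window (\<lambda>t. ennreal (B powr p) * indicator E t) \<xi> l
            + nn_window (\<lambda>t. ennreal (4 powr p) * (T t + T (t + \<tau>))) \<xi> l)"
          unfolding b_def by (simp add: nn_window_add)
        also have "\<dots> = ennreal \<delta> * ennreal l + (ennreal (B powr p) * ennreal (window E \<xi> l)
            + ennreal (4 powr p) * (nn_window T \<xi> l + nn_window T (\<xi> + \<tau>) l))"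
          using l(1) by (simp add: nn_window_const nn_window_cmult nn_window_add nn_window_indicator[OF E_sets] nn_window_shift)
        also have "\<dots> \<le> ennreal \<delta> * ennreal l + (ennreal (B powr p) * ennreal (\<delta> * l)
            + ennreal (4 powr p) * (ennreal (\<epsilon>1 * l) + ennreal (\<epsilon>1 * l)))"
          using E_window ui[OF l(3)] unfolding T_def
          by (intro add_mono mult_left_mono ennreal_leI) auto
        also have "\<dots> = ennreal (\<delta> * l + (B powr p * (\<delta> * l) + 4 powr p * (\<epsilon>1 * l + \<epsilon>1 * l)))"
        proof -
          have nn: "0 \<le> \<delta> * l" "0 \<le> B powr p * (\<delta> * l)" "0 \<le> \<epsilon>1 * l" "0 \<le> 4 powr p * (\<epsilon>1 * l + \<epsilon>1 * l)"
            using \<delta>(1) l(1) \<epsilon>1(1) by auto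
          have "ennreal \<delta> * ennreal l = ennreal (\<delta> * l)"
            by (rule ennreal_mult'[symmetric]) (use \<delta>(1) in simp)
          moreover have "ennreal (B powr p) * ennreal (\<delta> * l) = ennreal (B powr p * (\<delta> * l))"
            by (rule ennreal_mult'[symmetric]) simp
          moreover have "ennreal (4 powr p) * (ennreal (\<epsilon>1 * l) + ennreal (\<epsilon>1 * l)) = ennreal (4 powr p * (\<epsilon>1 * l + \<epsilon>1 * l))"
            by (rule ennreal_mult_add) (use nn(3) in auto)
          ultimately show ?thesis
            by (simp only: ennreal_plus[symmetric] nn add_nonneg_nonneg)
        qed
        also have "\<delta> * l + (B powr p * (\<delta> * l) + 4 powr p * (\<epsilon>1 * l + \<epsilon>1 * l))
            = ((1 + B powr p) * \<delta> + 4 powr p * (2 * \<epsilon>1)) * l" by (simp add: algebra_simps)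
        also have "ennreal \<dots> \<le> ennreal (c * l)"
          using \<delta>(3) \<epsilon>1(2) c l by (intro ennreal_leI mult_right_mono) auto
        finally show ?thesis .
      qed
      have "weyl_dist_p d p l f (\<lambda>t. f (t + \<tau>)) \<le> c powr (1 / p)"
        unfolding weyl_dist_p_def
      proof (rule SUP_powr_le_if_nn_window_le)
        show "(\<lambda>t. d (f t) (f (t + \<tau>)) powr p) \<in> borel_measurable lebesgue" using v_meas unfolding v_def by measurable
        show "nn_window (\<lambda>t. ennreal (d (f t) (f (t + \<tau>)) powr p)) \<xi> l \<le> ennreal (c * l)" for \<xi>
          using order_trans[OF 1 2] unfolding v_def .
      qed (use p l c in auto)
      then show ?thesis using c(2) \<epsilon> by simp
    qed
    then have "relatively_dense {\<tau>. weyl_dist_p d p l f (\<lambda>t. f (t + \<tau>)) < \<epsilon>}"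
      by (intro relatively_dense_mono[OF l1(2)]) blast
    then show ?thesis using l(1) by blast
  qed
  then show ?thesis using Mp by (simp add: weyl_ap_p_def)
qed

text \<open>A class with bounded values may be represented by an F that is unbounded on a null set,
  so membership in the space of degree p is asked of some F' equal to F almost everywhere. One and
  the same f serves all p and all base points.\<close>

theorem theorem1p3:
  fixes U :: "'a set" and \<rho> :: "'a \<Rightarrow> 'a \<Rightarrow> real"
    and F :: "real \<Rightarrow> 'a set" and g :: "real \<Rightarrow> 'a" and \<eta> :: "real \<Rightarrow> real"
  assumes "Metric_space U \<rho>" and "Metric_space.mcomplete U \<rho>"
    and "F \<in> weyl_ap (cl_sets U \<rho>) (hausdorff_dist (trunc_dist \<rho>))"
    and "g \<in> weyl_ap U \<rho>"
    and "\<eta> \<in> gauge_funs"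
  shows "\<exists>f \<in> weyl_ap U \<rho>.
      Mod \<rho> f \<subseteq> module_sum (Mod (hausdorff_dist (trunc_dist \<rho>)) F) (Mod \<rho> g) \<and>
      (AE t in lebesgue. f t \<in> F t) \<and>
      (AE t in lebesgue.
         \<rho> (f t) (g t) \<le> point_set_dist \<rho> (g t) (F t) + \<eta> (point_set_dist \<rho> (g t) (F t))) \<and>
      (\<forall>p\<ge>1. \<forall>A0 \<in> clb_sets U \<rho>. \<forall>x0 \<in> U.
         (\<exists>F' \<in> weyl_ap_p (clb_sets U \<rho>) (hausdorff_dist \<rho>) A0 p. AE t in lebesgue. F' t = F t)
         \<longrightarrow> f \<in> weyl_ap_p U \<rho> x0 p)"
proof -
  interpret selection_problem U \<rho> F g
    by (rule selection_problem.intro[OF assms(1) selection_problem_axioms.intro]) (fact assms)+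
  obtain f where f: "f \<in> measurable_funs U \<rho>" "kernel_controlled e (time_kernel \<rho> f)"
    and sel: "AE t in lebesgue. f t \<in> F t"
    and near: "AE t in lebesgue. \<rho> (f t) (g t) \<le> gap t + \<eta> (gap t)"
    using selection[OF assms(5)] by (elim exE conjE) (rule that)
  have "ap_kernel (time_kernel \<rho> f)"
    by (rule controlled_ap_kernel[OF ker.ap_kernel_axioms point.kernel_time_kernel[OF f(1)] f(2)])
  then have f_ap: "f \<in> weyl_ap U \<rho>" using f(1) point.weyl_ap_iff by blast
  have Mod: "Mod \<rho> f \<subseteq> module_sum (Mod (hausdorff_dist (trunc_dist \<rho>)) F) (Mod \<rho> g)"
    by (rule Mod_subset_module_sum[OF setdist.pseudometric_axioms point.pseudometric_axioms
          point.pseudometric_axioms assms(3,4) f(1) f(2)[unfolded e_eq]])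
  have "f \<in> weyl_ap_p U \<rho> x0 p"
    if "p \<ge> 1" "A0 \<in> clb_sets U \<rho>" "x0 \<in> U"
      "F' \<in> weyl_ap_p (clb_sets U \<rho>) (hausdorff_dist \<rho>) A0 p" "AE t in lebesgue. F' t = F t" for p A0 x0 F'
  proof (rule weyl_ap_p_selection[OF f_ap that(4) _ that(1,2,3)])
    show "AE t in lebesgue. f t \<in> F' t"
      using sel that(5) by eventually_elim simp
  qed
  then show ?thesis using f_ap Mod sel near unfolding gap_def by (intro bexI[of _ f] conjI) blast+
qed

end
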